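(* Fix $d\ge1$ and consider the directed once-edge-reinforced random walk on $\mathbb{Z}^d$ with translation-invariant finite-range initial weights $w_0$ satisfying $\sum_x x\,w_0(0,x)\ne0$. There exists $\beta_0=\beta_0(d,w_0)>0$ such that for every $\beta$ with $|\beta|\le\beta_0$ there exist $\theta=\theta(\beta,w_0,d)\in[-L,L]^d$ and a finite matrix $\Sigma=\Sigma(\beta,w_0,d)$ such that, as $n\to\infty$: (a) $\mathbb{E}_\beta[\omega_n]=\theta n\,[1+O(\tfrac1n)]$; (b) $\mathrm{Var}_\beta(\omega_n)=\Sigma n\,[1+O(\tfrac1n)]$; (c) under $\mathbb{Q}_\beta$, $\dfrac{\omega_n-\theta n}{\sqrt n}$ converges in distribution to $\mathcal{N}(0,\Sigma)$.
   Context: Directed once-edge-reinforced random walk with drift. Initial weights $w_0(x,y)\ge0$ on directed edges $(x,y)$ of $\mathbb{Z}^d$ are translation invariant ($w_0(x,y)=w_0(0,y-x)$), not identically zero, and of finite range $L$ ($w_0(0,x)=0$ if $|x|>L$). The walk starts at $\omega_0=0$. Let $\beta$ be a real reinforcement parameter (possibly negative, provided $w_0(b)+\beta$ stays bounded away from $0$ on edges with $w_0(b)>0$). The weight of the directed edge $b$ at time $t$ is $w_t(b)=w_0(b)+\beta\,I_{\{b \text{ has been traversed by time } t\}}$, i.e. the weight is increased by $\beta$ the first time $b$ is traversed and never changes afterwards. Given the history $\vec\omega_i=(x_0,\dots,x_i)$, the probability of stepping from $x_i$ to $x_{i+1}$ is $w_i(x_i,x_{i+1})/\sum_y w_i(x_i,y)$.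 $\mathbb{Q}_\beta$ denotes the law of this walk, $\mathbb{E}_\beta$ its expectation, and $\mathrm{Var}_\beta(\omega_n)$ the covariance matrix of the random vector $\omega_n$ under $\mathbb{Q}_\beta$. $\mathcal{N}(0,\Sigma)$ is the centred multivariate normal law with covariance matrix $\Sigma$. For a vector or matrix $v$, $v_n=vn[1+O(\epsilon_n)]$ means $|v_n-vn|=O(n\epsilon_n)$ as $n\to\infty$. *)

theory Defs
  imports "HOL-Probability.Probability" "HOL-Library.Landau_Symbols"
begin

section \<open>The directed once-edge-reinforced random walk on $\mathbb{Z}^d$\<close>

text \<open>The lattice $\mathbb{Z}^d$ is the type \<open>int ^ 'd\<close> with \<open>d = CARD('d)\<close>; \<open>rvec\<close> is its
  inclusion into $\mathbb{R}^d$.\<close>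

definition rvec :: "int ^ 'd \<Rightarrow> real ^ 'd" where
  "rvec x = (\<chi> i. real_of_int (x $ i))"

definition translation_invariant :: "(int ^ 'd \<Rightarrow> int ^ 'd \<Rightarrow> real) \<Rightarrow> bool" where
  "translation_invariant w0 \<longleftrightarrow> (\<forall>x y. w0 x y = w0 0 (y - x))"

definition finite_range :: "real \<Rightarrow> (int ^ 'd::finite \<Rightarrow> int ^ 'd \<Rightarrow> real) \<Rightarrow> bool" where
  "finite_range L w0 \<longleftrightarrow> (\<forall>x. norm (rvec x) > L \<longrightarrow> w0 0 x = 0)"

definition drift :: "(int ^ 'd::finite \<Rightarrow> int ^ 'd \<Rightarrow> real) \<Rightarrow> real ^ 'd" where
  "drift w0 = (\<Sum>\<^sub>\<infinity>x. w0 0 x *\<^sub>R rvec x)"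

text \<open>A path is a function \<open>\<omega>\<close> of time; the following notions at time \<open>t\<close> only look at
  \<open>\<omega> 0, \<dots>, \<omega> t\<close>.\<close>

definition traversed :: "(nat \<Rightarrow> 'v) \<Rightarrow> nat \<Rightarrow> 'v \<Rightarrow> 'v \<Rightarrow> bool" where
  "traversed \<omega> t x y \<longleftrightarrow> (\<exists>s<t. \<omega> s = x \<and> \<omega> (Suc s) = y)"

definition weight :: "('v \<Rightarrow> 'v \<Rightarrow> real) \<Rightarrow> real \<Rightarrow> (nat \<Rightarrow> 'v) \<Rightarrow> nat \<Rightarrow> 'v \<Rightarrow> 'v \<Rightarrow> real" where
  "weight w0 \<beta> \<omega> t x y = w0 x y + \<beta> * of_bool (traversed \<omega> t x y)"

definition step_prob :: "('v \<Rightarrow> 'v \<Rightarrow> real) \<Rightarrow> real \<Rightarrow> (nat \<Rightarrow> 'v) \<Rightarrow> nat \<Rightarrow> 'v \<Rightarrow> real" where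
  "step_prob w0 \<beta> \<omega> t y =
     weight w0 \<beta> \<omega> t (\<omega> t) y / (\<Sum>\<^sub>\<infinity>z. weight w0 \<beta> \<omega> t (\<omega> t) z)"

text \<open>Law of \<open>\<omega> n\<close> given \<open>\<omega> 0, \<dots>, \<omega> (n - 1)\<close>.  \<open>embed_pmf\<close> is meaningful only if its argument
  is a probability mass function (see \<open>pmf_walk_kernel\<close> below), i.e. for \<open>w0 + \<beta>\<close> positive where
  \<open>w0\<close> is, and histories that only use edges of positive initial weight.\<close>

fun walk_kernel ::
  "(int ^ 'd \<Rightarrow> int ^ 'd \<Rightarrow> real) \<Rightarrow> real \<Rightarrow> nat \<Rightarrow> (nat \<Rightarrow> int ^ 'd) \<Rightarrow> (int ^ 'd) pmf" where
  "walk_kernel w0 \<beta> 0 \<omega> = return_pmf 0"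
| "walk_kernel w0 \<beta> (Suc t) \<omega> = embed_pmf (step_prob w0 \<beta> \<omega> t)"

lemma traversed_cong:
  assumes "\<And>s. s \<le> t \<Longrightarrow> \<omega> s = \<omega>' s"
  shows "traversed \<omega> t = traversed \<omega>' t"
proof -
  have "(\<omega> s = x \<and> \<omega> (Suc s) = y) = (\<omega>' s = x \<and> \<omega>' (Suc s) = y)" if "s < t" for s x y
    using that assms[of s] assms[of "Suc s"] by simp
  then show ?thesis
    unfolding traversed_def fun_eq_iff by blast
qed

lemma walk_kernel_cong:
  assumes "\<And>s. s < n \<Longrightarrow> \<omega> s = \<omega>' s"
  shows "walk_kernel w0 \<beta> n \<omega> = walk_kernel w0 \<beta> n \<omega>'"
proof (cases n)
  case (Suc t)
  then have "traversed \<omega> t = traversed \<omega>' t"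
    using assms by (intro traversed_cong) simp
  moreover have "\<omega> t = \<omega>' t"
    using assms Suc by simp
  ultimately show ?thesis
    using Suc by (simp add: step_prob_def[abs_def] weight_def[abs_def])
qed simp

lemma pmf_walk_kernel:
  fixes w0 :: "int ^ 'd::finite \<Rightarrow> int ^ 'd \<Rightarrow> real"
  assumes nonneg: "\<And>x y. w0 x y \<ge> 0"
    and pos: "\<And>x y. w0 x y > 0 \<Longrightarrow> w0 x y + \<beta> > 0"
    and fin: "finite {y. w0 (\<omega> t) y \<noteq> 0}" and ne: "\<exists>y. w0 (\<omega> t) y \<noteq> 0"
    and hist: "\<And>s. s < t \<Longrightarrow> w0 (\<omega> s) (\<omega> (Suc s)) > 0"
  shows "pmf (walk_kernel w0 \<beta> (Suc t) \<omega>) y = step_prob w0 \<beta> \<omega> t y"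
proof -
  let ?w = "weight w0 \<beta> \<omega> t (\<omega> t)"
  let ?S = "{y. w0 (\<omega> t) y \<noteq> 0}"
  have zero: "?w y = 0" if "y \<notin> ?S" for y
  proof -
    have "\<not> traversed \<omega> t (\<omega> t) y"
      using hist that by (force simp: traversed_def)
    with that show ?thesis by (simp add: weight_def)
  qed
  have wpos: "?w y > 0" if "y \<in> ?S" for y
    using that nonneg[of "\<omega> t" y] pos[of "\<omega> t" y]
    by (cases "traversed \<omega> t (\<omega> t) y") (auto simp: weight_def)
  have wnn: "?w y \<ge> 0" for y
    using zero[of y] wpos[of y] by (cases "y \<in> ?S") auto
  have tot: "(\<Sum>\<^sub>\<infinity>z. ?w z) = (\<Sum>z\<in>?S. ?w z)"
  proof -
    have "(\<Sum>\<^sub>\<infinity>z. ?w z) = (\<Sum>\<^sub>\<infinity>z\<in>?S. ?w z)"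
      by (rule infsum_cong_neutral) (use zero in auto)
    then show ?thesis using fin by simp
  qed
  have totpos: "(\<Sum>z\<in>?S. ?w z) > 0"
    using fin ne wpos by (intro sum_pos) auto
  have snn: "step_prob w0 \<beta> \<omega> t z \<ge> 0" for z
    using wnn totpos by (simp add: step_prob_def tot)
  have "(\<integral>\<^sup>+z. ennreal (step_prob w0 \<beta> \<omega> t z) \<partial>count_space UNIV)
      = (\<Sum>z\<in>?S. ennreal (step_prob w0 \<beta> \<omega> t z))"
    using fin zero by (intro nn_integral_count_space') (auto simp: step_prob_def)
  also have "\<dots> = ennreal (\<Sum>z\<in>?S. step_prob w0 \<beta> \<omega> t z)"
    using snn by simp
  also have "(\<Sum>z\<in>?S. step_prob w0 \<beta> \<omega> t z) = 1"
    using totpos by (simp add: step_prob_def tot sum_divide_distrib[symmetric])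
  finally show ?thesis
    using snn by (simp add: pmf_embed_pmf)
qed

interpretation walk: Ionescu_Tulcea
  "\<lambda>n \<omega>. measure_pmf (walk_kernel (w0 :: int ^ 'd::finite \<Rightarrow> int ^ 'd \<Rightarrow> real) \<beta> n \<omega>)"
  "\<lambda>_. count_space UNIV"
  for w0 \<beta>
proof
  fix i :: nat
  have "PiM {0..<i} (\<lambda>_. count_space (UNIV :: (int ^ 'd) set)) = count_space (PiE {0..<i} (\<lambda>_. UNIV))"
    by (rule count_space_PiM_finite) auto
  then show "(\<lambda>\<omega>. measure_pmf (walk_kernel w0 \<beta> i \<omega>))
      \<in> PiM {0..<i} (\<lambda>_. count_space UNIV) \<rightarrow>\<^sub>M subprob_algebra (count_space UNIV)"
    by (simp add: space_subprob_algebra measure_pmf.subprob_space_axioms)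
qed

text \<open>The law $\mathbb{Q}_\beta$ on path space, by the Ionescu-Tulcea theorem.\<close>

definition walk_law ::
  "(int ^ 'd::finite \<Rightarrow> int ^ 'd \<Rightarrow> real) \<Rightarrow> real \<Rightarrow> (nat \<Rightarrow> int ^ 'd) measure" where
  "walk_law w0 \<beta> = walk.PF.lim w0 \<beta>"

lemma space_walk_law [simp]: "space (walk_law w0 \<beta>) = UNIV"
  by (simp add: walk_law_def space_PiM)

lemma sets_walk_law [measurable_cong]:
  "sets (walk_law w0 \<beta>) = sets (PiM UNIV (\<lambda>_. count_space UNIV))"
  by (simp add: walk_law_def)

lemma emeasure_walk_C:
  fixes w0 :: "int ^ 'd::finite \<Rightarrow> int ^ 'd \<Rightarrow> real"
  shows "emeasure (walk.C w0 \<beta> 0 n (\<lambda>_. undefined)) {restrict x {0..<n}}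
    = (\<Prod>t<n. ennreal (pmf (walk_kernel w0 \<beta> t x) (x t)))"
proof (induction n)
  case 0
  show ?case by (simp add: PiM_empty)
next
  case (Suc m)
  let ?M = "\<lambda>n. PiM {0..<n} (\<lambda>_. count_space (UNIV :: (int ^ 'd) set))"
  let ?C = "\<lambda>n. walk.C w0 \<beta> 0 n (\<lambda>_. undefined)"
  have M: "?M n = count_space (PiE {0..<n} (\<lambda>_. UNIV))" for n :: nat
    by (rule count_space_PiM_finite) auto
  have sp: "space (?C m) = space (?M m)" and se: "sets (?C m) = sets (?M m)"
    using walk.space_C[of "\<lambda>_. undefined" 0 w0 \<beta> m] walk.sets_C[of "\<lambda>_. undefined" 0 w0 \<beta> m] by auto
  let ?x = "\<lambda>n. restrict x {0..<n}"
  have A: "{?x (Suc m)} \<in> sets (?M (Suc m))"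
    by (auto simp: M)
  have eP: "emeasure (walk.eP w0 \<beta> m \<omega>) {?x (Suc m)}
      = ennreal (pmf (walk_kernel w0 \<beta> m x) (x m)) * indicator {?x m} \<omega>"
    if \<omega>: "\<omega> \<in> space (?M m)" for \<omega>
  proof -
    have ext: "\<omega> \<in> extensional {0..<m}"
      using \<omega> by (auto simp: space_PiM PiE_iff)
    have eq: "emeasure (walk.eP w0 \<beta> m \<omega>) {?x (Suc m)}
        = emeasure (walk_kernel w0 \<beta> m \<omega>) {v. fun_upd \<omega> m v = ?x (Suc m)}"
      using walk.emeasure_eP[OF \<omega> A] by (simp add: vimage_def)
    show ?thesis
    proof (cases "\<omega> = ?x m")
      case True
      have "{v. fun_upd \<omega> m v = ?x (Suc m)} = {x m}"
        unfolding True by (auto simp: fun_eq_iff restrict_def)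
      moreover have "walk_kernel w0 \<beta> m \<omega> = walk_kernel w0 \<beta> m x"
        unfolding True by (rule walk_kernel_cong) simp
      ultimately show ?thesis
        using eq True by (simp add: emeasure_pmf_single)
    next
      case False
      then obtain i where i: "i < m" "\<omega> i \<noteq> x i"
        using extensionalityI[OF ext restrict_extensional, of x] by force
      then have "{v. fun_upd \<omega> m v = ?x (Suc m)} = {}"
        by (auto simp: fun_eq_iff intro!: exI[of _ i])
      then show ?thesis using eq False by simp
    qed
  qed
  have ne: "space (?C m) \<noteq> {}"
    unfolding sp by simp
  have "emeasure (?C (Suc m)) {?x (Suc m)} = (\<integral>\<^sup>+\<omega>. emeasure (walk.eP w0 \<beta> m \<omega>) {?x (Suc m)} \<partial>?C m)"
  proof -
    have "walk.eP w0 \<beta> m \<in> ?C m \<rightarrow>\<^sub>M subprob_algebra (?M (Suc m))"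
      using walk.measurable_eP[of w0 \<beta> m] by (simp add: measurable_cong_sets[OF se refl])
    from emeasure_bind[OF ne this A] show ?thesis by simp
  qed
  also have "\<dots> = (\<integral>\<^sup>+\<omega>. ennreal (pmf (walk_kernel w0 \<beta> m x) (x m)) * indicator {?x m} \<omega> \<partial>?C m)"
    by (rule nn_integral_cong) (simp add: sp eP)
  also have "\<dots> = ennreal (pmf (walk_kernel w0 \<beta> m x) (x m)) * emeasure (?C m) {?x m}"
    by (rule nn_integral_cmult_indicator) (simp add: se M)
  finally show ?case
    by (simp add: Suc mult.commute del: restrict_apply)
qed

lemma emeasure_walk_law_cylinder:
  fixes w0 :: "int ^ 'd::finite \<Rightarrow> int ^ 'd \<Rightarrow> real"
  shows "emeasure (walk_law w0 \<beta>) {\<omega>. \<forall>t<n. \<omega> t = x t}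
    = (\<Prod>t<n. ennreal (pmf (walk_kernel w0 \<beta> t x) (x t)))"
proof -
  let ?N = "\<lambda>_. count_space (UNIV :: (int ^ 'd) set)"
  let ?x = "restrict x {0..<n}"
  have M: "PiM {0..<n} ?N = count_space (PiE {0..<n} (\<lambda>_. UNIV))"
    by (rule count_space_PiM_finite) auto
  have A: "{?x} \<in> sets (PiM {0..<n} ?N)"
    by (auto simp: M)
  have emb: "{\<omega>. \<forall>t<n. \<omega> t = x t} = prod_emb UNIV ?N {0..<n} {?x}"
    by (auto simp: prod_emb_def space_PiM fun_eq_iff restrict_def split: if_splits)
  have id: "prod_emb {0..<n} ?N {0..<n} {?x} = {?x}"
    by (rule prod_emb_id) auto
  show ?thesis
    unfolding emb walk_law_def
    using walk.lim[OF _ A, of w0 \<beta>] walk.emeasure_CI[OF order_refl A, of w0 \<beta>] emeasure_walk_C[of w0 \<beta> n x]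
    by (simp add: id)
qed

section \<open>Moments, the multivariate normal law and convergence in distribution\<close>

definition mean_vector :: "'a measure \<Rightarrow> ('a \<Rightarrow> real ^ 'd::finite) \<Rightarrow> real ^ 'd" where
  "mean_vector M X = (\<integral>\<omega>. X \<omega> \<partial>M)"

definition covariance_matrix :: "'a measure \<Rightarrow> ('a \<Rightarrow> real ^ 'd::finite) \<Rightarrow> real ^ 'd ^ 'd" where
  "covariance_matrix M X =
     (\<chi> i j. \<integral>\<omega>. (X \<omega> $ i - mean_vector M X $ i) * (X \<omega> $ j - mean_vector M X $ j) \<partial>M)"

text \<open>$\mathcal{N}(0,\Sigma)$ is the law of \<open>A *v Z\<close> for independent standard normal coordinates
  \<open>Z\<close> and any \<open>A\<close> with \<open>A ** transpose A = \<Sigma>\<close>; \<open>\<Sigma>\<close> may be singular, so there need not be a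
  density.\<close>

definition std_normal_vector_law :: "(real ^ 'd::finite) measure" where
  "std_normal_vector_law =
     distr (PiM UNIV (\<lambda>_ :: 'd. std_normal_distribution)) borel (\<lambda>z. \<chi> i. z i)"

definition is_centred_normal_law :: "real ^ 'd ^ 'd \<Rightarrow> (real ^ 'd::finite) measure \<Rightarrow> bool" where
  "is_centred_normal_law \<Sigma> \<mu> \<longleftrightarrow>
     (\<exists>A :: real ^ 'd ^ 'd. A ** transpose A = \<Sigma> \<and> \<mu> = distr std_normal_vector_law borel (\<lambda>z. A *v z))"

text \<open>\<open>weak_conv_m\<close> only covers measures on the real line.\<close>

definition converges_weakly :: "(nat \<Rightarrow> 'a::topological_space measure) \<Rightarrow> 'a measure \<Rightarrow> bool" where
  "converges_weakly \<mu> \<nu> \<longleftrightarrow>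
     (\<forall>f :: 'a \<Rightarrow> real. continuous_on UNIV f \<and> bounded (range f) \<longrightarrow>
        (\<lambda>n. \<integral>x. f x \<partial>\<mu> n) \<longlonglongrightarrow> (\<integral>x. f x \<partial>\<nu>))"

text \<open>\<open>linear_asymp v u \<epsilon>\<close> renders $v_n = u\,n\,[1 + O(\epsilon_n)]$, an absolute error bound
  $|v_n - u n| = O(n \epsilon_n)$.\<close>

definition linear_asymp :: "(nat \<Rightarrow> 'a::real_normed_vector) \<Rightarrow> 'a \<Rightarrow> (nat \<Rightarrow> real) \<Rightarrow> bool" where
  "linear_asymp v u \<epsilon> \<longleftrightarrow> (\<lambda>n. norm (v n - real n *\<^sub>R u)) \<in> O(\<lambda>n. real n * \<epsilon> n)"

end

theory Submission
  imports Defs "HOL-Real_Asymp.Real_Asymp"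
begin

text \<open>For small \<open>\<beta>\<close> every step law of the reinforced walk is a mixture: with probability \<open>1 - e\<close> the step
follows one fixed law with positive drift, whatever the history, and with probability \<open>e\<close> it follows
a law depending on the edges already used at the present site (\<open>mixture_noise\<close>,
\<open>small_reinforcement_noise\<close>).  Hence the walk can be built from i.i.d. noise \<open>u 0, u 1, \<dots>\<close> in such
a way that, along the drift direction, step \<open>i\<close> advances by at least \<open>Z (u i)\<close>, where the \<open>Z (u i)\<close>
are i.i.d., bounded and of positive mean (\<open>walk_law_eq\<close> identifies the law).

A step looks into the past only through earlier visits to the present site, and the walk can revisit
a site only after an interval of time over which the \<open>Z\<close> sum to at most \<open>0\<close>.  Say that \<open>c\<close> is a cut
before time \<open>n\<close> if \<open>Z (u s) + \<dots> + Z (u (t - 1)) > 0\<close> whenever \<open>s < c \<le> t \<le> n\<close>.  From a cut on, the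
walk moves as if it had started afresh there (\<open>walk_after_cut\<close>).  So the walk started at time \<open>0\<close> and
the walk started at time \<open>r\<close> with the same noise make the same step at time \<open>n\<close> unless there is no
cut in \<open>[r, n]\<close>, and by \<open>cut_probability\<close> this has probability \<open>O((n - r + 1)\<^sup>-\<^sup>1\<^sup>0)\<close>: cuts seen
through windows of length \<open>\<surd>(n - r)\<close> occur independently in disjoint windows with probability bounded
below, and longer intervals have positive sum by a large deviation bound.

It remains to prove the limit theorems for a sum \<open>seg 0 n\<close> of such forgetful increments, one
direction at a time (\<open>forgetful_increments\<close>).  Compare \<open>seg 0 (n + m)\<close> with the independent sum of
\<open>seg 0 n\<close> and of the walk restarted at time \<open>n\<close>.  The difference, the defect, has bounded second moment,
and it is a sum of small terms depending on the noise near time \<open>n\<close> only, so that its covariance with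
an \<open>l\<close>-Lipschitz function of the independent sum is \<open>O(l)\<close> (\<open>cov_defect_Lipschitz\<close>).  Therefore mean
and variance are additive up to a bounded error, hence linear up to a bounded error, which is (a) and
(b); and the characteristic functions of the centred sums satisfy
\<open>\<phi> (n + m) s = \<phi> n s * \<phi> m s + O(s\<^sup>2)\<close>.  Gluing about \<open>n / b\<close> blocks of length \<open>b\<close> at \<open>s = 1 / \<surd>n\<close>
costs \<open>O(1 / b)\<close>, and each block is Gaussian to second order; \<open>n \<rightarrow> \<infinity>\<close> and then \<open>b \<rightarrow> \<infinity>\<close>
give the central limit theorem in each direction (\<open>increments_clt\<close>).

Finally \<open>\<Sigma>\<close> is recovered from the directional variances by polarization and factored as \<open>A A\<^sup>T\<close>
(\<open>psd_factorization\<close>), and characteristic functions together with tightness give weak convergence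
(\<open>weak_convergence_from_characteristic_functions\<close>).\<close>

section \<open>Functions of finitely many coordinates of an i.i.d. sequence\<close>

text \<open>The noise takes values in \<open>nat\<close>, a countable type, so that every function of finitely many coordinates
is measurable; independence is then read off from disjointness of coordinate sets.\<close>

definition depends_on :: "((nat \<Rightarrow> nat) \<Rightarrow> 'b) \<Rightarrow> nat set \<Rightarrow> bool" where
  "depends_on F A \<longleftrightarrow> (\<forall>u v. (\<forall>i\<in>A. u i = v i) \<longrightarrow> F u = F v)"

definition restart :: "nat \<Rightarrow> (nat \<Rightarrow> nat) \<Rightarrow> nat \<Rightarrow> nat" where
  "restart k u = (\<lambda>i. u (k + i))"

text \<open>Boundedness is included so that these functions are integrable and closed under products.\<close>

definition cylinder_fun :: "((nat \<Rightarrow> nat) \<Rightarrow> 'b::real_normed_vector) \<Rightarrow> bool" where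
  "cylinder_fun F \<longleftrightarrow> (\<exists>A. finite A \<and> depends_on F A) \<and> bounded (range F)"

lemma depends_onD: "depends_on F A \<Longrightarrow> (\<And>i. i \<in> A \<Longrightarrow> u i = v i) \<Longrightarrow> F u = F v"
  by (auto simp: depends_on_def)

lemma depends_onI: "(\<And>u v. (\<And>i. i \<in> A \<Longrightarrow> u i = v i) \<Longrightarrow> F u = F v) \<Longrightarrow> depends_on F A"
  unfolding depends_on_def by blast

lemma depends_on_mono: "depends_on F A \<Longrightarrow> A \<subseteq> B \<Longrightarrow> depends_on F B"
  unfolding depends_on_def by (meson subsetD)

lemma depends_on_comp: "depends_on F A \<Longrightarrow> depends_on (\<lambda>u. h (F u)) A"
  unfolding depends_on_def by metis

lemma depends_on_comp2:
  "depends_on F A \<Longrightarrow> depends_on G A \<Longrightarrow> depends_on (\<lambda>u. h (F u) (G u)) A"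
  unfolding depends_on_def by metis

lemma depends_on_sum: "(\<And>i. i \<in> I \<Longrightarrow> depends_on (F i) A) \<Longrightarrow> depends_on (\<lambda>u. \<Sum>i\<in>I. F i u) A"
  unfolding depends_on_def by (meson sum.cong)

lemma depends_on_coord: "i \<in> A \<Longrightarrow> depends_on (\<lambda>u. h (u i)) A"
  unfolding depends_on_def by auto

lemma depends_on_Ball:
  assumes "\<And>i. i \<in> I \<Longrightarrow> depends_on (F i) A"
  shows "depends_on (\<lambda>u. \<forall>i\<in>I. F i u) A"
  using assms unfolding depends_on_def by meson

lemma depends_on_restart:
  assumes "depends_on F {..<m}" shows "depends_on (\<lambda>u. F (restart k u)) {k..<k+m}"
  by (rule depends_onI, rule depends_onD[OF assms]) (auto simp: restart_def)

lemma restart_0 [simp]: "restart 0 u = u"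
  by (simp add: restart_def)

lemma restart_restart: "restart j (restart k u) = restart (k + j) u"
  by (simp add: restart_def add.assoc)

lemma cylinder_funI:
  assumes "depends_on F A" "finite A" "\<And>u. norm (F u) \<le> B" shows "cylinder_fun F"
  using assms unfolding cylinder_fun_def bounded_iff by auto

lemma cylinder_fun_bounds:
  "cylinder_fun F \<Longrightarrow> \<exists>A a. finite A \<and> depends_on F A \<and> (\<forall>u. norm (F u) \<le> a)"
  unfolding cylinder_fun_def bounded_iff by (simp add: ball_UNIV)

text \<open>A common source of the closure properties below: the monotone \<open>q\<close> turns norm bounds of \<open>F\<close> and
\<open>G\<close> into one of \<open>h (F u) (G u)\<close>.\<close>

lemma cylinder_fun_map2:
  assumes F: "cylinder_fun F" and G: "cylinder_fun G"
    and h: "\<And>a b. norm (h (F a) (G b)) \<le> q (norm (F a)) (norm (G b))"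
    and q: "\<And>a b a' b'. 0 \<le> a \<Longrightarrow> 0 \<le> b \<Longrightarrow> a \<le> a' \<Longrightarrow> b \<le> b' \<Longrightarrow> q a b \<le> (q a' b' :: real)"
  shows "cylinder_fun (\<lambda>u. h (F u) (G u))"
proof -
  obtain A a where A: "finite A" "depends_on F A" "\<forall>u. norm (F u) \<le> a"
    using cylinder_fun_bounds[OF F] by blast
  obtain B b where B: "finite B" "depends_on G B" "\<forall>u. norm (G u) \<le> b"
    using cylinder_fun_bounds[OF G] by blast
  show ?thesis
  proof (rule cylinder_funI[of _ "A \<union> B" "q a b"])
    show "depends_on (\<lambda>u. h (F u) (G u)) (A \<union> B)"
      by (rule depends_on_comp2[OF depends_on_mono[OF A(2)] depends_on_mono[OF B(2)]]) auto
    show "norm (h (F u) (G u)) \<le> q a b" for u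
      using order_trans[OF h q[OF norm_ge_zero norm_ge_zero A(3)[rule_format] B(3)[rule_format]]] .
  qed (use A B in auto)
qed

lemma cylinder_fun_const [simp]: "cylinder_fun (\<lambda>_. c)"
  by (rule cylinder_funI[of _ "{}" "norm c"]) (auto simp: depends_on_def)

lemma cylinder_fun_add: "cylinder_fun F \<Longrightarrow> cylinder_fun G \<Longrightarrow> cylinder_fun (\<lambda>u. F u + G u)"
  by (rule cylinder_fun_map2[where q = "\<lambda>a b. a + b"]) (auto intro: norm_triangle_ineq)

lemma cylinder_fun_diff: "cylinder_fun F \<Longrightarrow> cylinder_fun G \<Longrightarrow> cylinder_fun (\<lambda>u. F u - G u)"
  by (rule cylinder_fun_map2[where q = "\<lambda>a b. a + b"]) (auto intro: norm_triangle_ineq4)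

lemma cylinder_fun_mult:
  fixes F G :: "_ \<Rightarrow> 'b::real_normed_algebra"
  shows "cylinder_fun F \<Longrightarrow> cylinder_fun G \<Longrightarrow> cylinder_fun (\<lambda>u. F u * G u)"
  by (rule cylinder_fun_map2[where q = "\<lambda>a b. a * b"])
    (auto intro: norm_mult_ineq mult_mono)

lemma cylinder_fun_power:
  fixes F :: "_ \<Rightarrow> 'b::real_normed_algebra_1"
  shows "cylinder_fun F \<Longrightarrow> cylinder_fun (\<lambda>u. F u ^ n)"
  by (induction n) (auto intro: cylinder_fun_mult)

lemma cylinder_fun_sum:
  "(\<And>i. i \<in> I \<Longrightarrow> cylinder_fun (F i)) \<Longrightarrow> cylinder_fun (\<lambda>u. \<Sum>i\<in>I. F i u)"
  by (induction I rule: infinite_finite_induct) (auto intro: cylinder_fun_add)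

lemma cylinder_fun_comp:
  assumes "cylinder_fun F" "\<And>x. norm (h x) \<le> K + M * norm x" "M \<ge> 0"
  shows "cylinder_fun (\<lambda>u. h (F u))"
  using cylinder_fun_map2[OF assms(1,1), of "\<lambda>x _. h x" "\<lambda>x _. K + M * x"] assms(2,3)
  by (auto intro: mult_left_mono)

lemma cylinder_fun_restart:
  assumes "cylinder_fun F" shows "cylinder_fun (\<lambda>u. F (restart k u))"
proof -
  obtain A a where A: "finite A" "depends_on F A" "\<forall>u. norm (F u) \<le> a"
    using cylinder_fun_bounds[OF assms] by blast
  have "depends_on (\<lambda>u. F (restart k u)) ((+) k ` A)"
    by (rule depends_onI, rule depends_onD[OF A(2)]) (auto simp: restart_def)
  then show ?thesis using A by (intro cylinder_funI[of _ "(+) k ` A" a]) auto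
qed

lemmas cylinder_fun_intros = cylinder_fun_const cylinder_fun_add cylinder_fun_diff
  cylinder_fun_mult cylinder_fun_power cylinder_fun_sum cylinder_fun_restart

definition noise_law :: "nat pmf \<Rightarrow> (nat \<Rightarrow> nat) measure" where
  "noise_law N = PiM UNIV (\<lambda>_. measure_pmf N)"

locale iid_noise = fixes N :: "nat pmf"
begin

sublocale prob_space "noise_law N"
  unfolding noise_law_def by (rule prob_space_PiM) (rule prob_space_measure_pmf)

abbreviation P :: "(nat \<Rightarrow> nat) measure" where "P \<equiv> noise_law N"

lemma space_noise [simp]: "space P = UNIV"
  by (auto simp: noise_law_def space_PiM)

lemma sets_noise: "sets P = sets (PiM UNIV (\<lambda>_. count_space UNIV))"
  unfolding noise_law_def by (intro sets_PiM_cong) auto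

lemma measurable_restrict_noise:
  assumes "finite A"
  shows "(\<lambda>u. restrict u A) \<in> P \<rightarrow>\<^sub>M count_space (PiE A (\<lambda>_. UNIV))"
proof -
  have "(\<lambda>u. restrict u A) \<in> PiM UNIV (\<lambda>_. count_space UNIV) \<rightarrow>\<^sub>M PiM A (\<lambda>_. count_space (UNIV::nat set))"
    by (rule measurable_restrict_subset) simp
  also have "PiM A (\<lambda>_. count_space (UNIV::nat set)) = count_space (PiE A (\<lambda>_. UNIV))"
    by (rule count_space_PiM_finite) (use assms in auto)
  finally show ?thesis by (simp only: measurable_cong_sets[OF sets_noise refl])
qed

lemma depends_on_restrict: "depends_on F A \<Longrightarrow> F u = F (restrict u A)"
  by (rule depends_onD) auto

lemma measurable_depends_on:
  assumes "depends_on F A" "finite A" shows "F \<in> P \<rightarrow>\<^sub>M count_space UNIV"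
proof -
  have "F = F \<circ> (\<lambda>u. restrict u A)"
    using depends_on_restrict[OF assms(1)] by auto
  also have "\<dots> \<in> P \<rightarrow>\<^sub>M count_space UNIV"
    using measurable_comp[OF measurable_restrict_noise[OF assms(2)], of F "count_space UNIV"] by simp
  finally show ?thesis .
qed

lemma events_depends_on:
  assumes "depends_on F A" "finite A" shows "{u. F u} \<in> events"
proof -
  have "F -` {True} \<inter> space P \<in> events"
    by (rule measurable_sets[OF measurable_depends_on[OF assms]]) auto
  then show ?thesis by (simp add: vimage_def)
qed

lemma borel_depends_on:
  assumes "depends_on F A" "finite A" shows "F \<in> borel_measurable P"
proof -
  have "(\<lambda>x. x) \<circ> F \<in> borel_measurable P"
    using measurable_comp[OF measurable_depends_on[OF assms], of "\<lambda>x. x" borel] by simp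
  then show ?thesis by (simp add: o_def)
qed

lemma integrable_cylinder [intro]:
  fixes F :: "_ \<Rightarrow> 'b::{banach, second_countable_topology}"
  assumes "cylinder_fun F" shows "integrable P F"
proof -
  obtain A a where A: "finite A" "depends_on F A" "\<forall>u. norm (F u) \<le> a"
    using cylinder_fun_bounds[OF assms] by blast
  show ?thesis
    by (rule integrable_const_bound[of _ a]) (simp_all add: A(3) borel_depends_on[OF A(2,1)])
qed

lemma indep_coordinates: "indep_vars (\<lambda>_. count_space UNIV) (\<lambda>i u. u i) UNIV"
proof -
  have M: "PiM UNIV (\<lambda>_. measure_pmf N) = PiM UNIV (\<lambda>i. distr P (count_space UNIV) (\<lambda>u. u i))"
  proof (rule PiM_cong)
    fix i :: nat
    have "distr P (measure_pmf N) (\<lambda>u. u i) = measure_pmf N"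
      unfolding noise_law_def by (rule distr_PiM_component) (auto intro: prob_space_measure_pmf)
    moreover have "distr P (measure_pmf N) (\<lambda>u. u i) = distr P (count_space UNIV) (\<lambda>u. u i)"
      by (rule distr_cong) auto
    ultimately show "measure_pmf N = distr P (count_space UNIV) (\<lambda>u. u i)" by simp
  qed auto
  have "distr P (PiM UNIV (\<lambda>_. count_space UNIV)) (\<lambda>x. x) = P"
    by (rule distr_id2) (rule sets_noise[symmetric])
  then show ?thesis
    using M[symmetric] borel_depends_on
    by (subst indep_vars_iff_distr_eq_PiM')
      (auto simp: noise_law_def[symmetric] restrict_def intro!: measurable_depends_on[of _ "{i}" for i] depends_on_coord)
qed

lemma indep_depends_on:
  assumes F: "depends_on F A" "finite A" and G: "depends_on G B" "finite B" and AB: "A \<inter> B = {}"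
  shows "indep_var borel F borel G"
proof -
  have M: "PiM A (\<lambda>_. count_space (UNIV::nat set)) = count_space (PiE A (\<lambda>_. UNIV))"
    if "finite A" for A :: "nat set"
    by (rule count_space_PiM_finite) (use that in auto)
  have "indep_var (PiM A (\<lambda>_. count_space (UNIV::nat set))) (\<lambda>u. restrict u A)
                  (PiM B (\<lambda>_. count_space (UNIV::nat set))) (\<lambda>u. restrict u B)"
    using indep_var_restrict[OF indep_coordinates AB] by simp
  then have "indep_var borel (F \<circ> (\<lambda>u. restrict u A)) borel (G \<circ> (\<lambda>u. restrict u B))"
    by (rule indep_var_compose) (simp_all add: M F G)
  then show ?thesis
    using depends_on_restrict[OF F(1)] depends_on_restrict[OF G(1)] by (simp add: o_def)
qed

lemma expectation_mult_indep:
  fixes F G :: "_ \<Rightarrow> 'b::{real_normed_field, banach, second_countable_topology}"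
  assumes "depends_on F A" "finite A" "depends_on G B" "finite B" "A \<inter> B = {}"
    and "cylinder_fun F" "cylinder_fun G"
  shows "(\<integral>u. F u * G u \<partial>P) = (\<integral>u. F u \<partial>P) * (\<integral>u. G u \<partial>P)"
  by (rule indep_var_lebesgue_integral[OF indep_depends_on[OF assms(1-5)]]) (use assms in auto)

lemma prob_conj_indep:
  assumes "depends_on F A" "finite A" "depends_on G B" "finite B" "A \<inter> B = {}"
  shows "prob {u. F u \<and> G u} = prob {u. F u} * prob {u. G u}"
proof -
  have I: "(\<integral>u. of_bool (H u) \<partial>P) = prob {u. H u}" if "depends_on H C" "finite C" for H :: "_ \<Rightarrow> bool" and C
  proof -
    have "(\<integral>u. of_bool (H u) \<partial>P) = (\<integral>u. (indicator {u. H u} u :: real) \<partial>P)"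
      by (rule Bochner_Integration.integral_cong) (auto simp: indicator_def)
    then show ?thesis using events_depends_on[OF that] by simp
  qed
  have c: "cylinder_fun (\<lambda>u. of_bool (H u) :: real)" if "depends_on H C" "finite C" for H :: "_ \<Rightarrow> bool" and C
    by (rule cylinder_funI[OF depends_on_comp[OF that(1)] that(2), of _ 1]) auto
  have FG: "depends_on (\<lambda>u. F u \<and> G u) (A \<union> B)"
    by (rule depends_on_comp2[OF depends_on_mono[OF assms(1)] depends_on_mono[OF assms(3)]]) auto
  have "prob {u. F u \<and> G u} = (\<integral>u. of_bool (F u \<and> G u) \<partial>P)"
    using I[OF FG] assms by simp
  also have "\<dots> = (\<integral>u. of_bool (F u) * of_bool (G u) \<partial>P)"
    by (simp only: of_bool_conj)
  also have "\<dots> = (\<integral>u. of_bool (F u) \<partial>P) * (\<integral>u. of_bool (G u) \<partial>P)"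
    by (rule expectation_mult_indep[where A = A and B = B])
       (use assms c in \<open>auto intro: depends_on_comp\<close>)
  finally show ?thesis using I assms by simp
qed

lemma distr_restart: "distr P P (restart k) = P"
proof -
  have "distr (PiM UNIV (\<lambda>_. measure_pmf N)) (PiM UNIV (\<lambda>_. measure_pmf N)) (\<lambda>u. \<lambda>n\<in>UNIV. u (k + n))
      = PiM UNIV (\<lambda>_. measure_pmf N)"
    by (rule distr_PiM_reindex[where M = "\<lambda>_. measure_pmf N" and f = "\<lambda>n. k + n"]) (auto intro: prob_space_measure_pmf)
  then show ?thesis
    by (simp add: noise_law_def restart_def[abs_def] restrict_def)
qed

lemma measurable_restart [measurable]: "restart k \<in> P \<rightarrow>\<^sub>M P"
proof -
  have "restart k \<in> PiM UNIV (\<lambda>_. measure_pmf N) \<rightarrow>\<^sub>M PiM UNIV (\<lambda>_. measure_pmf N)"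
    unfolding restart_def[abs_def] by (rule measurable_PiM_single') (auto simp: space_PiM)
  then show ?thesis by (simp add: noise_law_def)
qed

lemma expectation_restart:
  fixes F :: "_ \<Rightarrow> 'b::{banach, second_countable_topology}"
  assumes "cylinder_fun F"
  shows "(\<integral>u. F (restart k u) \<partial>P) = (\<integral>u. F u \<partial>P)"
proof -
  have "F \<in> borel_measurable P"
    using integrable_cylinder[OF assms] by auto
  then have "(\<integral>u. F u \<partial>distr P P (restart k)) = (\<integral>u. F (restart k u) \<partial>P)"
    by (intro integral_distr) auto
  then show ?thesis by (simp add: distr_restart)
qed

lemma prob_restart:
  assumes "depends_on F A" "finite A"
  shows "prob {u. F (restart k u)} = prob {u. F u}"
proof -
  have "measure (distr P P (restart k)) {u. F u} = prob (restart k -` {u. F u} \<inter> space P)"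
    by (rule measure_distr) (use events_depends_on[OF assms] in auto)
  then show ?thesis by (simp add: distr_restart vimage_def)
qed

lemma prob_coordinate: "prob {u. u i \<in> S} = measure_pmf.prob N S"
proof -
  have "distr P (measure_pmf N) (\<lambda>u. u i) = measure_pmf N"
    unfolding noise_law_def by (rule distr_PiM_component) (auto intro: prob_space_measure_pmf)
  moreover have "(\<lambda>u. u i) \<in> P \<rightarrow>\<^sub>M measure_pmf N"
    using measurable_depends_on[OF depends_on_coord[of i "{i}" "\<lambda>x. x"]] by auto
  ultimately have "measure N S = prob ((\<lambda>u. u i) -` S \<inter> space P)"
    by (metis measure_distr sets_measure_pmf UNIV_I)
  then show ?thesis by (simp add: vimage_def)
qed

lemma expectation_coordinate:
  fixes f :: "nat \<Rightarrow> real"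
  shows "(\<integral>u. f (u i) \<partial>P) = measure_pmf.expectation N f"
proof -
  have "distr P (measure_pmf N) (\<lambda>u. u i) = measure_pmf N"
    unfolding noise_law_def by (rule distr_PiM_component) (auto intro: prob_space_measure_pmf)
  moreover have "(\<lambda>u. u i) \<in> P \<rightarrow>\<^sub>M measure_pmf N"
    using measurable_depends_on[OF depends_on_coord[of i "{i}" "\<lambda>x. x"]] by auto
  ultimately show ?thesis
    using integral_distr[of "\<lambda>u. u i" P "measure_pmf N" f] by simp
qed

lemma expectation_prod_coordinates:
  fixes f :: "nat \<Rightarrow> real"
  assumes "finite I" and f: "\<And>x. \<bar>f x\<bar> \<le> B"
  shows "(\<integral>u. (\<Prod>i\<in>I. f (u i)) \<partial>P) = measure_pmf.expectation N f ^ card I"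
proof -
  have "(\<integral>u. (\<Prod>i\<in>I. f (u i)) \<partial>P) = (\<Prod>i\<in>I. \<integral>u. f (u i) \<partial>P)"
  proof (rule indep_vars_lebesgue_integral[OF assms(1)])
    have "indep_vars (\<lambda>_. count_space UNIV) (\<lambda>i u. u i) I"
      by (rule indep_vars_subset[OF indep_coordinates]) auto
    then show "indep_vars (\<lambda>_. borel) (\<lambda>i u. f (u i)) I"
      by (rule indep_vars_compose2) auto
    show "integrable P (\<lambda>u. f (u i))" for i
      by (intro integrable_cylinder cylinder_funI[OF depends_on_coord[of i "{i}" f], of B]) (auto simp: f)
  qed
  then show ?thesis by (simp add: expectation_coordinate)
qed

end

section \<open>Real-variable estimates\<close>

lemma sum_inverse_squares_le: "(\<Sum>p<q. 1 / (real p + 1)\<^sup>2) \<le> 2"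
proof -
  have "(\<Sum>p<Suc q. 1 / (real p + 1)\<^sup>2) \<le> 2 - 1 / (real q + 1)" for q
  proof (induction q)
    case (Suc q)
    have "1 / (real q + 2)\<^sup>2 \<le> 1 / ((real q + 1) * (real q + 2))"
      by (intro divide_left_mono) (auto simp: power2_eq_square)
    also have "\<dots> = 1 / (real q + 1) - 1 / (real q + 2)"
      by (simp add: field_simps)
    finally show ?case using Suc by (simp add: add.commute)
  qed simp
  from this[of "q - 1"] show ?thesis
    by (cases q) (auto intro: order_trans)
qed

lemma sum_powers_le:
  assumes "0 < \<rho>" "\<rho> < (1::real)"
  shows "(\<Sum>i<n. \<rho> ^ i) \<le> 1 / (1 - \<rho>)"
proof -
  have "(\<Sum>i<n. \<rho> ^ i) = (1 - \<rho> ^ n) / (1 - \<rho>)"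
    using assms by (simp add: sum_gp_strict)
  also have "\<dots> \<le> 1 / (1 - \<rho>)" using assms by (intro divide_right_mono) auto
  finally show ?thesis .
qed

lemma abs_sin_diff_le: "\<bar>sin a - sin b\<bar> \<le> \<bar>a - b :: real\<bar>"
proof -
  have "\<bar>sin a - sin b\<bar> = 2 * \<bar>sin ((a - b) / 2)\<bar> * \<bar>cos ((a + b) / 2)\<bar>"
    by (simp add: sin_diff_sin abs_mult)
  also have "\<dots> \<le> 2 * \<bar>(a - b) / 2\<bar> * 1"
    by (intro mult_mono mult_left_mono abs_sin_x_le_abs_x) auto
  finally show ?thesis by simp
qed

lemma abs_cos_diff_le: "\<bar>cos a - cos b\<bar> \<le> \<bar>a - b :: real\<bar>"
  using abs_sin_diff_le[of "pi / 2 - a" "pi / 2 - b"] by (simp add: cos_sin_eq abs_minus_commute)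

text \<open>For \<open>y \<ge> 0\<close> from \<open>e\<^sup>-\<^sup>y \<le> 1 / (1 + y)\<close> and \<open>(1 - y + y\<^sup>2) (1 + y) = 1 + y\<^sup>3 \<ge> 1\<close>.\<close>

lemma exp_minus_le_quadratic:
  assumes "- 1 \<le> (y :: real)" shows "exp (- y) \<le> 1 - y + y\<^sup>2"
proof (cases "y \<ge> 0")
  case True
  have "exp (- y) \<le> 1 / (1 + y)"
    using True exp_ge_add_one_self[of y] by (simp add: exp_minus field_simps)
  also have "\<dots> \<le> 1 - y + y\<^sup>2"
  proof -
    have "1 \<le> (1 - y + y\<^sup>2) * (1 + y)"
      using True by (simp add: algebra_simps power2_eq_square)
    then show ?thesis using True by (simp add: divide_le_eq)
  qed
  finally show ?thesis .
next
  case False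
  then show ?thesis using exp_bound[of "- y"] assms by simp
qed

lemma exp_minus_second_order: "0 \<le> (y :: real) \<Longrightarrow> \<bar>exp (- y) - (1 - y)\<bar> \<le> y\<^sup>2"
  using exp_minus_le_quadratic[of y] exp_ge_add_one_self[of "- y"] by simp

text \<open>The tenth power leaves room: its square root is what enters the \<open>L\<^sup>2\<close> estimates, where it has to
beat a double sum and a factor linear in the distance.\<close>

lemma stretched_exponential_decay:
  assumes q: "0 < q" "q < (1::real)" and D: "D > 0"
  obtains A where "A \<ge> 0" "\<And>m. (1 + D * (real m + 1)) * q powr (sqrt m / 2 - 1) \<le> (A / (real m + 1) ^ 5)\<^sup>2"
proof -
  define \<kappa> where "\<kappa> = - ln q"
  have \<kappa>: "\<kappa> > 0" using q by (simp add: \<kappa>_def)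
  let ?f = "\<lambda>m. (1 + D * (real m + 1)) * exp (- \<kappa> * (sqrt (real m) / 2 - 1)) * (real m + 1) ^ 10"
  have "?f \<longlonglongrightarrow> 0" using \<kappa> D by real_asymp
  then have "Bseq ?f" by (intro convergent_imp_Bseq convergentI)
  then obtain K where K: "K > 0" "\<And>m. norm (?f m) \<le> K" by (auto elim: BseqE)
  show ?thesis
  proof (rule that)
    show "sqrt K \<ge> 0" using K by simp
    fix m
    have "q powr (sqrt m / 2 - 1) = exp (- \<kappa> * (sqrt (real m) / 2 - 1))"
      using q by (simp add: powr_def \<kappa>_def mult.commute)
    moreover have "(1 + D * (real m + 1)) * exp (- \<kappa> * (sqrt (real m) / 2 - 1)) \<le> K / (real m + 1) ^ 10"
      using K(2)[of m] D by (simp add: pos_le_divide_eq abs_mult)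
    moreover have "K / (real m + 1) ^ 10 = (sqrt K / (real m + 1) ^ 5)\<^sup>2"
      using K(1) by (simp add: power_divide flip: power_mult)
    ultimately show "(1 + D * (real m + 1)) * q powr (sqrt m / 2 - 1) \<le> (sqrt K / (real m + 1) ^ 5)\<^sup>2"
      by simp
  qed
qed

text \<open>\<open>f - C\<close> is superadditive and \<open>f + C\<close> subadditive, so \<open>(f n - C) / n \<le> (f m + C) / m\<close> for all
positive \<open>n\<close> and \<open>m\<close> (compare both at \<open>n m\<close>), and any number \<open>a\<close> in between works.\<close>

lemma almost_additive_limit:
  fixes f :: "nat \<Rightarrow> real"
  assumes f: "\<And>n m. \<bar>f (n + m) - f n - f m\<bar> \<le> C"
  obtains a where "\<And>n. \<bar>f n - a * real n\<bar> \<le> C"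
proof -
  have mult: "\<bar>f (k * n) - real k * f n\<bar> \<le> (real k - 1) * C" if "k \<ge> 1" for k n
    using that
  proof (induction k rule: dec_induct)
    case (step k)
    have "\<bar>f (k * n + n) - f (k * n) - f n\<bar> \<le> C" by (rule f)
    then show ?case using step by (simp add: algebra_simps)
  qed simp
  have C: "C \<ge> 0" using f[of 0 0] by simp
  have key: "(f n - C) / real n \<le> (f m + C) / real m" if "n \<ge> 1" "m \<ge> 1" for n m
  proof -
    have "real m * f n - real m * C \<le> f (m * n) - C"
      using mult[of m n] that by (simp add: algebra_simps)
    moreover have "f (n * m) + C \<le> real n * f m + real n * C"
      using mult[of n m] that by (simp add: algebra_simps)
    ultimately have "real m * (f n - C) \<le> real n * (f m + C)"
      using C by (simp add: algebra_simps)
    then show ?thesis using that by (simp add: field_simps)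
  qed
  define a where "a = (SUP n\<in>{1..}. (f n - C) / real n)"
  have bdd: "bdd_above ((\<lambda>n. (f n - C) / real n) ` {1..})"
    by (rule bdd_aboveI[of _ "(f 1 + C) / 1"]) (use key[of _ 1] in auto)
  show ?thesis
  proof (rule that)
    fix n
    show "\<bar>f n - a * real n\<bar> \<le> C"
    proof (cases "n = 0")
      case True
      then show ?thesis using f[of 0 0] by simp
    next
      case False
      have "(f n - C) / real n \<le> a"
        unfolding a_def using False by (intro cSUP_upper bdd) auto
      moreover have "a \<le> (f n + C) / real n"
        unfolding a_def using False key[of _ n] by (intro cSUP_least) auto
      ultimately show ?thesis using False by (simp add: field_simps)
    qed
  qed
qed

lemma linear_growth_bound:
  fixes f :: "nat \<Rightarrow> real"
  assumes "\<And>n. \<bar>f n - a * real n\<bar> \<le> C" "\<And>n. f n \<le> b * real n + D"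
  shows "a \<le> b"
proof (rule ccontr)
  assume "\<not> a \<le> b"
  then obtain n where "C + D < real n * (a - b)"
    using reals_Archimedean3[of "a - b"] by auto
  then show False using assms(1)[of n] assms(2)[of n] by (simp add: algebra_simps)
qed

lemma linear_growth_unique:
  fixes f :: "nat \<Rightarrow> real"
  assumes "\<And>n. \<bar>f n - a * real n\<bar> \<le> C" "\<And>n. \<bar>f n - b * real n\<bar> \<le> D"
  shows "a = b"
proof (rule antisym)
  show "a \<le> b"
    by (rule linear_growth_bound[OF assms(1), of b D]) (use assms(2) in \<open>simp add: abs_le_iff algebra_simps\<close>)
  show "b \<le> a"
    by (rule linear_growth_bound[OF assms(2), of a C]) (use assms(1) in \<open>simp add: abs_le_iff algebra_simps\<close>)
qed

lemma quadratic_form_eq_sum: "x \<bullet> (Q *v x) = (\<Sum>i\<in>UNIV. \<Sum>j\<in>UNIV. x $ i * x $ j * Q $ i $ j)"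
  by (simp add: inner_vec_def matrix_vector_mult_def sum_distrib_left algebra_simps)

section \<open>Covariances and $L^2$ norms\<close>

context iid_noise
begin

definition cov :: "((nat \<Rightarrow> nat) \<Rightarrow> real) \<Rightarrow> ((nat \<Rightarrow> nat) \<Rightarrow> real) \<Rightarrow> real" where
  "cov F G = expectation (\<lambda>u. F u * G u) - expectation F * expectation G"

definition L2 :: "((nat \<Rightarrow> nat) \<Rightarrow> real) \<Rightarrow> real" where
  "L2 F = sqrt (expectation (\<lambda>u. (F u)\<^sup>2))"

lemma L2_nonneg: "L2 F \<ge> 0"
  by (simp add: L2_def)

lemma L2_square: "(L2 F)\<^sup>2 = expectation (\<lambda>u. (F u)\<^sup>2)"
  by (simp add: L2_def)

lemma Cauchy_Schwarz_expectation:
  assumes F: "cylinder_fun F" and G: "cylinder_fun G"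
  shows "\<bar>expectation (\<lambda>u. F u * G u)\<bar> \<le> L2 F * L2 G"
proof -
  define a b c where "a = expectation (\<lambda>u. (F u)\<^sup>2)" and "b = expectation (\<lambda>u. F u * G u)"
    and "c = expectation (\<lambda>u. (G u)\<^sup>2)"
  have i: "integrable P (\<lambda>u. (F u)\<^sup>2)" "integrable P (\<lambda>u. F u * G u)" "integrable P (\<lambda>u. (G u)\<^sup>2)"
    using F G by (auto intro!: cylinder_fun_intros)
  have q: "0 \<le> s\<^sup>2 * a - 2 * s * t * b + t\<^sup>2 * c" for s t
  proof -
    have "0 \<le> expectation (\<lambda>u. (s * F u - t * G u)\<^sup>2)" by simp
    also have "\<dots> = expectation (\<lambda>u. s\<^sup>2 * (F u)\<^sup>2 - 2 * s * t * (F u * G u) + t\<^sup>2 * (G u)\<^sup>2)"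
      by (rule Bochner_Integration.integral_cong) (auto simp: power2_eq_square algebra_simps)
    also have "\<dots> = s\<^sup>2 * a - 2 * s * t * b + t\<^sup>2 * c"
      using i by (simp add: a_def b_def c_def)
    finally show ?thesis .
  qed
  have c: "c \<ge> 0" and a: "a \<ge> 0" by (simp_all add: a_def c_def)
  have "b\<^sup>2 \<le> a * c"
  proof (cases "c = 0")
    case True
    have "b = 0"
    proof (rule ccontr)
      assume "b \<noteq> 0"
      have "0 \<le> a - 2 * ((a + 1) / (2 * b)) * b" using q[of 1 "(a + 1) / (2 * b)"] True by simp
      then show False using \<open>b \<noteq> 0\<close> by (simp add: field_simps)
    qed
    then show ?thesis using True by simp
  next
    case False
    have "0 \<le> c * (a * c - b\<^sup>2)"
      using q[of c b] by (simp add: power2_eq_square algebra_simps)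
    then show ?thesis using False c by (simp add: zero_le_mult_iff)
  qed
  then have "\<bar>b\<bar> \<le> sqrt (a * c)"
    using real_sqrt_le_mono[of "b\<^sup>2" "a * c"] by simp
  then show ?thesis by (simp add: L2_def a_def b_def c_def real_sqrt_mult)
qed

lemma L2_triangle:
  assumes F: "cylinder_fun F" and G: "cylinder_fun G"
  shows "L2 (\<lambda>u. F u + G u) \<le> L2 F + L2 G"
proof -
  have i: "integrable P (\<lambda>u. (F u)\<^sup>2)" "integrable P (\<lambda>u. F u * G u)" "integrable P (\<lambda>u. (G u)\<^sup>2)"
    using F G by (auto intro!: cylinder_fun_intros)
  have "(L2 (\<lambda>u. F u + G u))\<^sup>2 = expectation (\<lambda>u. (F u)\<^sup>2 + 2 * (F u * G u) + (G u)\<^sup>2)"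
    unfolding L2_square by (rule Bochner_Integration.integral_cong) (auto simp: power2_eq_square algebra_simps)
  also have "\<dots> = (L2 F)\<^sup>2 + 2 * expectation (\<lambda>u. F u * G u) + (L2 G)\<^sup>2"
    using i by (simp add: L2_square)
  also have "\<dots> \<le> (L2 F)\<^sup>2 + 2 * (L2 F * L2 G) + (L2 G)\<^sup>2"
    using Cauchy_Schwarz_expectation[OF F G] by linarith
  also have "\<dots> = (L2 F + L2 G)\<^sup>2" by (simp add: power2_eq_square algebra_simps)
  finally show ?thesis
    by (rule power2_le_imp_le) (simp add: L2_nonneg)
qed

lemma L2_sum:
  assumes "\<And>i. i \<in> I \<Longrightarrow> cylinder_fun (F i)"
  shows "L2 (\<lambda>u. \<Sum>i\<in>I. F i u) \<le> (\<Sum>i\<in>I. L2 (F i))"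
  using assms
proof (induction I rule: infinite_finite_induct)
  case (insert i I)
  then have "L2 (\<lambda>u. F i u + (\<Sum>i\<in>I. F i u)) \<le> L2 (F i) + L2 (\<lambda>u. \<Sum>i\<in>I. F i u)"
    by (intro L2_triangle cylinder_fun_sum) auto
  then show ?case using insert by force
qed (auto simp: L2_def)

lemma L2_mono:
  assumes "cylinder_fun F" "cylinder_fun G" "\<And>u. \<bar>F u\<bar> \<le> \<bar>G u\<bar>"
  shows "L2 F \<le> L2 G"
  unfolding L2_def
proof (intro real_sqrt_le_mono integral_mono)
  show "integrable P (\<lambda>u. (F u)\<^sup>2)" "integrable P (\<lambda>u. (G u)\<^sup>2)"
    using assms by (auto intro!: cylinder_fun_intros)
qed (use assms(3) abs_le_square_iff in blast)

lemma L2_const: "L2 (\<lambda>_. c) = \<bar>c\<bar>"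
  using prob_space by (simp add: L2_def)

lemma L2_cmult: "cylinder_fun F \<Longrightarrow> c \<ge> 0 \<Longrightarrow> L2 (\<lambda>u. c * F u) = c * L2 F"
  by (simp add: L2_def power_mult_distrib real_sqrt_mult)

lemma L2_centre:
  assumes F: "cylinder_fun F"
  shows "L2 (\<lambda>u. F u - expectation F) \<le> L2 F"
proof -
  have i: "integrable P (\<lambda>u. (F u)\<^sup>2)" "integrable P F"
    using F by (auto intro!: cylinder_fun_intros)
  have "expectation (\<lambda>u. (F u - expectation F)\<^sup>2) = expectation (\<lambda>u. (F u)\<^sup>2) - (expectation F)\<^sup>2"
    using i by (simp add: variance_eq)
  then show ?thesis unfolding L2_def by simp
qed

lemma expectation_le_L2:
  assumes F: "cylinder_fun F" shows "\<bar>expectation F\<bar> \<le> L2 F"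
  using Cauchy_Schwarz_expectation[OF F cylinder_fun_const[of 1]] by (simp add: L2_const)

lemma cov_bound:
  assumes F: "cylinder_fun F" and G: "cylinder_fun G"
  shows "\<bar>cov F G\<bar> \<le> L2 F * L2 G"
proof -
  have i: "integrable P (\<lambda>u. F u * G u)" "integrable P G"
    using F G by (auto intro!: cylinder_fun_intros)
  have "cov F G = expectation (\<lambda>u. (F u - expectation F) * G u)"
    using i by (simp add: cov_def left_diff_distrib)
  also have "\<bar>\<dots>\<bar> \<le> L2 (\<lambda>u. F u - expectation F) * L2 G"
    by (rule Cauchy_Schwarz_expectation) (auto intro!: cylinder_fun_intros F G)
  also have "\<dots> \<le> L2 F * L2 G"
    by (intro mult_right_mono L2_centre F L2_nonneg)
  finally show ?thesis .
qed

lemma cov_diff_right: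
  assumes "cylinder_fun F" "cylinder_fun G" "cylinder_fun H"
  shows "cov F (\<lambda>u. G u - H u) = cov F G - cov F H"
proof -
  have "integrable P (\<lambda>u. F u * G u)" "integrable P (\<lambda>u. F u * H u)" "integrable P G" "integrable P H"
    using assms by (auto intro!: cylinder_fun_intros)
  then show ?thesis by (simp add: cov_def right_diff_distrib)
qed

lemma cov_add_right:
  assumes "cylinder_fun F" "cylinder_fun G" "cylinder_fun H"
  shows "cov F (\<lambda>u. G u + H u) = cov F G + cov F H"
proof -
  have "integrable P (\<lambda>u. F u * G u)" "integrable P (\<lambda>u. F u * H u)" "integrable P G" "integrable P H"
    using assms by (auto intro!: cylinder_fun_intros)
  then show ?thesis by (simp add: cov_def distrib_left)
qed

lemma cov_commute: "cov F G = cov G F"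
  by (simp add: cov_def mult.commute)

lemma cov_sum_left:
  assumes "\<And>i. i \<in> I \<Longrightarrow> cylinder_fun (F i)" "cylinder_fun G"
  shows "cov (\<lambda>u. \<Sum>i\<in>I. F i u) G = (\<Sum>i\<in>I. cov (F i) G)"
  using assms(1)
proof (induction I rule: infinite_finite_induct)
  case (insert i I)
  then have "cov G (\<lambda>u. F i u + (\<Sum>i\<in>I. F i u)) = cov G (F i) + cov G (\<lambda>u. \<Sum>i\<in>I. F i u)"
    using assms(2) by (intro cov_add_right cylinder_fun_sum) auto
  then show ?case using insert by (simp add: cov_commute[of G])
qed (simp_all add: cov_def)

lemma cov_indep:
  assumes "depends_on F A" "finite A" "depends_on G B" "finite B" "A \<inter> B = {}"
    and "cylinder_fun F" "cylinder_fun G"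
  shows "cov F G = 0"
  unfolding cov_def using expectation_mult_indep[OF assms] by simp

lemma cov_restart:
  assumes "cylinder_fun F" "cylinder_fun G"
  shows "cov (\<lambda>u. F (restart k u)) (\<lambda>u. G (restart k u)) = cov F G"
  unfolding cov_def
  using expectation_restart[OF cylinder_fun_mult[OF assms], of k] expectation_restart[OF assms(1), of k]
    expectation_restart[OF assms(2), of k] by simp

lemma cov_cmult_left: "cylinder_fun F \<Longrightarrow> cov (\<lambda>u. c * F u) G = c * cov F G"
  by (simp add: cov_def mult.assoc right_diff_distrib)

lemma cov_inner:
  fixes X :: "_ \<Rightarrow> real ^ 'd::finite"
  assumes X: "\<And>i. cylinder_fun (\<lambda>u. X u $ i)"
  shows "cov (\<lambda>u. t \<bullet> X u) (\<lambda>u. t \<bullet> X u) = t \<bullet> ((\<chi> i j. cov (\<lambda>u. X u $ i) (\<lambda>u. X u $ j)) *v t)"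
proof -
  have tX: "(\<lambda>u. t \<bullet> X u) = (\<lambda>u. \<Sum>i\<in>UNIV. t $ i * X u $ i)"
    by (simp add: inner_vec_def)
  have c: "cylinder_fun (\<lambda>u. t $ i * X u $ i)" for i
    by (intro cylinder_fun_mult cylinder_fun_const X)
  have left: "cov (\<lambda>u. t \<bullet> X u) F = (\<Sum>i\<in>UNIV. t $ i * cov (\<lambda>u. X u $ i) F)" if "cylinder_fun F" for F
    unfolding tX using that by (subst cov_sum_left) (auto simp: c cov_cmult_left X)
  have ct: "cylinder_fun (\<lambda>u. t \<bullet> X u)" unfolding tX by (intro cylinder_fun_sum c)
  have "cov (\<lambda>u. t \<bullet> X u) (\<lambda>u. t \<bullet> X u) = (\<Sum>i\<in>UNIV. t $ i * cov (\<lambda>u. t \<bullet> X u) (\<lambda>u. X u $ i))"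
    unfolding left[OF ct] by (simp add: cov_commute)
  also have "\<dots> = (\<Sum>i\<in>UNIV. t $ i * (\<Sum>j\<in>UNIV. t $ j * cov (\<lambda>u. X u $ i) (\<lambda>u. X u $ j)))"
    unfolding left[OF X] by (simp add: cov_commute)
  finally show ?thesis
    unfolding quadratic_form_eq_sum by (simp add: sum_distrib_left algebra_simps)
qed

lemma cov_eq_centred:
  assumes "cylinder_fun F" "cylinder_fun G"
  shows "expectation (\<lambda>u. (F u - expectation F) * (G u - expectation G)) = cov F G"
proof -
  have i: "integrable P (\<lambda>u. F u * G u)" "integrable P F" "integrable P G"
    using assms by (auto intro!: cylinder_fun_intros)
  have "expectation (\<lambda>u. (F u - expectation F) * (G u - expectation G))
      = expectation (\<lambda>u. F u * G u - expectation G * F u - expectation F * G u + expectation F * expectation G)"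
    by (rule Bochner_Integration.integral_cong) (auto simp: algebra_simps)
  also have "\<dots> = cov F G"
    using i prob_space by (simp add: cov_def)
  finally show ?thesis .
qed

lemma cov_self_nonneg: "cylinder_fun F \<Longrightarrow> 0 \<le> cov F F"
  by (subst cov_eq_centred[symmetric]) simp_all

end

section \<open>Limit theorems for increments that forget their past\<close>

text \<open>The process restarted at time \<open>r\<close> uses the noise from \<open>r\<close> on; its increment at absolute time \<open>j\<close> is
\<open>\<xi> (j - r) (restart r u)\<close>.  The bound is written as a square since its square root bounds an \<open>L\<^sup>2\<close> norm.\<close>

locale forgetful_increments = iid_noise N for N +
  fixes \<xi> :: "nat \<Rightarrow> (nat \<Rightarrow> nat) \<Rightarrow> real" and B A :: real
  assumes increment_depends: "depends_on (\<xi> j) {..j}"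
    and increment_bound: "\<bar>\<xi> j u\<bar> \<le> B"
    and A_nonneg: "A \<ge> 0"
    and forget: "r \<le> j \<Longrightarrow> prob {u. \<xi> j u \<noteq> \<xi> (j - r) (restart r u)} \<le> (A / (real (j - r) + 1) ^ 5)\<^sup>2"
begin

text \<open>\<open>incr k n\<close> is the increment at absolute time \<open>n\<close> of the process started at time \<open>k\<close>, meant for
\<open>k \<le> n\<close>, and \<open>seg k n\<close> is the sum of its increments at times \<open>k, \<dots>, n - 1\<close>.\<close>

definition incr :: "nat \<Rightarrow> nat \<Rightarrow> (nat \<Rightarrow> nat) \<Rightarrow> real" where
  "incr k n u = \<xi> (n - k) (restart k u)"

definition seg :: "nat \<Rightarrow> nat \<Rightarrow> (nat \<Rightarrow> nat) \<Rightarrow> real" where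
  "seg k n u = (\<Sum>i\<in>{k..<n}. incr k i u)"

lemma B_nonneg: "B \<ge> 0"
  using increment_bound[of 0 undefined] by linarith

lemma depends_on_incr: "k \<le> n \<Longrightarrow> depends_on (incr k n) {k..n}"
  using depends_on_restart[OF increment_depends[of "n - k", folded lessThan_Suc_atMost], of k]
  by (auto simp: incr_def[abs_def] atLeastLessThanSuc_atLeastAtMost elim!: depends_on_mono)

lemma abs_incr_le: "\<bar>incr k n u\<bar> \<le> B"
  by (simp add: incr_def increment_bound)

lemma cylinder_incr: "cylinder_fun (incr k n)"
proof -
  have "cylinder_fun (\<xi> (n - k))"
    by (rule cylinder_funI[where B = B, OF increment_depends]) (auto simp: increment_bound)
  then show ?thesis unfolding incr_def[abs_def] by (rule cylinder_fun_restart)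
qed

lemma cylinder_seg: "cylinder_fun (seg k n)"
  unfolding seg_def[abs_def] by (intro cylinder_fun_sum cylinder_incr)

lemma depends_on_seg: "depends_on (seg k n) {k..<n}"
  unfolding seg_def[abs_def] by (intro depends_on_sum depends_on_mono[OF depends_on_incr]) auto

lemma seg_shift: "seg n (n + m) u = seg 0 m (restart n u)"
proof -
  have "seg n (n + m) u = (\<Sum>i\<in>{0+n..<m+n}. incr n i u)"
    by (simp add: seg_def add.commute)
  also have "\<dots> = (\<Sum>i\<in>{0..<m}. incr n (i + n) u)"
    by (rule sum.shift_bounds_nat_ivl)
  finally show ?thesis by (simp add: seg_def incr_def)
qed

text \<open>The difference is bounded by \<open>2 B\<close> and vanishes off an event whose probability is bounded by
\<open>forget\<close>, after both processes have been shifted so that the first one starts at time \<open>0\<close>.\<close>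

lemma L2_incr_diff:
  assumes "k' \<le> k" "k \<le> n"
  shows "L2 (\<lambda>u. incr k' n u - incr k n u) \<le> 2 * B * (A / (real (n - k) + 1) ^ 5)"
proof -
  define a where "a = A / (real (n - k) + 1) ^ 5"
  have a: "a \<ge> 0" using A_nonneg by (simp add: a_def)
  let ?F = "\<lambda>v. \<xi> (n - k') v \<noteq> \<xi> ((n - k') - (k - k')) (restart (k - k') v)"
  have arith: "(n - k') - (k - k') = n - k" using assms by simp
  have dep: "depends_on ?F {..n - k'}"
  proof (rule depends_on_comp2[where h = "(\<noteq>)", OF increment_depends])
    have "depends_on (\<lambda>u. \<xi> (n - k) (restart (k - k') u)) {k - k'..<k - k' + Suc (n - k)}"
      by (rule depends_on_restart) (simp add: lessThan_Suc_atMost increment_depends)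
    then show "depends_on (\<lambda>v. \<xi> ((n - k') - (k - k')) (restart (k - k') v)) {..n - k'}"
      unfolding arith by (rule depends_on_mono) (use assms in auto)
  qed
  have set: "{u. incr k' n u \<noteq> incr k n u} = {u. ?F (restart k' u)}"
    using assms by (simp add: incr_def restart_restart)
  have "prob {u. incr k' n u \<noteq> incr k n u} = prob {u. ?F u}"
    unfolding set by (rule prob_restart[OF dep]) simp
  also have "\<dots> \<le> a\<^sup>2"
    using forget[of "k - k'" "n - k'"] assms by (simp add: a_def)
  finally have p: "prob {u. incr k' n u \<noteq> incr k n u} \<le> a\<^sup>2" .
  have "depends_on (\<lambda>u. incr k' n u \<noteq> incr k n u) {k'..n}"
    by (rule depends_on_comp2[OF depends_on_mono[OF depends_on_incr] depends_on_mono[OF depends_on_incr]])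
       (use assms in auto)
  then have ev: "{u. incr k' n u \<noteq> incr k n u} \<in> events"
    by (rule events_depends_on) simp
  have "(L2 (\<lambda>u. incr k' n u - incr k n u))\<^sup>2 \<le> expectation (\<lambda>u. (2 * B)\<^sup>2 * indicator {u. incr k' n u \<noteq> incr k n u} u)"
    unfolding L2_square
  proof (rule integral_mono)
    show "integrable P (\<lambda>u. (incr k' n u - incr k n u)\<^sup>2)"
      by (intro integrable_cylinder cylinder_fun_power cylinder_fun_diff cylinder_incr)
    show "integrable P (\<lambda>u. (2 * B)\<^sup>2 * indicator {u. incr k' n u \<noteq> incr k n u} u)"
      using ev by (simp add: emeasure_eq_measure)
    fix u
    have "\<bar>incr k' n u - incr k n u\<bar> \<le> \<bar>2 * B\<bar>"
      using abs_incr_le[of k' n u] abs_incr_le[of k n u] by linarith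
    then have "(incr k' n u - incr k n u)\<^sup>2 \<le> (2 * B)\<^sup>2"
      using abs_le_square_iff by blast
    then show "(incr k' n u - incr k n u)\<^sup>2 \<le> (2 * B)\<^sup>2 * indicator {u. incr k' n u \<noteq> incr k n u} u"
      by (auto simp: indicator_def)
  qed
  also have "\<dots> = (2 * B)\<^sup>2 * prob {u. incr k' n u \<noteq> incr k n u}"
    using ev by (simp add: emeasure_eq_measure)
  also have "\<dots> \<le> (2 * B)\<^sup>2 * a\<^sup>2"
    by (intro mult_left_mono p) auto
  also have "\<dots> = (2 * B * a)\<^sup>2" by (simp add: power_mult_distrib)
  finally show ?thesis
    unfolding a_def[symmetric] by (rule power2_le_imp_le) (use B_nonneg a in auto)
qed

lemma sum_forget_le: "(\<Sum>p<q. 2 * B * (A / (real p + 1) ^ 5)) \<le> 4 * A * B"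
proof -
  have "2 * B * (A / (real p + 1) ^ 5) \<le> 2 * B * A * (1 / (real p + 1)\<^sup>2)" for p
    using B_nonneg A_nonneg by (auto intro!: mult_left_mono divide_left_mono power_increasing)
  then have "(\<Sum>p<q. 2 * B * (A / (real p + 1) ^ 5)) \<le> 2 * B * A * (\<Sum>p<q. 1 / (real p + 1)\<^sup>2)"
    unfolding sum_distrib_left by (intro sum_mono)
  also have "\<dots> \<le> 2 * B * A * 2"
    using B_nonneg A_nonneg by (intro mult_left_mono sum_inverse_squares_le) auto
  finally show ?thesis by (simp add: algebra_simps)
qed

lemma L2_sum_incr_diff:
  assumes "k' \<le> k"
  shows "L2 (\<lambda>u. \<Sum>i\<in>{k..<k+q}. incr k' i u - incr k i u) \<le> 4 * A * B"
proof -
  have "L2 (\<lambda>u. \<Sum>i\<in>{k..<k+q}. incr k' i u - incr k i u) \<le> (\<Sum>i\<in>{k..<k+q}. L2 (\<lambda>u. incr k' i u - incr k i u))"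
    by (intro L2_sum cylinder_fun_diff cylinder_incr)
  also have "\<dots> \<le> (\<Sum>i\<in>{k..<k+q}. 2 * B * (A / (real (i - k) + 1) ^ 5))"
    by (intro sum_mono L2_incr_diff assms) auto
  also have "\<dots> = (\<Sum>i\<in>{0+k..<q+k}. 2 * B * (A / (real (i - k) + 1) ^ 5))"
    by (simp add: add.commute)
  also have "\<dots> = (\<Sum>i\<in>{0..<q}. 2 * B * (A / (real (i + k - k) + 1) ^ 5))"
    by (rule sum.shift_bounds_nat_ivl)
  also have "\<dots> = (\<Sum>i<q. 2 * B * (A / (real i + 1) ^ 5))"
    by (simp add: lessThan_atLeast0)
  also have "\<dots> \<le> 4 * A * B" by (rule sum_forget_le)
  finally show ?thesis .
qed

text \<open>Up to the defect, the process run for time \<open>n + m\<close> is glued from two independent copies: one run on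
the noise before \<open>n\<close> and one on the noise from \<open>n\<close> on.\<close>

definition glued :: "nat \<Rightarrow> nat \<Rightarrow> (nat \<Rightarrow> nat) \<Rightarrow> real" where
  "glued n m u = seg 0 n u + seg n (n + m) u"

definition defect :: "nat \<Rightarrow> nat \<Rightarrow> (nat \<Rightarrow> nat) \<Rightarrow> real" where
  "defect n m u = (\<Sum>i\<in>{n..<n + m}. incr 0 i u - incr n i u)"

lemma seg_add: "seg 0 (n + m) u = glued n m u + defect n m u"
proof -
  have "seg 0 (n + m) u = seg 0 n u + (\<Sum>i\<in>{n..<n + m}. incr 0 i u)"
    unfolding seg_def by (rule sum.atLeastLessThan_concat[symmetric]) auto
  then show ?thesis by (simp add: glued_def defect_def seg_def sum_subtractf)
qed

lemma cylinder_glued: "cylinder_fun (glued n m)"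
  unfolding glued_def[abs_def] by (intro cylinder_fun_add cylinder_seg)

lemma cylinder_defect: "cylinder_fun (defect n m)"
  unfolding defect_def[abs_def] by (intro cylinder_fun_sum cylinder_fun_diff cylinder_incr)

lemma L2_defect: "L2 (defect n m) \<le> 4 * A * B"
  unfolding defect_def[abs_def] by (rule L2_sum_incr_diff) simp

lemma L2_incr: "L2 (incr k n) \<le> B"
  using L2_mono[OF cylinder_incr[of k n] cylinder_fun_const[of B]] abs_incr_le[of k n] B_nonneg
  by (simp add: L2_const)

text \<open>The function \<open>E\<close> depends on the noise at times \<open>n - Suc q, \<dots>, n + p\<close> only, and has \<open>L\<^sup>2\<close> norm
\<open>O((p + q + 1)\<^sup>-\<^sup>5)\<close> by forgetting.  Replacing \<open>glued n m\<close> by the sum \<open>Wf\<close> of the segment before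
this window and of a fresh segment after it makes it independent of \<open>E\<close> and changes it, in \<open>L\<^sup>2\<close>, by
at most \<open>O(p + q + 1)\<close>.\<close>

lemma cov_local_part:
  assumes g: "\<And>a b. \<bar>g a - g b\<bar> \<le> l * \<bar>a - b\<bar>" and q: "q < n" and p: "p < m"
  defines "E \<equiv> \<lambda>u. incr (n - Suc q) (n + p) u - incr (n - q) (n + p) u"
  shows "\<bar>cov E (\<lambda>u. g (glued n m u))\<bar>
     \<le> 4 * A * B\<^sup>2 * l * (1 + 2 * A) * (1 / (real p + 1)\<^sup>2 * (1 / (real q + 1)\<^sup>2))"
proof -
  have l: "l \<ge> 0" using g[of 1 0] by simp
  define r where "r = n - Suc q"
  define j where "j = n + p"
  have r: "r < n" "n - q = Suc r" and j: "n \<le> j" "j < n + m"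
    using q p by (auto simp: r_def j_def)
  define Wf where "Wf u = seg 0 r u + seg (Suc j) (n + m) u" for u
  have lip: "\<bar>g y\<bar> \<le> \<bar>g 0\<bar> + l * \<bar>y\<bar>" for y
    using g[of y 0] by simp
  have cW: "cylinder_fun (\<lambda>u. g (glued n m u))"
    by (rule cylinder_fun_comp[OF cylinder_glued, of g "\<bar>g 0\<bar>" l]) (use lip l in auto)
  have cWf0: "cylinder_fun Wf"
    unfolding Wf_def[abs_def] by (intro cylinder_fun_add cylinder_seg)
  have cWf: "cylinder_fun (\<lambda>u. g (Wf u))"
    by (rule cylinder_fun_comp[OF cWf0, of g "\<bar>g 0\<bar>" l]) (use lip l in auto)
  have cE: "cylinder_fun E"
    unfolding E_def by (intro cylinder_fun_diff cylinder_incr)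
  have "cov E (\<lambda>u. g (Wf u)) = 0"
  proof (rule cov_indep[OF _ _ _ _ _ cE cWf])
    show "depends_on E {r..j}"
      unfolding E_def r(2) r_def[symmetric] j_def[symmetric] using r(1) j(1)
      by (intro depends_on_comp2[of _ _ _ "(-)"] depends_on_mono[OF depends_on_incr]) auto
    show "depends_on (\<lambda>u. g (Wf u)) ({0..<r} \<union> {Suc j..<n + m})"
      unfolding Wf_def
      by (intro depends_on_comp[of _ _ g] depends_on_comp2[of _ _ _ "(+)"] depends_on_mono[OF depends_on_seg]) auto
  qed auto
  then have "\<bar>cov E (\<lambda>u. g (glued n m u))\<bar> = \<bar>cov E (\<lambda>u. g (glued n m u) - g (Wf u))\<bar>"
    using cov_diff_right[OF cE cW cWf] by simp
  also have "\<dots> \<le> L2 E * L2 (\<lambda>u. g (glued n m u) - g (Wf u))"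
    by (intro cov_bound cE cylinder_fun_diff cW cWf)
  \<comment> \<open>the window has \<open>j + 1 - r\<close> times; beyond it, replacing the second copy by a fresh one costs \<open>4 A B\<close>\<close>
  also have "\<dots> \<le> (2 * B * (A / (real (p + q) + 1) ^ 5)) * (l * (B * real (j + 1 - r) + 4 * A * B))"
  proof (rule mult_mono)
    have "n + p - (n - q) = p + q" using q by auto
    then show "L2 E \<le> 2 * B * (A / (real (p + q) + 1) ^ 5)"
      using L2_incr_diff[of "n - Suc q" "n - q" "n + p"] unfolding E_def by simp
    have diff: "glued n m u - Wf u = (\<Sum>i\<in>{r..<n}. incr 0 i u) + (\<Sum>i\<in>{n..<Suc j}. incr n i u)
        + (\<Sum>i\<in>{Suc j..<n + m}. incr n i u - incr (Suc j) i u)" for u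
    proof -
      have "seg 0 n u = seg 0 r u + (\<Sum>i\<in>{r..<n}. incr 0 i u)"
        unfolding seg_def by (rule sum.atLeastLessThan_concat[symmetric]) (use r in auto)
      moreover have "seg n (n + m) u = (\<Sum>i\<in>{n..<Suc j}. incr n i u) + (\<Sum>i\<in>{Suc j..<n + m}. incr n i u)"
        unfolding seg_def by (rule sum.atLeastLessThan_concat[symmetric]) (use j in auto)
      ultimately show ?thesis by (simp add: glued_def Wf_def seg_def sum_subtractf)
    qed
    have "L2 (\<lambda>u. glued n m u - Wf u) \<le> L2 (\<lambda>u. (\<Sum>i\<in>{r..<n}. incr 0 i u) + (\<Sum>i\<in>{n..<Suc j}. incr n i u))
        + L2 (\<lambda>u. \<Sum>i\<in>{Suc j..<n + m}. incr n i u - incr (Suc j) i u)"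
      unfolding diff by (intro L2_triangle cylinder_fun_intros cylinder_incr)
    also have "\<dots> \<le> (L2 (\<lambda>u. \<Sum>i\<in>{r..<n}. incr 0 i u) + L2 (\<lambda>u. \<Sum>i\<in>{n..<Suc j}. incr n i u)) + 4 * A * B"
    proof (rule add_mono)
      show "L2 (\<lambda>u. (\<Sum>i\<in>{r..<n}. incr 0 i u) + (\<Sum>i\<in>{n..<Suc j}. incr n i u))
          \<le> L2 (\<lambda>u. \<Sum>i\<in>{r..<n}. incr 0 i u) + L2 (\<lambda>u. \<Sum>i\<in>{n..<Suc j}. incr n i u)"
        by (intro L2_triangle cylinder_fun_intros cylinder_incr)
      show "L2 (\<lambda>u. \<Sum>i\<in>{Suc j..<n + m}. incr n i u - incr (Suc j) i u) \<le> 4 * A * B"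
        using L2_sum_incr_diff[of n "Suc j" "n + m - Suc j"] j by simp
    qed
    also have "\<dots> \<le> (B * real (n - r) + B * real (Suc j - n)) + 4 * A * B"
    proof -
      have "L2 (\<lambda>u. \<Sum>i\<in>I. incr k i u) \<le> B * real (card I)" for k I
      proof -
        have "L2 (\<lambda>u. \<Sum>i\<in>I. incr k i u) \<le> (\<Sum>i\<in>I. L2 (incr k i))"
          by (intro L2_sum cylinder_incr)
        also have "\<dots> \<le> real (card I) * B"
          by (rule sum_bounded_above) (rule L2_incr)
        finally show ?thesis by (simp add: mult.commute)
      qed
      from this[of 0 "{r..<n}"] this[of n "{n..<Suc j}"] show ?thesis by simp
    qed
    also have "\<dots> = B * real (j + 1 - r) + 4 * A * B"
      using r j by (simp add: of_nat_diff algebra_simps)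
    finally have 1: "L2 (\<lambda>u. glued n m u - Wf u) \<le> B * real (j + 1 - r) + 4 * A * B" .
    have "L2 (\<lambda>u. g (glued n m u) - g (Wf u)) \<le> L2 (\<lambda>u. l * (glued n m u - Wf u))"
      by (rule L2_mono) (use g l in \<open>auto intro!: cylinder_fun_intros cW cWf cWf0 cylinder_glued simp: abs_mult\<close>)
    also have "\<dots> = l * L2 (\<lambda>u. glued n m u - Wf u)"
      by (intro L2_cmult cylinder_fun_diff cylinder_glued cWf0 l)
    finally show "L2 (\<lambda>u. g (glued n m u) - g (Wf u)) \<le> l * (B * real (j + 1 - r) + 4 * A * B)"
      using mult_left_mono[OF 1 l] by linarith
  qed (auto simp: L2_nonneg A_nonneg B_nonneg)
  also have "\<dots> \<le> (2 * B * (A / (real (p + q) + 1) ^ 5)) * (l * (2 * B * (1 + 2 * A) * (real (p + q) + 1)))"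
  proof -
    have "real (j + 1 - r) \<le> 2 * (real (p + q) + 1)"
      using q by (simp add: j_def r_def of_nat_diff)
    then have "B * real (j + 1 - r) \<le> B * (2 * (real (p + q) + 1))"
      by (rule mult_left_mono) (rule B_nonneg)
    moreover have "4 * A * B * 1 \<le> 4 * A * B * (real (p + q) + 1)"
      by (rule mult_left_mono) (auto simp: A_nonneg B_nonneg)
    ultimately have "B * real (j + 1 - r) + 4 * A * B \<le> 2 * B * (1 + 2 * A) * (real (p + q) + 1)"
      by (simp add: algebra_simps)
    then show ?thesis
      using l A_nonneg B_nonneg by (intro mult_left_mono) auto
  qed
  also have "\<dots> = 4 * A * B\<^sup>2 * l * (1 + 2 * A) * (1 / (real (p + q) + 1) ^ 4)"
  proof -
    have "y > 0 \<Longrightarrow> (2 * B * (A / y ^ 5)) * (l * (2 * B * (1 + 2 * A) * y))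
      = 4 * A * B\<^sup>2 * l * (1 + 2 * A) * (1 / y ^ 4)" for y :: real
      by (simp add: field_simps power2_eq_square eval_nat_numeral)
    then show ?thesis by simp
  qed
  also have "\<dots> \<le> 4 * A * B\<^sup>2 * l * (1 + 2 * A) * (1 / (real p + 1)\<^sup>2 * (1 / (real q + 1)\<^sup>2))"
  proof (rule mult_left_mono)
    have "(real p + 1)\<^sup>2 * (real q + 1)\<^sup>2 \<le> (real (p + q) + 1)\<^sup>2 * (real (p + q) + 1)\<^sup>2"
      by (intro mult_mono power_mono) auto
    also have "\<dots> = (real (p + q) + 1) ^ 4"
      by (simp flip: power_add)
    finally show "1 / (real (p + q) + 1) ^ 4 \<le> 1 / (real p + 1)\<^sup>2 * (1 / (real q + 1)\<^sup>2)"
      by (simp add: divide_left_mono)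
  qed (auto simp: l A_nonneg)
  finally show ?thesis .
qed

definition K where "K = 16 * A * B\<^sup>2 * (1 + 2 * A)"

text \<open>Moving the starting time from \<open>0\<close> to \<open>n\<close> one unit at a time writes the defect as a double sum of the
local terms of \<open>cov_local_part\<close>, whose bounds are summable.  Applied to the identity this controls
the variance, applied to sine and cosine the characteristic function.\<close>

lemma cov_defect_Lipschitz:
  assumes g: "\<And>a b. \<bar>g a - g b\<bar> \<le> l * \<bar>a - b\<bar>"
  shows "\<bar>cov (defect n m) (\<lambda>u. g (glued n m u))\<bar> \<le> K * l"
proof -
  have l: "l \<ge> 0" using g[of 1 0] by simp
  have lip: "\<bar>g y\<bar> \<le> \<bar>g 0\<bar> + l * \<bar>y\<bar>" for y
    using g[of y 0] by simp
  have cW: "cylinder_fun (\<lambda>u. g (glued n m u))"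
    by (rule cylinder_fun_comp[OF cylinder_glued, of g "\<bar>g 0\<bar>" l]) (use lip l in auto)
  define E where "E q p u = incr (n - Suc q) (n + p) u - incr (n - q) (n + p) u" for q p u
  have cE: "cylinder_fun (E q p)" for q p
    unfolding E_def[abs_def] by (intro cylinder_fun_diff cylinder_incr)
  have defect: "defect n m = (\<lambda>u. \<Sum>p<m. \<Sum>q<n. E q p u)"
  proof
    fix u
    have "(\<Sum>q<n. E q p u) = incr 0 (n + p) u - incr n (n + p) u" for p
      unfolding E_def using sum_lessThan_telescope[of "\<lambda>q. incr (n - q) (n + p) u" n] by simp
    moreover have "defect n m u = (\<Sum>p<m. incr 0 (n + p) u - incr n (n + p) u)"
    proof -
      have "defect n m u = (\<Sum>i\<in>{0+n..<m+n}. incr 0 i u - incr n i u)"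
        by (simp add: defect_def add.commute)
      also have "\<dots> = (\<Sum>i\<in>{0..<m}. incr 0 (i + n) u - incr n (i + n) u)"
        by (rule sum.shift_bounds_nat_ivl)
      finally show ?thesis by (simp add: lessThan_atLeast0 add.commute)
    qed
    ultimately show "defect n m u = (\<Sum>p<m. \<Sum>q<n. E q p u)" by simp
  qed
  have "cov (defect n m) (\<lambda>u. g (glued n m u)) = (\<Sum>p<m. \<Sum>q<n. cov (E q p) (\<lambda>u. g (glued n m u)))"
    unfolding defect by (subst cov_sum_left, intro cylinder_fun_sum cE, rule cW)
      (intro sum.cong refl cov_sum_left cE cW)
  also have "\<bar>\<dots>\<bar> \<le> (\<Sum>p<m. \<Sum>q<n. \<bar>cov (E q p) (\<lambda>u. g (glued n m u))\<bar>)"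
    by (intro order_trans[OF sum_abs] sum_mono sum_abs)
  also have "\<dots> \<le> (\<Sum>p<m. \<Sum>q<n. 4 * A * B\<^sup>2 * l * (1 + 2 * A) * (1 / (real p + 1)\<^sup>2 * (1 / (real q + 1)\<^sup>2)))"
    unfolding E_def[abs_def] by (intro sum_mono cov_local_part[OF g]) auto
  also have "\<dots> = 4 * A * B\<^sup>2 * l * (1 + 2 * A) * ((\<Sum>p<m. 1 / (real p + 1)\<^sup>2) * (\<Sum>q<n. 1 / (real q + 1)\<^sup>2))"
    by (simp only: sum_product) (simp only: sum_distrib_left)
  also have "\<dots> \<le> 4 * A * B\<^sup>2 * l * (1 + 2 * A) * (2 * 2)"
    by (intro mult_left_mono mult_mono sum_inverse_squares_le) (auto simp: l A_nonneg sum_nonneg)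
  finally show ?thesis by (simp add: K_def algebra_simps)
qed


definition mean :: "nat \<Rightarrow> real" where "mean n = expectation (seg 0 n)"

definition V :: "nat \<Rightarrow> real" where "V n = cov (seg 0 n) (seg 0 n)"

lemma expectation_glued: "expectation (glued n m) = mean n + mean m"
proof -
  have "expectation (glued n m) = expectation (seg 0 n) + expectation (seg n (n + m))"
    unfolding glued_def[abs_def] by (intro Bochner_Integration.integral_add integrable_cylinder cylinder_seg)
  moreover have "expectation (seg n (n + m)) = expectation (seg 0 m)"
    unfolding seg_shift[abs_def] by (rule expectation_restart) (rule cylinder_seg)
  ultimately show ?thesis by (simp add: mean_def)
qed

lemma expectation_seg_add: "mean (n + m) = mean n + mean m + expectation (defect n m)"
  unfolding expectation_glued[symmetric] mean_def[of "n + m"] seg_add[abs_def]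
  by (intro Bochner_Integration.integral_add integrable_cylinder cylinder_glued cylinder_defect)

lemma mean_almost_additive: "\<bar>mean (n + m) - mean n - mean m\<bar> \<le> 4 * A * B"
  using expectation_le_L2[OF cylinder_defect, of n m] L2_defect[of n m] by (simp add: expectation_seg_add)

lemma cov_glued: "cov (glued n m) (glued n m) = V n + V m"
proof -
  have 0: "cov (seg 0 n) (seg n (n + m)) = 0"
    by (rule cov_indep[OF depends_on_seg _ depends_on_seg]) (auto intro: cylinder_seg)
  have m: "cov (seg n (n + m)) (seg n (n + m)) = V m"
    unfolding seg_shift[abs_def] V_def by (rule cov_restart) (rule cylinder_seg)+
  have "cov (glued n m) (glued n m) = cov (glued n m) (seg 0 n) + cov (glued n m) (seg n (n + m))"
    using cov_add_right[OF cylinder_glued cylinder_seg cylinder_seg] by (simp add: glued_def[abs_def])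
  also have "cov (glued n m) (seg 0 n) = cov (seg 0 n) (seg 0 n) + cov (seg 0 n) (seg n (n + m))"
    unfolding cov_commute[of "glued n m"] using cov_add_right[OF cylinder_seg cylinder_seg cylinder_seg]
    by (simp add: glued_def[abs_def])
  also have "cov (glued n m) (seg n (n + m)) = cov (seg n (n + m)) (seg 0 n) + cov (seg n (n + m)) (seg n (n + m))"
    unfolding cov_commute[of "glued n m"] using cov_add_right[OF cylinder_seg cylinder_seg cylinder_seg]
    by (simp add: glued_def[abs_def])
  finally show ?thesis using 0 m by (simp add: V_def cov_commute)
qed

lemma V_almost_additive: "\<bar>V (n + m) - V n - V m\<bar> \<le> 2 * K + (4 * A * B)\<^sup>2"
proof -
  have seg: "seg 0 (n + m) = (\<lambda>u. glued n m u + defect n m u)"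
    by (simp add: seg_add[abs_def])
  have split: "cov F (seg 0 (n + m)) = cov F (glued n m) + cov F (defect n m)" if "cylinder_fun F" for F
    unfolding seg using that by (intro cov_add_right cylinder_glued cylinder_defect)
  have "V (n + m) = cov (seg 0 (n + m)) (glued n m) + cov (seg 0 (n + m)) (defect n m)"
    unfolding V_def by (rule split) (rule cylinder_seg)
  also have "\<dots> = cov (glued n m) (seg 0 (n + m)) + cov (defect n m) (seg 0 (n + m))"
    by (simp add: cov_commute)
  also have "\<dots> = cov (glued n m) (glued n m) + cov (glued n m) (defect n m) + (cov (defect n m) (glued n m) + cov (defect n m) (defect n m))"
    by (simp only: split cylinder_glued cylinder_defect)
  finally have eq: "V (n + m) - V n - V m = 2 * cov (defect n m) (glued n m) + cov (defect n m) (defect n m)"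
    by (simp add: cov_glued cov_commute[of "glued n m" "defect n m"])
  have "\<bar>cov (defect n m) (glued n m)\<bar> \<le> K"
    using cov_defect_Lipschitz[of "\<lambda>y. y" 1 n m] by simp
  moreover have "\<bar>cov (defect n m) (defect n m)\<bar> \<le> (4 * A * B)\<^sup>2"
    unfolding power2_eq_square
    by (rule order_trans[OF cov_bound mult_mono]) (auto intro: cylinder_defect L2_defect L2_nonneg simp: A_nonneg B_nonneg)
  ultimately show ?thesis unfolding eq by linarith
qed

definition \<phi> :: "nat \<Rightarrow> real \<Rightarrow> complex" where
  "\<phi> n s = (\<integral>u. iexp (s * (seg 0 n u - mean n)) \<partial>P)"

lemma cylinder_iexp: "cylinder_fun F \<Longrightarrow> cylinder_fun (\<lambda>u. iexp (F u))"
  by (rule cylinder_fun_comp[of _ "\<lambda>y. iexp y" 1 0]) auto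

lemma cylinder_of_real: "cylinder_fun F \<Longrightarrow> cylinder_fun (\<lambda>u. complex_of_real (F u))"
  by (rule cylinder_fun_comp[of _ complex_of_real 0 1]) auto

lemma cmod_\<phi>_le_1: "cmod (\<phi> n s) \<le> 1"
proof -
  have "cmod (\<phi> n s) \<le> (\<integral>u. cmod (iexp (s * (seg 0 n u - mean n))) \<partial>P)"
    unfolding \<phi>_def by (rule integral_norm_bound)
  also have "\<dots> = 1" using prob_space by simp
  finally show ?thesis .
qed

lemma cylinder_iexp_seg: "cylinder_fun (\<lambda>u. iexp (s * (seg k n u - c)))"
  by (intro cylinder_iexp cylinder_fun_mult cylinder_fun_diff cylinder_seg cylinder_fun_const)

lemma char_glued: "(\<integral>u. iexp (s * (glued n m u - expectation (glued n m))) \<partial>P) = \<phi> n s * \<phi> m s"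
proof -
  have "(\<integral>u. iexp (s * (glued n m u - expectation (glued n m))) \<partial>P)
     = (\<integral>u. iexp (s * (seg 0 n u - mean n)) * iexp (s * (seg n (n + m) u - mean m)) \<partial>P)"
    unfolding expectation_glued glued_def
    by (rule Bochner_Integration.integral_cong) (simp_all add: exp_add[symmetric] algebra_simps)
  also have "\<dots> = \<phi> n s * (\<integral>u. iexp (s * (seg n (n + m) u - mean m)) \<partial>P)"
    unfolding \<phi>_def
  proof (rule expectation_mult_indep)
    show "depends_on (\<lambda>u. iexp (s * (seg 0 n u - mean n))) {0..<n}"
      by (rule depends_on_comp[OF depends_on_seg, of "\<lambda>y. iexp (s * (y - mean n))"])
    show "depends_on (\<lambda>u. iexp (s * (seg n (n + m) u - mean m))) {n..<n + m}"
      by (rule depends_on_comp[OF depends_on_seg, of "\<lambda>y. iexp (s * (y - mean m))"])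
  qed (use cylinder_iexp_seg in \<open>auto simp only: finite_atLeastLessThan ivl_disj_int\<close>)
  also have "(\<integral>u. iexp (s * (seg n (n + m) u - mean m)) \<partial>P) = \<phi> m s"
    unfolding \<phi>_def seg_shift
    by (rule expectation_restart[of "\<lambda>u. iexp (s * (seg 0 m u - mean m))"]) (rule cylinder_iexp_seg)
  finally show ?thesis .
qed

text \<open>With \<open>w\<close> and \<open>d\<close> the centred versions of \<open>s * glued n m\<close> and of the defect, the left side is the
modulus of the mean of \<open>e\<^sup>i\<^sup>w (e\<^sup>i\<^sup>s\<^sup>d - 1)\<close>.  The quadratic part of \<open>e\<^sup>i\<^sup>s\<^sup>d - 1\<close> is controlled by
the second moment of the defect.  The linear part is \<open>s\<close> times a covariance of the defect with functions
\<open>cos\<close> and \<open>sin\<close> of \<open>w\<close>, which are \<open>|s|\<close>-Lipschitz in \<open>glued n m\<close>; this second factor \<open>s\<close>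
is what makes the block argument for the central limit theorem work.\<close>

lemma char_almost_multiplicative:
  "cmod (\<phi> (n + m) s - \<phi> n s * \<phi> m s) \<le> (2 * K + (4 * A * B)\<^sup>2 / 2) * s\<^sup>2"
proof -
  define w where "w u = s * (glued n m u - expectation (glued n m))" for u
  define d where "d u = defect n m u - expectation (defect n m)" for u
  define R where "R y = iexp y - (1 + \<i> * of_real y)" for y :: real
  have R: "cmod (R y) \<le> y\<^sup>2 / 2" for y
    using iexp_approx1[of y 1] by (simp add: R_def power2_eq_square)
  have cw: "cylinder_fun w" and cd: "cylinder_fun d"
    unfolding w_def[abs_def] d_def[abs_def] by (auto intro!: cylinder_fun_intros cylinder_glued cylinder_defect)
  have cR: "cylinder_fun (\<lambda>u. R (s * d u))"
    unfolding R_def by (intro cylinder_fun_intros cylinder_iexp cylinder_of_real cd)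
  have sw: "cylinder_fun (\<lambda>u. cos (w u))" "cylinder_fun (\<lambda>u. sin (w u))"
    by (rule cylinder_fun_comp[OF cw, of _ 1 0]; simp)+
  have "\<phi> (n + m) s = (\<integral>u. iexp (w u) + (\<i> * s) * (iexp (w u) * of_real (d u)) + iexp (w u) * R (s * d u) \<partial>P)"
    unfolding \<phi>_def
  proof (rule Bochner_Integration.integral_cong)
    fix u
    have "seg 0 (n + m) u - mean (n + m) = (glued n m u - expectation (glued n m)) + d u"
      by (simp add: seg_add expectation_seg_add expectation_glued d_def)
    then have arg: "s * (seg 0 (n + m) u - mean (n + m)) = w u + s * d u"
      by (simp only: w_def distrib_left)
    have "iexp (s * (seg 0 (n + m) u - mean (n + m))) = iexp (w u) * iexp (s * d u)"
      unfolding arg of_real_add distrib_left exp_add ..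
    then show "iexp (s * (seg 0 (n + m) u - mean (n + m))) =
       iexp (w u) + (\<i> * s) * (iexp (w u) * of_real (d u)) + iexp (w u) * R (s * d u)"
      by (simp add: R_def algebra_simps)
  qed simp
  also have "\<dots> = \<phi> n s * \<phi> m s + (\<i> * s) * (\<integral>u. iexp (w u) * of_real (d u) \<partial>P) + (\<integral>u. iexp (w u) * R (s * d u) \<partial>P)"
  proof -
    have "integrable P (\<lambda>u. iexp (w u))" "integrable P (\<lambda>u. iexp (w u) * of_real (d u))"
      "integrable P (\<lambda>u. iexp (w u) * R (s * d u))"
      by (intro integrable_cylinder cylinder_fun_mult cylinder_iexp cylinder_of_real cw cd cR)+
    moreover have "(\<integral>u. iexp (w u) \<partial>P) = \<phi> n s * \<phi> m s"
      unfolding w_def by (rule char_glued)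
    ultimately show ?thesis by simp
  qed
  finally have eq: "\<phi> (n + m) s - \<phi> n s * \<phi> m s
      = (\<i> * s) * (\<integral>u. iexp (w u) * of_real (d u) \<partial>P) + (\<integral>u. iexp (w u) * R (s * d u) \<partial>P)" by simp
  have covg: "\<bar>expectation (\<lambda>u. h (w u) * d u)\<bar> \<le> K * \<bar>s\<bar>"
    if h: "\<And>a b. \<bar>h a - h b\<bar> \<le> \<bar>a - b\<bar>" and ch: "cylinder_fun (\<lambda>u. h (w u))" for h :: "real \<Rightarrow> real"
  proof -
    have "\<bar>cov (defect n m) (\<lambda>u. h (s * (glued n m u - expectation (glued n m))))\<bar> \<le> K * \<bar>s\<bar>"
    proof (rule cov_defect_Lipschitz)
      fix a b
      show "\<bar>h (s * (a - expectation (glued n m))) - h (s * (b - expectation (glued n m)))\<bar> \<le> \<bar>s\<bar> * \<bar>a - b\<bar>"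
        by (rule order_trans[OF h]) (simp add: abs_mult[symmetric] algebra_simps)
    qed
    moreover have "cov (defect n m) (\<lambda>u. h (w u)) = expectation (\<lambda>u. h (w u) * d u)"
    proof -
      have "integrable P (\<lambda>u. h (w u) * defect n m u)" "integrable P (\<lambda>u. h (w u))"
        by (intro integrable_cylinder cylinder_fun_mult ch cylinder_defect)+
      then show ?thesis by (simp add: cov_def d_def right_diff_distrib mult.commute)
    qed
    ultimately show ?thesis by (simp add: w_def)
  qed
  have "(\<integral>u. iexp (w u) * of_real (d u) \<partial>P)
      = of_real (expectation (\<lambda>u. cos (w u) * d u)) + \<i> * of_real (expectation (\<lambda>u. sin (w u) * d u))"
  proof -
    have i: "integrable P (\<lambda>u. complex_of_real (cos (w u) * d u))" "integrable P (\<lambda>u. complex_of_real (sin (w u) * d u))"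
      by (intro integrable_cylinder cylinder_of_real cylinder_fun_mult sw cd)+
    have "(\<integral>u. iexp (w u) * of_real (d u) \<partial>P)
       = (\<integral>u. complex_of_real (cos (w u) * d u) + \<i> * complex_of_real (sin (w u) * d u) \<partial>P)"
      by (rule Bochner_Integration.integral_cong)
         (simp_all add: cis_conv_exp[symmetric] complex_eq_iff)
    also have "\<dots> = (\<integral>u. complex_of_real (cos (w u) * d u) \<partial>P) + \<i> * (\<integral>u. complex_of_real (sin (w u) * d u) \<partial>P)"
      by (simp only: Bochner_Integration.integral_add[OF i(1) integrable_mult_right[OF i(2)]] integral_mult_right_zero)
    finally show ?thesis by (simp only: integral_complex_of_real)
  qed
  then have "cmod (\<integral>u. iexp (w u) * of_real (d u) \<partial>P)
      \<le> \<bar>expectation (\<lambda>u. cos (w u) * d u)\<bar> + \<bar>expectation (\<lambda>u. sin (w u) * d u)\<bar>"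
    by (simp only:) (rule order_trans[OF norm_triangle_ineq], simp add: norm_mult)
  also have "\<dots> \<le> K * \<bar>s\<bar> + K * \<bar>s\<bar>"
    by (intro add_mono covg abs_cos_diff_le abs_sin_diff_le sw)
  also have "\<dots> = 2 * K * \<bar>s\<bar>" by simp
  finally have 1: "cmod (\<integral>u. iexp (w u) * of_real (d u) \<partial>P) \<le> 2 * K * \<bar>s\<bar>" .
  have "cmod (\<integral>u. iexp (w u) * R (s * d u) \<partial>P) \<le> expectation (\<lambda>u. s\<^sup>2 / 2 * (d u)\<^sup>2)"
  proof (rule order_trans[OF integral_norm_bound integral_mono])
    show "integrable P (\<lambda>u. cmod (iexp (w u) * R (s * d u)))"
      by (intro integrable_norm integrable_cylinder cylinder_fun_mult cylinder_iexp cw cR)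
    show "integrable P (\<lambda>u. s\<^sup>2 / 2 * (d u)\<^sup>2)"
      by (intro integrable_cylinder cylinder_fun_intros cd)
    show "cmod (iexp (w u) * R (s * d u)) \<le> s\<^sup>2 / 2 * (d u)\<^sup>2" for u
      using R[of "s * d u"] by (simp add: norm_mult power_mult_distrib)
  qed
  also have "\<dots> = s\<^sup>2 / 2 * (L2 d)\<^sup>2"
    by (simp add: L2_square)
  also have "\<dots> \<le> s\<^sup>2 / 2 * (4 * A * B)\<^sup>2"
  proof (intro mult_left_mono power_mono L2_nonneg)
    show "L2 d \<le> 4 * A * B"
      unfolding d_def[abs_def] using L2_centre[OF cylinder_defect, of n m] L2_defect[of n m] by simp
  qed auto
  finally have 2: "cmod (\<integral>u. iexp (w u) * R (s * d u) \<partial>P) \<le> s\<^sup>2 / 2 * (4 * A * B)\<^sup>2" .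
  have "cmod (\<phi> (n + m) s - \<phi> n s * \<phi> m s)
     \<le> \<bar>s\<bar> * cmod (\<integral>u. iexp (w u) * of_real (d u) \<partial>P) + cmod (\<integral>u. iexp (w u) * R (s * d u) \<partial>P)"
    unfolding eq by (rule order_trans[OF norm_triangle_ineq]) (simp add: norm_mult)
  also have "\<dots> \<le> \<bar>s\<bar> * (2 * K * \<bar>s\<bar>) + s\<^sup>2 / 2 * (4 * A * B)\<^sup>2"
    by (intro add_mono mult_left_mono 1 2) auto
  also have "\<dots> = (2 * K + (4 * A * B)\<^sup>2 / 2) * s\<^sup>2"
    by (simp add: algebra_simps power2_eq_square abs_mult_self_eq)
  finally show ?thesis .
qed


lemma abs_seg_le: "\<bar>seg 0 n u\<bar> \<le> B * real n"
proof -
  have "\<bar>seg 0 n u\<bar> \<le> (\<Sum>i\<in>{0..<n}. \<bar>incr 0 i u\<bar>)"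
    unfolding seg_def by (rule sum_abs)
  also have "\<dots> \<le> real (card {0..<n}) * B"
    by (rule sum_bounded_above) (rule abs_incr_le)
  finally show ?thesis by (simp add: mult.commute)
qed

lemma abs_mean_le: "\<bar>mean n\<bar> \<le> B * real n"
proof -
  have "\<bar>mean n\<bar> \<le> L2 (seg 0 n)"
    unfolding mean_def by (rule expectation_le_L2) (rule cylinder_seg)
  also have "\<dots> \<le> L2 (\<lambda>_. B * real n)"
    by (rule L2_mono) (auto intro: cylinder_seg order_trans[OF abs_seg_le])
  finally show ?thesis using B_nonneg by (simp add: L2_const)
qed

lemma expectation_centred:
  shows "expectation (\<lambda>u. seg 0 n u - mean n) = 0"
    and "expectation (\<lambda>u. (seg 0 n u - mean n)\<^sup>2) = V n"
  using cov_eq_centred[OF cylinder_seg cylinder_seg, of 0 n 0 n] integrable_cylinder[OF cylinder_seg] prob_space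
  by (simp_all add: mean_def V_def power2_eq_square)

lemma V_nonneg: "V n \<ge> 0"
  unfolding V_def by (rule cov_self_nonneg) (rule cylinder_seg)

text \<open>The bound is crude in \<open>n\<close>, as it is only used for block lengths that stay fixed while \<open>s \<rightarrow> 0\<close>.\<close>

lemma char_second_order:
  "cmod (\<phi> n s - (1 - s\<^sup>2 * V n / 2)) \<le> \<bar>s\<bar> ^ 3 * ((2 * B * real n) ^ 3 / 6)"
proof -
  define y where "y u = seg 0 n u - mean n" for u
  define R where "R t = iexp t - (1 + \<i> * of_real t - of_real (t\<^sup>2 / 2))" for t :: real
  have R: "cmod (R t) \<le> \<bar>t\<bar> ^ 3 / 6" for t
    using iexp_approx1[of t 2]
    by (simp add: R_def numeral_2_eq_2 fact_numeral numeral_3_eq_3 power2_eq_square algebra_simps)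
  have cy: "cylinder_fun y"
    unfolding y_def[abs_def] by (intro cylinder_fun_diff cylinder_seg cylinder_fun_const)
  have cR: "cylinder_fun (\<lambda>u. R (s * y u))"
    unfolding R_def by (intro cylinder_fun_intros cylinder_iexp cylinder_of_real cy) 
       (rule cylinder_fun_comp[where K = 0 and M = "1/2", of "\<lambda>u. (s * y u)\<^sup>2" "\<lambda>t. t / 2"], auto intro!: cylinder_fun_intros cy)
  have yb: "\<bar>y u\<bar> \<le> 2 * B * real n" for u
    using abs_seg_le[of n u] abs_mean_le[of n] by (simp add: y_def)
  have i: "integrable P (\<lambda>u. complex_of_real (y u))" "integrable P (\<lambda>u. complex_of_real ((y u)\<^sup>2))" 
      "integrable P (\<lambda>u. R (s * y u))"
    by (intro integrable_cylinder cylinder_of_real cylinder_fun_power cy cR)+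
  have "\<phi> n s = (\<integral>u. 1 + \<i> * s * of_real (y u) - of_real (s\<^sup>2 / 2) * of_real ((y u)\<^sup>2) + R (s * y u) \<partial>P)"
    unfolding \<phi>_def
    by (rule Bochner_Integration.integral_cong) (simp_all add: y_def[symmetric] R_def power_mult_distrib del: of_real_diff)
  also have "\<dots> = 1 + \<i> * s * (\<integral>u. complex_of_real (y u) \<partial>P) - of_real (s\<^sup>2 / 2) * (\<integral>u. complex_of_real ((y u)\<^sup>2) \<partial>P)
      + (\<integral>u. R (s * y u) \<partial>P)"
    using i prob_space
    by (simp add: Bochner_Integration.integral_add Bochner_Integration.integral_diff del: of_real_power)
  also have "\<dots> = (1 - s\<^sup>2 * V n / 2) + (\<integral>u. R (s * y u) \<partial>P)"
    using expectation_centred[of n]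
    by (simp add: integral_complex_of_real y_def del: of_real_power of_real_diff, simp)
  finally have "cmod (\<phi> n s - (1 - s\<^sup>2 * V n / 2)) = cmod (\<integral>u. R (s * y u) \<partial>P)" by simp
  also have "\<dots> \<le> (\<integral>u. cmod (R (s * y u)) \<partial>P)"
    by (rule integral_norm_bound)
  also have "\<dots> \<le> (\<integral>u. \<bar>s\<bar> ^ 3 * ((2 * B * real n) ^ 3 / 6) \<partial>P)"
  proof (rule integral_mono)
    show "integrable P (\<lambda>u. cmod (R (s * y u)))" using i(3) by simp
    show "cmod (R (s * y u)) \<le> \<bar>s\<bar> ^ 3 * ((2 * B * real n) ^ 3 / 6)" for u
    proof -
      have "cmod (R (s * y u)) \<le> \<bar>s\<bar> ^ 3 * (\<bar>y u\<bar> ^ 3 / 6)"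
        using R[of "s * y u"] by (simp add: abs_mult power_mult_distrib)
      also have "\<dots> \<le> \<bar>s\<bar> ^ 3 * ((2 * B * real n) ^ 3 / 6)"
        by (intro mult_left_mono divide_right_mono power_mono yb) auto
      finally show ?thesis .
    qed
  qed simp
  finally show ?thesis using prob_space by simp
qed

text \<open>Errors against the Gaussian \<open>\<psi>\<close> are subadditive up to \<open>O(s\<^sup>2)\<close>, since all the functions involved
are bounded by \<open>1\<close>.  Cutting \<open>n\<close> into \<open>n div b\<close> blocks of length \<open>b\<close> and a remainder, each piece
contributes a second order error \<open>O(s\<^sup>2)\<close> uniform in its length (by the linear growth of the variance)
and a third order error depending on \<open>b\<close>.\<close>

lemma char_close_to_gaussian:
  assumes \<sigma>: "\<sigma>2 \<ge> 0" and V: "\<And>n. \<bar>V n - \<sigma>2 * real n\<bar> \<le> C" and b: "b > 0" and s: "\<bar>s\<bar> \<le> 1"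
  defines "K' \<equiv> 2 * K + (4 * A * B)\<^sup>2 / 2"
    and "Q \<equiv> (2 * B * real b) ^ 3 / 6 + (\<sigma>2 * real b / 2)\<^sup>2"
  shows "cmod (\<phi> n s - exp (- (\<sigma>2 * s\<^sup>2 * real n / 2)))
    \<le> (real n / real b + 1) * ((C / 2 + K') * s\<^sup>2 + \<bar>s\<bar> ^ 3 * Q)"
proof -
  define \<psi> where "\<psi> n = exp (- (\<sigma>2 * s\<^sup>2 * real n / 2))" for n
  define \<Delta> where "\<Delta> n = cmod (\<phi> n s - of_real (\<psi> n))" for n
  have C: "C \<ge> 0" using V[of 0] by simp
  have K': "K' \<ge> 0" by (simp add: K'_def K_def A_nonneg)
  have small: "\<Delta> r \<le> C / 2 * s\<^sup>2 + \<bar>s\<bar> ^ 3 * Q" if r: "r \<le> b" for r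
  proof -
    define y where "y = \<sigma>2 * s\<^sup>2 * real r / 2"
    have y: "y \<ge> 0" using \<sigma> by (simp add: y_def)
    have "\<phi> r s - of_real (\<psi> r) = (\<phi> r s - (1 - s\<^sup>2 * V r / 2))
        + (of_real (s\<^sup>2 / 2 * (\<sigma>2 * real r - V r)) - of_real (\<psi> r - (1 - y)))"
      by (simp add: y_def field_simps)
    then have "\<Delta> r \<le> cmod (\<phi> r s - (1 - s\<^sup>2 * V r / 2))
        + (\<bar>s\<^sup>2 / 2 * (\<sigma>2 * real r - V r)\<bar> + \<bar>\<psi> r - (1 - y)\<bar>)"
      unfolding \<Delta>_def
      by (simp only:) (rule order_trans[OF norm_triangle_ineq add_left_mono[OF order_trans[OF norm_triangle_ineq4]]], simp only: norm_of_real)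
    also have "\<dots> \<le> \<bar>s\<bar> ^ 3 * ((2 * B * real b) ^ 3 / 6) + (s\<^sup>2 / 2 * C + \<bar>s\<bar> ^ 3 * (\<sigma>2 * real b / 2)\<^sup>2)"
    proof (intro add_mono)
      show "cmod (\<phi> r s - (1 - s\<^sup>2 * V r / 2)) \<le> \<bar>s\<bar> ^ 3 * ((2 * B * real b) ^ 3 / 6)"
        by (rule order_trans[OF char_second_order])
           (use r B_nonneg in \<open>auto intro!: mult_left_mono divide_right_mono power_mono\<close>)
      show "\<bar>s\<^sup>2 / 2 * (\<sigma>2 * real r - V r)\<bar> \<le> s\<^sup>2 / 2 * C"
        using V[of r] by (simp add: abs_mult abs_minus_commute mult_left_mono)
      have "\<bar>\<psi> r - (1 - y)\<bar> \<le> y\<^sup>2"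
        unfolding \<psi>_def y_def[symmetric] by (rule exp_minus_second_order) (rule y)
      also have "\<dots> = \<bar>s\<bar> ^ 4 * (\<sigma>2 * real r / 2)\<^sup>2"
        by (simp add: y_def power_mult_distrib power_divide)
      also have "\<dots> \<le> \<bar>s\<bar> ^ 3 * (\<sigma>2 * real b / 2)\<^sup>2"
        using s \<sigma> r by (intro mult_mono power_decreasing power_mono divide_right_mono mult_left_mono) auto
      finally show "\<bar>\<psi> r - (1 - y)\<bar> \<le> \<bar>s\<bar> ^ 3 * (\<sigma>2 * real b / 2)\<^sup>2" .
    qed
    finally show ?thesis by (simp add: Q_def algebra_simps)
  qed
  have \<psi>1: "\<bar>\<psi> n\<bar> \<le> 1" for n using \<sigma> by (simp add: \<psi>_def)
  have add: "\<Delta> (n + m) \<le> \<Delta> n + \<Delta> m + K' * s\<^sup>2" for n m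
  proof -
    have "\<psi> (n + m) = \<psi> n * \<psi> m"
      by (simp add: \<psi>_def exp_add[symmetric] algebra_simps add_divide_distrib)
    then have "\<phi> (n + m) s - of_real (\<psi> (n + m)) = (\<phi> (n + m) s - \<phi> n s * \<phi> m s)
        + (\<phi> n s * (\<phi> m s - of_real (\<psi> m)) + of_real (\<psi> m) * (\<phi> n s - of_real (\<psi> n)))"
      by (simp add: algebra_simps)
    then have "\<Delta> (n + m) \<le> cmod (\<phi> (n + m) s - \<phi> n s * \<phi> m s)
        + (cmod (\<phi> n s) * \<Delta> m + \<bar>\<psi> m\<bar> * \<Delta> n)"
      unfolding \<Delta>_def
      by (simp only:) (rule order_trans[OF norm_triangle_ineq add_left_mono[OF order_trans[OF norm_triangle_ineq]]], simp only: norm_mult norm_of_real)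
    also have "\<dots> \<le> K' * s\<^sup>2 + (1 * \<Delta> m + 1 * \<Delta> n)"
      unfolding K'_def
      by (intro add_mono char_almost_multiplicative mult_right_mono cmod_\<phi>_le_1 \<psi>1) (auto simp: \<Delta>_def)
    finally show ?thesis by simp
  qed
  have "\<Delta> (k * b + r) \<le> (real k + 1) * ((C / 2 + K') * s\<^sup>2 + \<bar>s\<bar> ^ 3 * Q)" if r: "r \<le> b" for k r
  proof (induction k)
    case 0
    have "0 \<le> K' * s\<^sup>2" using K' by simp
    then show ?case using small[OF r] by (simp add: algebra_simps)
  next
    case (Suc k)
    have "\<Delta> (b + (k * b + r)) \<le> \<Delta> b + \<Delta> (k * b + r) + K' * s\<^sup>2" by (rule add)
    also have "\<dots> \<le> (C / 2 * s\<^sup>2 + \<bar>s\<bar> ^ 3 * Q) + (real k + 1) * ((C / 2 + K') * s\<^sup>2 + \<bar>s\<bar> ^ 3 * Q) + K' * s\<^sup>2"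
      by (intro add_mono Suc.IH small order_refl)
    finally show ?case by (simp add: algebra_simps add_divide_distrib)
  qed
  from this[of "n mod b" "n div b"] have "\<Delta> n \<le> (real (n div b) + 1) * ((C / 2 + K') * s\<^sup>2 + \<bar>s\<bar> ^ 3 * Q)"
    using b by (simp add: less_imp_le)
  also have "\<dots> \<le> (real n / real b + 1) * ((C / 2 + K') * s\<^sup>2 + \<bar>s\<bar> ^ 3 * Q)"
    using b C K' B_nonneg
    by (intro mult_right_mono add_mono of_nat_div_le_of_nat) (auto simp: Q_def intro!: add_nonneg_nonneg mult_nonneg_nonneg)
  finally show ?thesis unfolding \<Delta>_def \<psi>_def by (simp del: of_real_exp)
qed

theorem increments_clt:
  "\<exists>\<theta> \<sigma>2 C. (\<forall>n. \<bar>mean n - \<theta> * real n\<bar> \<le> C) \<and> (\<forall>n. \<bar>V n - \<sigma>2 * real n\<bar> \<le> C) \<and>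
    (\<lambda>n. \<integral>u. iexp ((seg 0 n u - \<theta> * real n) / sqrt (real n)) \<partial>P) \<longlonglongrightarrow> exp (- \<sigma>2 / 2)"
proof -
  obtain \<theta> where \<theta>: "\<And>n. \<bar>mean n - \<theta> * real n\<bar> \<le> 4 * A * B"
    using almost_additive_limit[of mean "4 * A * B"] mean_almost_additive by blast
  obtain \<sigma>2 where \<sigma>2: "\<And>n. \<bar>V n - \<sigma>2 * real n\<bar> \<le> 2 * K + (4 * A * B)\<^sup>2"
    using almost_additive_limit[of V "2 * K + (4 * A * B)\<^sup>2"] V_almost_additive by blast
  define C where "C = max (4 * A * B) (2 * K + (4 * A * B)\<^sup>2)"
  have 1: "\<bar>mean n - \<theta> * real n\<bar> \<le> C" and 2: "\<bar>V n - \<sigma>2 * real n\<bar> \<le> C" for n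
    using \<theta>[of n] \<sigma>2[of n] by (auto simp: C_def)
  have C: "C \<ge> 0" using 1[of 0] by linarith
  have \<sigma>: "\<sigma>2 \<ge> 0"
  proof (rule ccontr)
    assume "\<not> \<sigma>2 \<ge> 0"
    then obtain n where "C < real n * (- \<sigma>2)"
      using reals_Archimedean3[of "- \<sigma>2"] by auto
    then show False using 2[of n] V_nonneg[of n] by (simp add: algebra_simps)
  qed
  define K' where "K' = C / 2 + (2 * K + (4 * A * B)\<^sup>2 / 2)"
  have K': "K' \<ge> 0" using C by (simp add: K'_def K_def A_nonneg)
  have main: "(\<lambda>n. \<phi> n (1 / sqrt n) - exp (- \<sigma>2 / 2)) \<longlonglongrightarrow> 0"
  proof (rule LIMSEQ_I)
    fix e :: real assume e: "e > 0"
    \<comment> \<open>the bound of the preceding lemma tends to \<open>K' / b\<close> as \<open>n\<close> grows, for fixed block length \<open>b\<close>\<close>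
    obtain b :: nat where b: "K' / (e / 2) < b" using reals_Archimedean2 by blast
    have b0: "b > 0"
    proof (rule ccontr)
      assume "\<not> b > 0"
      then have "K' / (e / 2) < 0" using b by simp
      moreover have "K' / (e / 2) \<ge> 0" using K' e by simp
      ultimately show False by linarith
    qed
    define Q where "Q = (2 * B * real b) ^ 3 / 6 + (\<sigma>2 * real b / 2)\<^sup>2"
    have bound: "cmod (\<phi> n (1 / sqrt n) - exp (- \<sigma>2 / 2))
        \<le> (real n / real b + 1) * (K' * (1 / sqrt n)\<^sup>2 + (1 / sqrt n) ^ 3 * Q)" if n: "n \<ge> 1" for n
    proof -
      have "cmod (\<phi> n (1 / sqrt n) - exp (- (\<sigma>2 * (1 / sqrt n)\<^sup>2 * real n / 2)))
          \<le> (real n / real b + 1) * (K' * (1 / sqrt n)\<^sup>2 + \<bar>1 / sqrt n\<bar> ^ 3 * Q)"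
        unfolding K'_def Q_def
        by (rule char_close_to_gaussian[OF \<sigma> 2 b0]) (use n in auto)
      moreover have "\<sigma>2 * (1 / sqrt n)\<^sup>2 * real n / 2 = \<sigma>2 / 2"
        using n by (simp add: power_divide)
      ultimately show ?thesis by simp
    qed
    have "(\<lambda>n. (real n / real b + 1) * (K' * (1 / sqrt n)\<^sup>2 + (1 / sqrt n) ^ 3 * Q)) \<longlonglongrightarrow> K' / b"
      using b0 by (real_asymp, simp add: field_simps)
    moreover have "K' / b < e"
    proof -
      have "K' * 2 < e * real b" using b e by (simp add: field_simps)
      then have "K' < e * real b" using K' by linarith
      then show ?thesis using b0 by (simp add: field_simps)
    qed
    ultimately have "eventually (\<lambda>n. (real n / real b + 1) * (K' * (1 / sqrt n)\<^sup>2 + (1 / sqrt n) ^ 3 * Q) < e) sequentially"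
      by (rule order_tendstoD(2))
    then have "eventually (\<lambda>n. cmod (\<phi> n (1 / sqrt n) - exp (- \<sigma>2 / 2) - 0) < e) sequentially"
      using eventually_ge_at_top[of 1] by eventually_elim (use bound in force)
    then show "\<exists>no. \<forall>n\<ge>no. cmod (\<phi> n (1 / sqrt n) - exp (- \<sigma>2 / 2) - 0) < e"
      by (simp add: eventually_sequentially)
  qed
  have "(\<lambda>n. iexp ((mean n - \<theta> * real n) / sqrt n) * \<phi> n (1 / sqrt n)) \<longlonglongrightarrow> iexp 0 * exp (- \<sigma>2 / 2)"
  proof (rule tendsto_mult)
    have "(\<lambda>n. (mean n - \<theta> * real n) / sqrt n) \<longlonglongrightarrow> 0"
    proof (rule Lim_null_comparison)
      show "eventually (\<lambda>n. norm ((mean n - \<theta> * real n) / sqrt n) \<le> C / sqrt n) sequentially"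
        using 1 by (intro always_eventually allI) (simp add: divide_right_mono)
      show "(\<lambda>n. C / sqrt (real n)) \<longlonglongrightarrow> 0" by real_asymp
    qed
    then show "(\<lambda>n. iexp ((mean n - \<theta> * real n) / sqrt n)) \<longlonglongrightarrow> iexp 0"
      by (intro tendsto_intros)
    show "(\<lambda>n. \<phi> n (1 / sqrt n)) \<longlonglongrightarrow> complex_of_real (exp (- \<sigma>2 / 2))"
      using main by (simp add: LIM_zero_iff)
  qed
  moreover have "iexp ((mean n - \<theta> * real n) / sqrt n) * \<phi> n (1 / sqrt n)
      = (\<integral>u. iexp ((seg 0 n u - \<theta> * real n) / sqrt (real n)) \<partial>P)" for n
  proof -
    have "iexp ((mean n - \<theta> * real n) / sqrt n) * \<phi> n (1 / sqrt n)
      = (\<integral>u. iexp ((mean n - \<theta> * real n) / sqrt n) * iexp (1 / sqrt n * (seg 0 n u - mean n)) \<partial>P)"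
      unfolding \<phi>_def by (rule integral_mult_right_zero[symmetric])
    also have "\<dots> = (\<integral>u. iexp ((seg 0 n u - \<theta> * real n) / sqrt (real n)) \<partial>P)"
      by (rule Bochner_Integration.integral_cong)
         (simp_all add: exp_add[symmetric] diff_divide_distrib algebra_simps)
    finally show ?thesis .
  qed
  ultimately have 3: "(\<lambda>n. \<integral>u. iexp ((seg 0 n u - \<theta> * real n) / sqrt (real n)) \<partial>P) \<longlonglongrightarrow> exp (- \<sigma>2 / 2)"
    by simp
  show ?thesis by (intro exI[of _ \<theta>] exI[of _ \<sigma>2] exI[of _ C] conjI allI 1 2 3)
qed

end

section \<open>Cut times of a random walk with positive drift\<close>

locale drifting_noise = iid_noise N for N +
  fixes Z :: "nat \<Rightarrow> real" and l :: real
  assumes Z_bound: "\<bar>Z a\<bar> \<le> l"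
    and Z_drift: "measure_pmf.expectation N Z > 0"
begin

definition sumZ :: "nat \<Rightarrow> nat \<Rightarrow> (nat \<Rightarrow> nat) \<Rightarrow> real" where
  "sumZ s t u = (\<Sum>i\<in>{s..<t}. Z (u i))"

lemma depends_on_sumZ: "depends_on (sumZ s t) {s..<t}"
  unfolding sumZ_def[abs_def] by (intro depends_on_sum depends_on_coord)

lemma sumZ_split: "s \<le> c \<Longrightarrow> c \<le> t \<Longrightarrow> sumZ s t u = sumZ s c u + sumZ c t u"
  unfolding sumZ_def by (rule sum.atLeastLessThan_concat[symmetric])

lemma integrable_pmf_bounded:
  fixes f :: "nat \<Rightarrow> real" assumes "\<And>a. \<bar>f a\<bar> \<le> B" shows "integrable (measure_pmf N) f"
  by (rule measure_pmf.integrable_const_bound[of _ B]) (auto simp: assms)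

text \<open>An exponential Markov inequality: for small \<open>\<gamma> > 0\<close> the mean \<open>\<rho>\<close> of \<open>e\<^sup>-\<^sup>\<gamma>\<^sup>Z\<close> is less than \<open>1\<close>, because
\<open>e\<^sup>-\<^sup>\<gamma>\<^sup>Z \<le> 1 - \<gamma> Z + \<gamma>\<^sup>2 Z\<^sup>2\<close> and the drift dominates the quadratic term.\<close>

lemma exponential_drift:
  obtains \<gamma> \<rho> where "\<gamma> > 0" "0 < \<rho>" "\<rho> < 1"
    "\<And>s t a. prob {u. sumZ s t u \<le> - a} \<le> exp (- \<gamma> * a) * \<rho> ^ (t - s)"
proof -
  define \<delta> where "\<delta> = measure_pmf.expectation N Z"
  define l' where "l' = l + 1"
  have \<delta>: "\<delta> > 0" using Z_drift by (simp add: \<delta>_def)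
  have l0: "l \<ge> 0" using Z_bound[of 0] by linarith
  then have l': "l' > 0" by (simp add: l'_def)
  have Zl: "\<bar>Z a\<bar> \<le> l'" for a using Z_bound[of a] by (simp add: l'_def)
  define \<gamma> where "\<gamma> = min (1 / l') (\<delta> / (2 * l'\<^sup>2))"
  have \<gamma>: "\<gamma> > 0" "\<gamma> * l' \<le> 1" "\<gamma> * l'\<^sup>2 \<le> \<delta> / 2"
  proof -
    show "\<gamma> > 0" using \<delta> l' by (simp add: \<gamma>_def)
    have "\<gamma> * l' \<le> 1 / l' * l'" using l' by (intro mult_right_mono) (auto simp: \<gamma>_def)
    then show "\<gamma> * l' \<le> 1" using l' by simp
    have "\<gamma> * l'\<^sup>2 \<le> \<delta> / (2 * l'\<^sup>2) * l'\<^sup>2" by (intro mult_right_mono) (auto simp: \<gamma>_def)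
    then show "\<gamma> * l'\<^sup>2 \<le> \<delta> / 2" using l' by simp
  qed
  have \<gamma>Z: "\<bar>\<gamma> * Z a\<bar> \<le> 1" for a
  proof -
    have "\<gamma> * \<bar>Z a\<bar> \<le> 1"
      by (rule order_trans[OF mult_left_mono[OF Zl] \<gamma>(2)]) (use \<gamma>(1) in simp)
    then show ?thesis using \<gamma>(1) by (simp add: abs_mult)
  qed
  define f where "f a = exp (- (\<gamma> * Z a))" for a
  have f_bound: "\<bar>f a\<bar> \<le> exp 1" for a
    using \<gamma>Z[of a] by (simp add: f_def)
  define \<rho> where "\<rho> = measure_pmf.expectation N f"
  have int: "integrable (measure_pmf N) Z" "integrable (measure_pmf N) f"
    using Z_bound f_bound by (auto intro: integrable_pmf_bounded)
  have "\<rho> \<le> measure_pmf.expectation N (\<lambda>a. 1 - \<gamma> * Z a + \<gamma> * (\<delta> / 2))"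
    unfolding \<rho>_def
  proof (rule integral_mono)
    fix a
    have "f a \<le> 1 - \<gamma> * Z a + (\<gamma> * Z a)\<^sup>2"
      unfolding f_def using \<gamma>Z[of a] by (intro exp_minus_le_quadratic) (simp add: abs_le_iff)
    also have "(\<gamma> * Z a)\<^sup>2 \<le> \<gamma> * (\<gamma> * l'\<^sup>2)"
    proof -
      have "(Z a)\<^sup>2 \<le> l'\<^sup>2" using Zl[of a] l' by (simp add: abs_le_square_iff[symmetric])
      then have "(\<gamma> * \<gamma>) * (Z a)\<^sup>2 \<le> (\<gamma> * \<gamma>) * l'\<^sup>2" using \<gamma> by (intro mult_left_mono) auto
      then show ?thesis by (simp add: power2_eq_square algebra_simps)
    qed
    also have "\<dots> \<le> \<gamma> * (\<delta> / 2)" using \<gamma> by (intro mult_left_mono) auto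
    finally show "f a \<le> 1 - \<gamma> * Z a + \<gamma> * (\<delta> / 2)" by simp
  qed (use int in auto)
  also have "\<dots> = 1 - \<gamma> * (\<delta> / 2)"
    using int by (simp add: \<delta>_def)
  also have "\<dots> < 1" using \<gamma> \<delta> by simp
  finally have \<rho>1: "\<rho> < 1" .
  have \<rho>0: "\<rho> > 0"
  proof -
    have "exp (- 1) \<le> \<rho>"
    proof -
      have "measure_pmf.expectation N (\<lambda>a. exp (- 1)) \<le> \<rho>"
        unfolding \<rho>_def
      proof (rule integral_mono)
        show "exp (- 1) \<le> f a" for a
          using \<gamma>Z[of a] by (simp add: f_def)
      qed (use int in auto)
      then show ?thesis by simp
    qed
    then show ?thesis using exp_gt_zero less_le_trans by blast
  qed
  have "prob {u. sumZ s t u \<le> - a} \<le> exp (- \<gamma> * a) * \<rho> ^ (t - s)" for s t a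
  proof -
    have ev: "{u. sumZ s t u \<le> - a} \<in> events"
      by (rule events_depends_on[OF depends_on_comp[OF depends_on_sumZ]]) simp
    have cp: "cylinder_fun (\<lambda>u. \<Prod>i\<in>I. f (u i))" if "finite I" for I
      using that
    proof (induction I)
      case (insert i I)
      have "cylinder_fun (\<lambda>u. f (u i))"
        by (rule cylinder_funI[where B = "exp 1" and A = "{i}"]) (auto intro: depends_on_coord f_bound)
      with insert show ?case by (simp add: cylinder_fun_mult)
    qed simp
    have "prob {u. sumZ s t u \<le> - a} = expectation (indicator {u. sumZ s t u \<le> - a})"
      using ev by simp
    also have "\<dots> \<le> expectation (\<lambda>u. exp (- \<gamma> * a) * (\<Prod>i\<in>{s..<t}. f (u i)))"
    proof (rule integral_mono)
      show "integrable P (indicator {u. sumZ s t u \<le> - a} :: _ \<Rightarrow> real)"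
        using ev by (simp add: emeasure_eq_measure)
      show "integrable P (\<lambda>u. exp (- \<gamma> * a) * (\<Prod>i\<in>{s..<t}. f (u i)))"
        by (intro integrable_cylinder cylinder_fun_mult cp cylinder_fun_const) simp
      fix u
      have eq: "exp (- \<gamma> * a) * (\<Prod>i\<in>{s..<t}. f (u i)) = exp (- \<gamma> * (a + sumZ s t u))"
        by (simp add: f_def exp_sum[symmetric] exp_add[symmetric] sumZ_def sum_negf sum_distrib_left algebra_simps)
      show "indicator {u. sumZ s t u \<le> - a} u \<le> exp (- \<gamma> * a) * (\<Prod>i\<in>{s..<t}. f (u i))"
        unfolding eq using \<gamma> by (auto simp: indicator_def mult_le_0_iff)
    qed
    also have "\<dots> = exp (- \<gamma> * a) * expectation (\<lambda>u. \<Prod>i\<in>{s..<t}. f (u i))"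
      by (rule integral_mult_right_zero)
    also have "\<dots> = exp (- \<gamma> * a) * \<rho> ^ (t - s)"
      using f_bound by (subst expectation_prod_coordinates) (auto simp: \<rho>_def)
    finally show ?thesis .
  qed
  then show ?thesis using that \<gamma>(1) \<rho>0 \<rho>1 by blast
qed

text \<open>A cut seen through a window of radius \<open>g\<close>, hence depending on finitely many coordinates and
independent for disjoint windows; a cut in the sense of \<open>cut\<close> looks at all intervals around \<open>c\<close>
that end by time \<open>n\<close>.  The case \<open>t = c\<close> makes \<open>cut\<close> include the sums ending at \<open>c\<close>.\<close>

definition local_cut :: "nat \<Rightarrow> nat \<Rightarrow> (nat \<Rightarrow> nat) \<Rightarrow> bool" where
  "local_cut c g u \<longleftrightarrow> (\<forall>s\<in>{c - g..<c}. sumZ s c u > 0) \<and> (\<forall>t\<in>{c<..c + g}. sumZ c t u > 0)"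

definition cut :: "nat \<Rightarrow> nat \<Rightarrow> (nat \<Rightarrow> nat) \<Rightarrow> bool" where
  "cut c n u \<longleftrightarrow> (\<forall>s\<in>{..<c}. \<forall>t\<in>{c..n}. sumZ s t u > 0)"

lemma depends_on_local_cut: "depends_on (local_cut c g) {c - g..<c + g}"
  unfolding local_cut_def[abs_def]
  by (rule depends_on_comp2[where h = "(\<and>)"]; intro depends_on_Ball depends_on_comp[of _ _ "\<lambda>x. x > 0"] depends_on_mono[OF depends_on_sumZ])
    auto

text \<open>Force the noise to take one value \<open>a0\<close> with \<open>Z a0 \<ge> \<delta>\<close>, the mean of \<open>Z\<close>, for \<open>h\<close> steps on either
side of \<open>c\<close>.  This has a fixed positive probability and creates a reserve \<open>\<delta> h\<close> on each side, which the
sums outside use up with probability at most \<open>1 / 2\<close> if \<open>h\<close> is large.  Both events are independent.\<close>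

lemma local_cut_probability:
  obtains p where "0 < p" "p \<le> 1" "\<And>c g. g \<le> c \<Longrightarrow> p \<le> prob {u. local_cut c g u}"
proof -
  obtain \<gamma> \<rho> where \<gamma>: "\<gamma> > 0" and \<rho>: "0 < \<rho>" "\<rho> < 1"
    and ld: "\<And>s t a. prob {u. sumZ s t u \<le> - a} \<le> exp (- \<gamma> * a) * \<rho> ^ (t - s)"
    by (rule exponential_drift) blast
  define \<delta> where "\<delta> = measure_pmf.expectation N Z"
  have \<delta>: "\<delta> > 0" using Z_drift by (simp add: \<delta>_def)
  obtain a0 where a0: "a0 \<in> set_pmf N" "Z a0 \<ge> \<delta>"
  proof (rule ccontr)
    assume "\<not> thesis"
    with that have lt: "Z a < \<delta>" if "a \<in> set_pmf N" for a using \<open>a \<in> set_pmf N\<close> by force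
    have i: "integrable (measure_pmf N) Z" by (rule integrable_pmf_bounded) (rule Z_bound)
    have "measure_pmf.expectation N Z < measure_pmf.expectation N (\<lambda>_. \<delta>)"
    proof (rule measure_pmf.integral_less_AE_space)
      show "AE a in measure_pmf N. Z a < \<delta>" by (simp add: AE_measure_pmf_iff lt)
    qed (use i in auto)
    then show False by (simp add: \<delta>_def)
  qed
  define p1 where "p1 = pmf N a0"
  have p1: "0 < p1" "p1 \<le> 1" using a0 by (simp_all add: p1_def pmf_positive pmf_le_1)
  have "(\<lambda>h. exp (- \<gamma> * (\<delta> * real h))) \<longlonglongrightarrow> 0"
    using \<gamma> \<delta> by real_asymp
  then have "eventually (\<lambda>h. exp (- \<gamma> * (\<delta> * real h)) < (1 - \<rho>) / 4) sequentially"
    by (rule order_tendstoD) (use \<rho> in auto)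
  then obtain h where h: "exp (- \<gamma> * (\<delta> * real h)) < (1 - \<rho>) / 4"
    by (auto simp: eventually_sequentially)
  have main: "p1 ^ (2 * h) / 2 \<le> prob {u. local_cut c g u}" if g: "g \<le> c" for c g
  proof -
    \<comment> \<open>the window may be shorter than the forced stretch, in which case \<open>E2\<close> is vacuous\<close>
    define k where "k = min h g"
    have k: "k \<le> c" "k \<le> g" "k \<le> h" using g by (auto simp: k_def)
    define E1 where "E1 u \<longleftrightarrow> (\<forall>i\<in>{c - k..<c + k}. u i = a0)" for u :: "nat \<Rightarrow> nat"
    define E2 where "E2 u \<longleftrightarrow> (\<forall>t\<in>{c + k<..c + g}. sumZ (c + k) t u > - (\<delta> * k))
       \<and> (\<forall>s\<in>{c - g..<c - k}. sumZ s (c - k) u > - (\<delta> * k))" for u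
    have d1: "depends_on E1 {c - k..<c + k}"
      unfolding E1_def[abs_def] by (intro depends_on_Ball depends_on_coord)
    have d2: "depends_on E2 ({c - g..<c - k} \<union> {c + k..<c + g})"
      unfolding E2_def[abs_def]
      by (rule depends_on_comp2[where h = "(\<and>)"];
          intro depends_on_Ball depends_on_comp[of _ _ "\<lambda>x. x > - (\<delta> * k)"] depends_on_mono[OF depends_on_sumZ]) auto
    have imp: "local_cut c g u" if "E1 u \<and> E2 u" for u
    proof -
      have const: "sumZ s t u \<ge> \<delta> * real (t - s)" if "c - k \<le> s" "t \<le> c + k" for s t
      proof -
        have "real (card {s..<t}) * \<delta> \<le> sumZ s t u"
          unfolding sumZ_def
          by (rule sum_bounded_below) (use \<open>E1 u \<and> E2 u\<close> that a0(2) in \<open>auto simp: E1_def\<close>)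
        then show ?thesis by (simp add: mult.commute)
      qed
      show ?thesis unfolding local_cut_def
      proof safe
        fix s assume s: "s \<in> {c - g..<c}"
        show "sumZ s c u > 0"
        proof (cases "c - k \<le> s")
          case True
          have "0 < \<delta> * real (c - s)" using s \<delta> by simp
          also have "\<dots> \<le> sumZ s c u" using True by (intro const) auto
          finally show ?thesis .
        next
          case False
          then have "sumZ s (c - k) u > - (\<delta> * k)" using that s by (auto simp: E2_def)
          moreover have "sumZ (c - k) c u \<ge> \<delta> * k" using const[of "c - k" c] k by simp
          ultimately show ?thesis using sumZ_split[of s "c - k" c u] False by simp
        qed
      next
        fix t assume t: "t \<in> {c<..c + g}"
        show "sumZ c t u > 0"
        proof (cases "t \<le> c + k")
          case True
          have "0 < \<delta> * real (t - c)" using t \<delta> by simp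
          also have "\<dots> \<le> sumZ c t u" using True by (intro const) auto
          finally show ?thesis .
        next
          case False
          then have "sumZ (c + k) t u > - (\<delta> * k)" using that t by (auto simp: E2_def)
          moreover have "sumZ c (c + k) u \<ge> \<delta> * k" using const[of c "c + k"] by simp
          ultimately show ?thesis using sumZ_split[of c "c + k" t u] False by simp
        qed
      qed
    qed
    have ev2: "{u. E2 u} \<in> events" by (rule events_depends_on[OF d2]) simp
    have P1: "prob {u. E1 u} \<ge> p1 ^ (2 * h)"
    proof -
      have "{u. E1 u} \<in> events" by (rule events_depends_on[OF d1]) simp
      then have "prob {u. E1 u} = expectation (indicator {u. E1 u})" by simp
      also have "\<dots> = expectation (\<lambda>u. \<Prod>i\<in>{c - k..<c + k}. indicator {a0} (u i))"
        by (rule Bochner_Integration.integral_cong) (auto simp: E1_def indicator_def)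
      also have "\<dots> = measure_pmf.expectation N (indicator {a0}) ^ card {c - k..<c + k}"
        by (rule expectation_prod_coordinates[where B = 1]) (auto simp: indicator_def)
      also have "\<dots> = p1 ^ (2 * k)"
        using k by (simp add: p1_def measure_pmf_single mult_2)
      also have "\<dots> \<ge> p1 ^ (2 * h)"
        using p1 k by (intro power_decreasing) auto
      finally show ?thesis .
    qed
    have P2: "prob {u. \<not> E2 u} \<le> 1 / 2"
    proof (cases "k = g")
      case True
      then show ?thesis by (simp add: E2_def)
    next
      case False
      then have kh: "k = h" by (auto simp: k_def)
      define e where "e = exp (- \<gamma> * (\<delta> * real k))"
      have "{u. \<not> E2 u} \<subseteq> (\<Union>t\<in>{c + k<..c + g}. {u. sumZ (c + k) t u \<le> - (\<delta> * k)})
          \<union> (\<Union>s\<in>{c - g..<c - k}. {u. sumZ s (c - k) u \<le> - (\<delta> * k)})"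
        unfolding E2_def by (auto simp: not_less)
      moreover have ev: "{u. sumZ s t u \<le> a} \<in> events" for s t a
        by (rule events_depends_on[OF depends_on_comp[OF depends_on_sumZ]]) simp
      ultimately have "prob {u. \<not> E2 u} \<le> prob ((\<Union>t\<in>{c + k<..c + g}. {u. sumZ (c + k) t u \<le> - (\<delta> * k)})
          \<union> (\<Union>s\<in>{c - g..<c - k}. {u. sumZ s (c - k) u \<le> - (\<delta> * k)}))"
        by (intro finite_measure_mono) auto
      also have "\<dots> \<le> (\<Sum>t\<in>{c + k<..c + g}. prob {u. sumZ (c + k) t u \<le> - (\<delta> * k)})
          + (\<Sum>s\<in>{c - g..<c - k}. prob {u. sumZ s (c - k) u \<le> - (\<delta> * k)})"
        using ev by (intro order_trans[OF measure_Un_le] add_mono finite_measure_subadditive_finite) auto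
      also have "\<dots> \<le> (\<Sum>t\<in>{c + k<..c + g}. e * \<rho> ^ (t - (c + k))) + (\<Sum>s\<in>{c - g..<c - k}. e * \<rho> ^ (c - k - s))"
        unfolding e_def by (intro add_mono sum_mono ld)
      also have "(\<Sum>t\<in>{c + k<..c + g}. e * \<rho> ^ (t - (c + k))) = (\<Sum>i\<in>{1..<Suc (g - k)}. e * \<rho> ^ i)"
        by (rule sum.reindex_bij_witness[where i = "\<lambda>i. c + k + i" and j = "\<lambda>t. t - (c + k)"]) auto
      also have "(\<Sum>s\<in>{c - g..<c - k}. e * \<rho> ^ (c - k - s)) = (\<Sum>i\<in>{1..<Suc (g - k)}. e * \<rho> ^ i)"
        using g k
        by (intro sum.reindex_bij_witness[where i = "\<lambda>i. c - k - i" and j = "\<lambda>s. c - k - s"]) auto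
      also have "(\<Sum>i\<in>{1..<Suc (g - k)}. e * \<rho> ^ i) \<le> e * (\<Sum>i<Suc (g - k). \<rho> ^ i)"
        unfolding sum_distrib_left using \<rho> by (intro sum_mono2) (auto simp: e_def)
      also have "\<dots> \<le> e * (1 / (1 - \<rho>))"
        using \<rho> by (intro mult_left_mono sum_powers_le) (auto simp: e_def)
      also have "\<dots> \<le> 1 / 4"
        using h \<rho> by (simp add: e_def kh field_simps)
      finally show ?thesis by simp
    qed
    have "{u. \<not> E2 u} = space P - {u. E2 u}" by auto
    then have "prob {u. E2 u} \<ge> 1 / 2" using P2 prob_compl[OF ev2] by simp
    then have "p1 ^ (2 * h) * (1 / 2) \<le> prob {u. E1 u} * prob {u. E2 u}"
      using P1 p1 by (intro mult_mono) auto
    also have "\<dots> = prob {u. E1 u \<and> E2 u}"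
      by (rule prob_conj_indep[symmetric, OF d1 _ d2]) (use k in auto)
    also have "\<dots> \<le> prob {u. local_cut c g u}"
      using imp by (intro finite_measure_mono events_depends_on[OF depends_on_local_cut]) auto
    finally show ?thesis by simp
  qed
  show ?thesis
  proof (rule that)
    show "0 < p1 ^ (2 * h) / 2" using p1 by simp
    show "p1 ^ (2 * h) / 2 \<le> 1" using p1 by (simp add: power_le_one order_trans[of _ 1])
  qed (rule main)
qed


lemma depends_on_cut: "depends_on (cut c n) {..<n}"
  unfolding cut_def[abs_def]
  by (intro depends_on_Ball depends_on_comp[of _ _ "\<lambda>x. x > 0"] depends_on_mono[OF depends_on_sumZ]) auto

lemma no_local_cut_probability:
  assumes p: "\<And>c g. g \<le> c \<Longrightarrow> p \<le> prob {u. local_cut c g u}"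
  shows "prob {u. \<forall>i\<in>{..<j}. \<not> local_cut (k + g + 2 * g * i) g u} \<le> (1 - p) ^ j"
proof (induction j)
  case 0
  show ?case using prob_space by simp
next
  case (Suc j)
  let ?c = "\<lambda>i. k + g + 2 * g * i"
  have d1: "depends_on (\<lambda>u. \<forall>i\<in>{..<j}. \<not> local_cut (?c i) g u) {..<k + 2 * g * j}"
  proof (intro depends_on_Ball depends_on_comp[of _ _ Not] depends_on_mono[OF depends_on_local_cut])
    fix i assume "i \<in> {..<j}"
    then have "2 * g * (i + 1) \<le> 2 * g * j" by (intro mult_le_mono) auto
    then show "{?c i - g..<?c i + g} \<subseteq> {..<k + 2 * g * j}" by (auto simp: algebra_simps)
  qed
  have d2: "depends_on (\<lambda>u. \<not> local_cut (?c j) g u) {?c j - g..<?c j + g}"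
    by (rule depends_on_comp[OF depends_on_local_cut])
  have "{u. \<not> local_cut (?c j) g u} = space P - {u. local_cut (?c j) g u}" by auto
  then have P2: "prob {u. \<not> local_cut (?c j) g u} \<le> 1 - p"
    using prob_compl[OF events_depends_on[OF depends_on_local_cut], of "?c j" g] p[of g "?c j"] by simp
  have "prob {u. \<forall>i\<in>{..<Suc j}. \<not> local_cut (?c i) g u}
      = prob {u. (\<forall>i\<in>{..<j}. \<not> local_cut (?c i) g u) \<and> \<not> local_cut (?c j) g u}"
    by (rule arg_cong[where f = prob]) (auto simp: less_Suc_eq)
  also have "\<dots> = prob {u. \<forall>i\<in>{..<j}. \<not> local_cut (?c i) g u} * prob {u. \<not> local_cut (?c j) g u}"
    by (rule prob_conj_indep[OF d1 _ d2]) auto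
  also have "\<dots> \<le> (1 - p) ^ j * (1 - p)"
    using P2 Suc by (intro mult_mono) (auto intro: order_trans[OF measure_nonneg])
  finally show ?case by (simp add: mult.commute)
qed

text \<open>An interval around \<open>c\<close> is either long, and then covered by the second hypothesis, or contained in the
window, and then the sum of two intervals ending and starting at \<open>c\<close>.\<close>

lemma local_cut_imp_cut:
  assumes loc: "local_cut c g u" and c: "k \<le> c"
    and far: "\<And>s t. k \<le> t \<Longrightarrow> t \<le> n \<Longrightarrow> s + g < t \<Longrightarrow> sumZ s t u > 0"
  shows "cut c n u"
  unfolding cut_def
proof (intro ballI)
  fix s t assume "s \<in> {..<c}" and t: "t \<in> {c..n}"
  then have s: "s < c" by simp
  show "sumZ s t u > 0"
  proof (cases "s + g < t")
    case True
    then show ?thesis using far t c by auto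
  next
    case False
    then have "sumZ s c u > 0" using loc s t by (auto simp: local_cut_def)
    moreover have "sumZ c t u \<ge> 0"
    proof (cases "t = c")
      case False
      then have "sumZ c t u > 0" using loc s t \<open>\<not> s + g < t\<close> by (auto simp: local_cut_def)
      then show ?thesis by simp
    qed (simp add: sumZ_def)
    ultimately show ?thesis using sumZ_split[of s c t u] s t by simp
  qed
qed

text \<open>With \<open>m = n - k\<close> and window radius \<open>g = \<lfloor>\<surd>m\<rfloor>\<close>, about \<open>g / 2\<close> disjoint windows fit into \<open>[k, n]\<close>, and
the probability that none of them shows a local cut is exponentially small in \<open>g\<close>.  So is, up to a factor
linear in \<open>m\<close>, the probability that some interval longer than \<open>g\<close> ending in \<open>[k, n]\<close> has a nonpositive
sum.\<close>

theorem cut_probability: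
  obtains A where "A \<ge> 0"
    "\<And>k n. k \<le> n \<Longrightarrow> prob {u. \<not> (\<exists>c\<in>{k..n}. cut c n u)} \<le> (A / (real (n - k) + 1) ^ 5)\<^sup>2"
proof -
  obtain p where p: "0 < p" "p \<le> 1" "\<And>c g. g \<le> c \<Longrightarrow> p \<le> prob {u. local_cut c g u}"
    by (rule local_cut_probability) blast
  obtain \<gamma> \<rho> where \<gamma>: "\<gamma> > 0" and \<rho>: "0 < \<rho>" "\<rho> < 1"
    and ld: "\<And>s t a. prob {u. sumZ s t u \<le> - a} \<le> exp (- \<gamma> * a) * \<rho> ^ (t - s)"
    by (rule exponential_drift) blast
  define q where "q = max \<rho> (1 - p)"
  have q: "0 < q" "q < 1" "\<rho> \<le> q" "1 - p \<le> q" using \<rho> p by (auto simp: q_def)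
  obtain A where A: "A \<ge> 0"
      "\<And>m. (1 + 1 / (1 - \<rho>) * (real m + 1)) * q powr (sqrt m / 2 - 1) \<le> (A / (real m + 1) ^ 5)\<^sup>2"
    by (rule stretched_exponential_decay[OF q(1,2), of "1 / (1 - \<rho>)"]) (use \<rho> in auto)
  have "prob {u. \<not> (\<exists>c\<in>{k..n}. cut c n u)} \<le> (A / (real (n - k) + 1) ^ 5)\<^sup>2" if kn: "k \<le> n" for k n
  proof -
    define m where "m = n - k"
    define g where "g = nat \<lfloor>sqrt m\<rfloor>"
    define j where "j = g div 2"
    have "real g \<le> sqrt m" by (simp add: g_def)
    then have "(real g)\<^sup>2 \<le> (sqrt m)\<^sup>2" by (intro power_mono) auto
    then have g2: "g * g \<le> m" by (simp add: power2_eq_square flip: of_nat_mult)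
    have jg: "real j \<ge> sqrt m / 2 - 1" unfolding j_def g_def by linarith
    let ?c = "\<lambda>i. k + g + 2 * g * i"
    let ?far = "\<Union>t\<in>{k..n}. \<Union>s\<in>{..<t - g}. {u. sumZ s t u \<le> - 0}"
    have "{u. \<not> (\<exists>c\<in>{k..n}. cut c n u)} \<subseteq> {u. \<forall>i\<in>{..<j}. \<not> local_cut (?c i) g u} \<union> ?far"
    proof (rule subsetI, rule ccontr)
      fix u assume u: "u \<in> {u. \<not> (\<exists>c\<in>{k..n}. cut c n u)}"
        and not: "u \<notin> {u. \<forall>i\<in>{..<j}. \<not> local_cut (?c i) g u} \<union> ?far"
      then obtain i where i: "i < j" "local_cut (?c i) g u" by auto
      have "g * (2 * (i + 1)) \<le> g * (2 * j)" using i by (intro mult_le_mono) auto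
      also have "\<dots> \<le> g * g" by (intro mult_le_mono) (auto simp: j_def)
      finally have "?c i \<le> n" using g2 kn by (simp add: m_def algebra_simps)
      moreover have "cut (?c i) n u"
      proof (rule local_cut_imp_cut[OF i(2), of k])
        fix s t assume "k \<le> t" "t \<le> n" "s + g < t"
        then show "sumZ s t u > 0" using not by (force simp: not_le)
      qed auto
      ultimately show False using u by auto
    qed
    moreover have ev: "{u. sumZ s t u \<le> a} \<in> events" for s t a
      by (rule events_depends_on[OF depends_on_comp[OF depends_on_sumZ]]) simp
    have evl: "{u. \<forall>i\<in>{..<j}. \<not> local_cut (?c i) g u} \<in> events"
    proof (rule events_depends_on)
      show "depends_on (\<lambda>u. \<forall>i\<in>{..<j}. \<not> local_cut (?c i) g u) (\<Union>i<j. {?c i - g..<?c i + g})"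
        by (intro depends_on_Ball depends_on_comp[of _ _ Not] depends_on_mono[OF depends_on_local_cut]) auto
    qed auto
    ultimately have "prob {u. \<not> (\<exists>c\<in>{k..n}. cut c n u)} \<le> prob ({u. \<forall>i\<in>{..<j}. \<not> local_cut (?c i) g u} \<union> ?far)"
      using ev by (intro finite_measure_mono sets.Un sets.finite_UN) auto
    also have "\<dots> \<le> prob {u. \<forall>i\<in>{..<j}. \<not> local_cut (?c i) g u} + prob ?far"
      using ev evl by (intro measure_Un_le sets.finite_UN) auto
    also have "prob ?far \<le> (\<Sum>t\<in>{k..n}. prob (\<Union>s\<in>{..<t - g}. {u. sumZ s t u \<le> - 0}))"
      using ev by (intro finite_measure_subadditive_finite) (auto intro!: sets.finite_UN)
    also have "\<dots> \<le> (\<Sum>t\<in>{k..n}. \<rho> ^ g * (1 / (1 - \<rho>)))"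
    proof (rule sum_mono)
      fix t
      have "prob (\<Union>s\<in>{..<t - g}. {u. sumZ s t u \<le> - 0}) \<le> (\<Sum>s\<in>{..<t - g}. prob {u. sumZ s t u \<le> - 0})"
        using ev by (intro finite_measure_subadditive_finite) auto
      also have "\<dots> \<le> (\<Sum>s\<in>{..<t - g}. \<rho> ^ (t - s))"
        using ld[of _ t 0] by (intro sum_mono) simp
      also have "\<dots> = (\<Sum>i<t - g. \<rho> ^ (g + Suc i))"
        by (rule sum.reindex_bij_witness[where i = "\<lambda>i. t - g - Suc i" and j = "\<lambda>s. t - g - Suc s"])
          (auto simp: Suc_diff_Suc simp flip: power_Suc)
      also have "\<dots> \<le> (\<Sum>i<t - g. \<rho> ^ g * \<rho> ^ i)"
        using \<rho> by (intro sum_mono) (simp add: power_add mult_left_le_one_le mult_left_mono)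
      also have "\<dots> = \<rho> ^ g * (\<Sum>i<t - g. \<rho> ^ i)" by (rule sum_distrib_left[symmetric])
      also have "\<dots> \<le> \<rho> ^ g * (1 / (1 - \<rho>))"
        using \<rho> by (intro mult_left_mono sum_powers_le) auto
      finally show "prob (\<Union>s\<in>{..<t - g}. {u. sumZ s t u \<le> - 0}) \<le> \<rho> ^ g * (1 / (1 - \<rho>))" .
    qed
    also have "\<dots> = (1 / (1 - \<rho>) * (real m + 1)) * \<rho> ^ g"
      using kn by (simp add: m_def of_nat_diff)
    also have "\<dots> \<le> (1 / (1 - \<rho>) * (real m + 1)) * q ^ j"
    proof (rule mult_left_mono)
      have "\<rho> ^ g \<le> q ^ g" using \<rho> q by (intro power_mono) auto
      also have "\<dots> \<le> q ^ j" using q by (intro power_decreasing) (auto simp: j_def)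
      finally show "\<rho> ^ g \<le> q ^ j" .
    qed (use \<rho> in auto)
    also have "prob {u. \<forall>i\<in>{..<j}. \<not> local_cut (?c i) g u} \<le> q ^ j"
      by (rule order_trans[OF no_local_cut_probability[OF p(3)] power_mono]) (use p q in auto)
    also have "q ^ j + (1 / (1 - \<rho>) * (real m + 1)) * q ^ j = (1 + 1 / (1 - \<rho>) * (real m + 1)) * q ^ j"
      by (simp add: algebra_simps)
    also have "\<dots> \<le> (1 + 1 / (1 - \<rho>) * (real m + 1)) * q powr (sqrt m / 2 - 1)"
    proof (rule mult_left_mono)
      have "q ^ j = q powr real j" using q by (simp add: powr_realpow)
      also have "\<dots> \<le> q powr (sqrt m / 2 - 1)" using q jg by (intro powr_mono') auto
      finally show "q ^ j \<le> q powr (sqrt m / 2 - 1)" .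
    qed (use \<rho> in \<open>auto intro!: add_nonneg_nonneg\<close>)
    also have "\<dots> \<le> (A / (real m + 1) ^ 5)\<^sup>2" by (rule A(2))
    finally show ?thesis by (simp add: m_def)
  qed
  then show ?thesis using that A(1) by blast
qed

end

section \<open>Walks driven by noise\<close>

text \<open>The set of steps already taken from the present site; it is the only part of the history that the
step probabilities of a once-reinforced walk with translation invariant weights depend on.\<close>

definition explored :: "(nat \<Rightarrow> 'v::ab_group_add) \<Rightarrow> nat \<Rightarrow> 'v set" where
  "explored \<omega> t = {z. traversed \<omega> t (\<omega> t) (\<omega> t + z)}"

text \<open>The recursion carries the whole path, as \<open>explored\<close> needs it; \<open>driven_path G u t\<close> is meaningful at times
up to \<open>t\<close>.  The map \<open>G\<close> turns explored set and noise into a step.\<close>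

primrec driven_path :: "('v::ab_group_add set \<Rightarrow> nat \<Rightarrow> 'v) \<Rightarrow> (nat \<Rightarrow> nat) \<Rightarrow> nat \<Rightarrow> nat \<Rightarrow> 'v" where
  "driven_path G u 0 = (\<lambda>_. 0)"
| "driven_path G u (Suc t) = (driven_path G u t)
     (Suc t := driven_path G u t t + G (explored (driven_path G u t) t) (u t))"

definition walk_pos :: "('v::ab_group_add set \<Rightarrow> nat \<Rightarrow> 'v) \<Rightarrow> (nat \<Rightarrow> nat) \<Rightarrow> nat \<Rightarrow> 'v" where
  "walk_pos G u t = driven_path G u t t"

definition walk_step :: "('v::ab_group_add set \<Rightarrow> nat \<Rightarrow> 'v) \<Rightarrow> nat \<Rightarrow> (nat \<Rightarrow> nat) \<Rightarrow> 'v" where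
  "walk_step G n u = G (explored (walk_pos G u) n) (u n)"

lemma explored_cong: "(\<And>s. s \<le> t \<Longrightarrow> \<omega> s = \<omega>' s) \<Longrightarrow> explored \<omega> t = explored \<omega>' t"
  using traversed_cong[of t \<omega> \<omega>'] by (simp add: explored_def)

lemma driven_path_eq: "s \<le> t \<Longrightarrow> driven_path G u t s = walk_pos G u s"
  by (induction t) (auto simp: walk_pos_def le_Suc_eq)

lemma walk_pos_0 [simp]: "walk_pos G u 0 = 0"
  by (simp add: walk_pos_def)

lemma walk_pos_Suc: "walk_pos G u (Suc t) = walk_pos G u t + walk_step G t u"
  using explored_cong[of t "driven_path G u t" "walk_pos G u"]
  by (simp add: walk_pos_def[of G u "Suc t"] walk_step_def driven_path_eq)

lemma walk_pos_eq_sum: "walk_pos G u t = (\<Sum>i<t. walk_step G i u)"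
  by (induction t) (auto simp: walk_pos_Suc)

lemma depends_on_walk_pos: "s \<le> t \<Longrightarrow> depends_on (\<lambda>u. walk_pos G u s) {..<t}"
proof (rule depends_onI)
  fix u v :: "nat \<Rightarrow> nat"
  assume s: "s \<le> t" and eq: "\<And>i. i \<in> {..<t} \<Longrightarrow> u i = v i"
  have "\<forall>s\<le>n. walk_pos G u s = walk_pos G v s" if "n \<le> t" for n
    using that
  proof (induction n)
    case (Suc n)
    then have IH: "walk_pos G u s = walk_pos G v s" if "s \<le> n" for s using that by simp
    have "walk_step G n u = walk_step G n v"
      using Suc.prems eq by (simp add: walk_step_def explored_cong[of n "walk_pos G u" "walk_pos G v", OF IH])
    then show ?case using IH by (auto simp: le_Suc_eq walk_pos_Suc)
  qed simp
  then show "walk_pos G u s = walk_pos G v s" using s by blast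
qed

lemma depends_on_walk_step: "depends_on (walk_step G n) {..n}"
proof -
  have "walk_step G n = (\<lambda>u. walk_pos G u (Suc n) - walk_pos G u n)"
    by (simp add: walk_pos_Suc fun_eq_iff)
  moreover have "depends_on (\<lambda>u. walk_pos G u (Suc n) - walk_pos G u n) {..<Suc n}"
    by (rule depends_on_comp2[where h = "(-)"]) (auto intro: depends_on_walk_pos)
  ultimately show ?thesis by (simp only: lessThan_Suc_atMost)
qed

text \<open>The height is additive, like a linear functional, and the noise alone guarantees an advance of
\<open>Z a\<close> whatever has been explored.\<close>

locale driven_walk = drifting_noise N Z l for N Z l +
  fixes G :: "'v::ab_group_add set \<Rightarrow> nat \<Rightarrow> 'v" and height :: "'v \<Rightarrow> real"
  assumes height_add: "height (x + y) = height x + height y"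
    and height_step: "Z a \<le> height (G T a)"
begin

lemma height_walk: "s \<le> t \<Longrightarrow> height (walk_pos G u s) + sumZ s t u \<le> height (walk_pos G u t)"
proof (induction t rule: dec_induct)
  case (step t)
  have "sumZ s (Suc t) u = sumZ s t u + Z (u t)"
    using step(1) by (simp add: sumZ_def)
  then show ?case
    using step height_step[of "u t" "explored (walk_pos G u) t"]
    by (simp add: walk_pos_Suc height_add walk_step_def)
qed (simp add: sumZ_def)

text \<open>A site visited before the cut lies strictly lower than all sites visited after it.  So the walk after the
cut never meets an edge traversed before, and its explored sets are those of the fresh walk.\<close>

lemma walk_after_cut:
  assumes cut: "cut c n u" and j: "c + j \<le> Suc n"
  shows "walk_pos G u (c + j) = walk_pos G u c + walk_pos G (restart c u) j"
  using j
proof (induction j rule: less_induct)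
  case (less j)
  show ?case
  proof (cases j)
    case (Suc i)
    let ?\<omega> = "walk_pos G u" and ?\<eta> = "walk_pos G (restart c u)"
    have IH: "?\<omega> (c + k) = ?\<omega> c + ?\<eta> k" if "k \<le> i" for k
      using less that Suc by simp
    have "explored ?\<omega> (c + i) = explored ?\<eta> i"
    proof -
      have "(\<exists>s<c + i. ?\<omega> s = ?\<omega> (c + i) \<and> ?\<omega> (Suc s) = ?\<omega> (c + i) + z) \<longleftrightarrow>
            (\<exists>k<i. ?\<eta> k = ?\<eta> i \<and> ?\<eta> (Suc k) = ?\<eta> i + z)" (is "?L \<longleftrightarrow> ?R") for z
      proof
        assume ?L
        then obtain s where s: "s < c + i" "?\<omega> s = ?\<omega> (c + i)" "?\<omega> (Suc s) = ?\<omega> (c + i) + z" by blast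
        have "c \<le> s"
        proof (rule ccontr)
          assume "\<not> c \<le> s"
          then have "sumZ s (c + i) u > 0" using cut less.prems Suc by (auto simp: cut_def)
          then show False using height_walk[of s "c + i" u] s by simp
        qed
        then obtain k where "s = c + k" using le_Suc_ex by blast
        with s IH[of k] IH[of i] IH[of "Suc k"] show ?R by (auto simp: add.assoc)
      next
        assume ?R
        then obtain k where k: "k < i" "?\<eta> k = ?\<eta> i" "?\<eta> (Suc k) = ?\<eta> i + z" by blast
        then show ?L using IH[of k] IH[of i] IH[of "Suc k"]
          by (intro exI[of _ "c + k"]) (auto simp: add.assoc)
      qed
      then show ?thesis by (simp add: explored_def traversed_def)
    qed
    then have "walk_step G (c + i) u = walk_step G i (restart c u)"
      by (simp add: walk_step_def restart_def)
    then show ?thesis using IH[of i] Suc by (simp add: walk_pos_Suc add.assoc)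
  qed simp
qed

lemma walk_step_after_cut:
  assumes "cut c n u" "c \<le> n"
  shows "walk_step G n u = walk_step G (n - c) (restart c u)"
  using walk_after_cut[OF assms(1), of "n - c"] walk_after_cut[OF assms(1), of "Suc (n - c)"] assms(2)
  by (simp add: walk_pos_Suc)

lemma cut_restart:
  assumes "cut c n u" "r \<le> c" "c \<le> n"
  shows "cut (c - r) (n - r) (restart r u)"
  unfolding cut_def
proof (intro ballI)
  fix s t assume st: "s \<in> {..<c - r}" "t \<in> {c - r..n - r}"
  have "sumZ s t (restart r u) = (\<Sum>i\<in>{s + r..<t + r}. Z (u i))"
    unfolding sumZ_def restart_def sum.shift_bounds_nat_ivl by (simp add: add.commute)
  moreover have "sumZ (s + r) (t + r) u > 0"
  proof -
    have "s + r \<in> {..<c}" "t + r \<in> {c..n}" using assms st by auto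
    then show ?thesis using assms(1) unfolding cut_def by blast
  qed
  ultimately show "sumZ s t (restart r u) > 0" by (simp add: sumZ_def)
qed

text \<open>A cut after \<open>r\<close> is also a cut for the walk restarted at \<open>r\<close>, and both walks coincide with the walk
started at the cut.\<close>

lemma walk_step_restart:
  assumes "cut c n u" "r \<le> c" "c \<le> n"
  shows "walk_step G n u = walk_step G (n - r) (restart r u)"
  using walk_step_after_cut[OF assms(1,3)] walk_step_after_cut[OF cut_restart[OF assms]] assms
  by (simp add: restart_restart)

lemma walk_step_forgets:
  obtains A where "A \<ge> 0"
    "\<And>r n. r \<le> n \<Longrightarrow> prob {u. walk_step G n u \<noteq> walk_step G (n - r) (restart r u)} \<le> (A / (real (n - r) + 1) ^ 5)\<^sup>2"
proof -
  obtain A where A: "A \<ge> 0"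
    "\<And>k n. k \<le> n \<Longrightarrow> prob {u. \<not> (\<exists>c\<in>{k..n}. cut c n u)} \<le> (A / (real (n - k) + 1) ^ 5)\<^sup>2"
    by (rule cut_probability) blast
  show ?thesis
  proof (rule that[OF A(1)])
    fix r n :: nat assume rn: "r \<le> n"
    have "depends_on (\<lambda>u. \<forall>c\<in>{r..n}. \<not> cut c n u) {..<n}"
      by (intro depends_on_Ball depends_on_comp[of _ _ Not] depends_on_cut)
    then have d: "depends_on (\<lambda>u. \<not> (\<exists>c\<in>{r..n}. cut c n u)) {..<n}" by simp
    have "prob {u. walk_step G n u \<noteq> walk_step G (n - r) (restart r u)} \<le> prob {u. \<not> (\<exists>c\<in>{r..n}. cut c n u)}"
      using walk_step_restart[where n = n and r = r]
      by (intro finite_measure_mono events_depends_on[OF d]) auto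
    then show "prob {u. walk_step G n u \<noteq> walk_step G (n - r) (restart r u)} \<le> (A / (real (n - r) + 1) ^ 5)\<^sup>2"
      using A(2)[OF rn] by simp
  qed
qed

end

section \<open>Noise for small reinforcement\<close>

lemma pmf_embed_pmf_finite:
  assumes "finite S" "\<And>x. f x \<ge> 0" "\<And>x. x \<notin> S \<Longrightarrow> f x = 0" "sum f S = 1"
  shows "pmf (embed_pmf f) x = f x"
proof (rule pmf_embed_pmf)
  have "(\<integral>\<^sup>+x. ennreal (f x) \<partial>count_space UNIV) = (\<Sum>x\<in>S. ennreal (f x))"
    using assms by (intro nn_integral_count_space') auto
  also have "\<dots> = ennreal (\<Sum>x\<in>S. f x)" using assms(2) by simp
  finally show "(\<integral>\<^sup>+x. ennreal (f x) \<partial>count_space UNIV) = 1" using assms(4) by simp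
qed (rule assms(2))

lemma pmf_expectation_finite:
  fixes h :: "'a \<Rightarrow> real"
  assumes "finite S" "set_pmf q \<subseteq> S"
  shows "measure_pmf.expectation q h = (\<Sum>x\<in>S. pmf q x * h x)"
  using integral_measure_pmf[of S q h] assms by (auto simp: mult.commute)

text \<open>The step law when the steps in \<open>T\<close> have been taken before from the present site.\<close>

definition reinforced_prob :: "('v \<Rightarrow> real) \<Rightarrow> real \<Rightarrow> 'v set \<Rightarrow> 'v set \<Rightarrow> 'v \<Rightarrow> real" where
  "reinforced_prob w \<beta> S T y = (w y + \<beta> * of_bool (y \<in> T)) / (\<Sum>z\<in>S. w z + \<beta> * of_bool (z \<in> T))"

text \<open>Each law \<open>p T\<close> dominates \<open>(1 - e) q\<close>, so it is a mixture of \<open>q\<close> and of a remainder \<open>r T\<close> with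
weights \<open>1 - e\<close> and \<open>e\<close>.  The noise consists of the coin, of a sample of \<open>q\<close> and of samples of all \<open>r T\<close>;
only the marginals of the latter matter.  When the coin chooses the remainder, the advance is bounded
below by \<open>- R\<close>, otherwise it is the height of the sample of \<open>q\<close>, independently of \<open>T\<close>.  The support of this
law is countable and is finally encoded into \<open>nat\<close>.\<close>

lemma mixture_noise:
  fixes S :: "'v set" and q :: "'v pmf" and p :: "'v set \<Rightarrow> 'v \<Rightarrow> real" and height :: "'v \<Rightarrow> real"
  assumes S: "finite S" and q: "set_pmf q \<subseteq> S"
    and p0: "\<And>T y. T \<subseteq> S \<Longrightarrow> y \<notin> S \<Longrightarrow> p T y = 0"
    and p1: "\<And>T. T \<subseteq> S \<Longrightarrow> sum (p T) S = 1"
    and pq: "\<And>T y. T \<subseteq> S \<Longrightarrow> (1 - e) * pmf q y \<le> p T y" and e: "0 < e" "e < 1"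
    and R: "\<And>x. x \<in> S \<Longrightarrow> \<bar>height x\<bar> \<le> R" and R0: "R \<ge> 0"
    and drift: "(1 - e) * measure_pmf.expectation q height - e * R > 0"
  obtains N :: "nat pmf" and G Z where
    "\<And>T a. G T a \<in> S"
    "\<And>T y. T \<subseteq> S \<Longrightarrow> pmf (map_pmf (G T) N) y = p T y"
    "\<And>a. \<bar>Z a\<bar> \<le> R" "\<And>T a. Z a \<le> height (G T a)" "measure_pmf.expectation N Z > 0"
proof -
  define r where "r T = embed_pmf (\<lambda>y. (p T y - (1 - e) * pmf q y) / e)" for T
  have q1: "sum (pmf q) S = 1" using S q by (rule sum_pmf_eq_1)
  have r: "pmf (r T) y = (p T y - (1 - e) * pmf q y) / e" if T: "T \<subseteq> S" for T y
    unfolding r_def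
  proof (rule pmf_embed_pmf_finite[OF S])
    show "(p T y - (1 - e) * pmf q y) / e \<ge> 0" for y using pq[OF T] e by simp
    show "(p T y - (1 - e) * pmf q y) / e = 0" if "y \<notin> S" for y
      using that q p0[OF T that] by (auto simp: pmf_eq_0_set_pmf)
    show "(\<Sum>y\<in>S. (p T y - (1 - e) * pmf q y) / e) = 1"
      using e q1 p1[OF T] by (simp add: sum_divide_distrib[symmetric] sum_subtractf sum_distrib_left[symmetric])
  qed
  define M where "M = pair_pmf q (Pi_pmf (Pow S) undefined r)"
  define N0 where "N0 = bind_pmf (bernoulli_pmf e) (\<lambda>b. map_pmf (Pair b) M)"
  define G0 where "G0 T = (\<lambda>\<omega> :: bool \<times> 'v \<times> ('v set \<Rightarrow> 'v). if fst \<omega> then snd (snd \<omega>) (T \<inter> S) else fst (snd \<omega>))"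
    for T :: "'v set"
  define Z0 where "Z0 = (\<lambda>\<omega> :: bool \<times> 'v \<times> ('v set \<Rightarrow> 'v). if fst \<omega> then - R else height (fst (snd \<omega>)))"
  have G0: "pmf (map_pmf (G0 T) N0) y = p (T \<inter> S) y" for T y
  proof -
    have 1: "map_pmf (\<lambda>z. snd z (T \<inter> S)) M = r (T \<inter> S)"
    proof -
      have "map_pmf (\<lambda>z. snd z (T \<inter> S)) M = map_pmf (\<lambda>f. f (T \<inter> S)) (map_pmf snd M)"
        by (simp add: pmf.map_comp o_def)
      then show ?thesis using S by (simp add: M_def map_snd_pair_pmf Pi_pmf_component)
    qed
    have 2: "map_pmf fst M = q"
      by (simp add: M_def map_fst_pair_pmf)
    have "map_pmf (G0 T) N0 = bind_pmf (bernoulli_pmf e) (\<lambda>b. map_pmf (\<lambda>z. if b then snd z (T \<inter> S) else fst z) M)"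
      by (simp add: N0_def map_bind_pmf pmf.map_comp o_def G0_def cong: if_cong)
    also have "\<dots> = bind_pmf (bernoulli_pmf e) (\<lambda>b. if b then r (T \<inter> S) else q)"
      by (intro bind_pmf_cong refl) (auto simp: 1 2)
    finally have "pmf (map_pmf (G0 T) N0) y = e * pmf (r (T \<inter> S)) y + (1 - e) * pmf q y"
      using e by (simp add: pmf_bind)
    then show ?thesis using e r[of "T \<inter> S" y] by simp
  qed
  have G0S: "G0 T \<omega> \<in> S" if "\<omega> \<in> set_pmf N0" for T \<omega>
  proof (rule ccontr)
    assume "G0 T \<omega> \<notin> S"
    then have "pmf (map_pmf (G0 T) N0) (G0 T \<omega>) = 0" unfolding G0 by (intro p0) auto
    moreover have "G0 T \<omega> \<in> set_pmf (map_pmf (G0 T) N0)" using that by auto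
    ultimately show False unfolding set_pmf_iff by blast
  qed
  have xS: "x \<in> S" if "(b, x, f) \<in> set_pmf N0" for b x f
    using that q by (auto simp: N0_def M_def)
  have Z0: "\<bar>Z0 \<omega>\<bar> \<le> R" "Z0 \<omega> \<le> height (G0 T \<omega>)" if \<omega>: "\<omega> \<in> set_pmf N0" for \<omega> T
  proof -
    obtain b x f where [simp]: "\<omega> = (b, x, f)" by (cases \<omega>) auto
    have "\<bar>height x\<bar> \<le> R" using xS[of b x f] \<omega> by (intro R) simp
    then show "\<bar>Z0 \<omega>\<bar> \<le> R" using R0 by (simp add: Z0_def)
    have "\<bar>height (G0 T \<omega>)\<bar> \<le> R" by (intro R G0S \<omega>)
    then show "Z0 \<omega> \<le> height (G0 T \<omega>)" by (auto simp: Z0_def G0_def split: if_splits)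
  qed
  have EZ0: "measure_pmf.expectation N0 Z0 > 0"
  proof -
    have "map_pmf Z0 N0 = bind_pmf (bernoulli_pmf e) (\<lambda>b. if b then return_pmf (- R) else map_pmf height q)"
    proof -
      have "map_pmf Z0 N0 = bind_pmf (bernoulli_pmf e) (\<lambda>b. map_pmf (\<lambda>z. if b then - R else height (fst z)) M)"
        by (simp add: N0_def map_bind_pmf pmf.map_comp o_def Z0_def cong: if_cong)
      also have "\<dots> = bind_pmf (bernoulli_pmf e) (\<lambda>b. if b then return_pmf (- R) else map_pmf height q)"
      proof (intro bind_pmf_cong refl)
        fix b
        have "map_pmf (\<lambda>z. height (fst z)) M = map_pmf height (map_pmf fst M)"
          by (simp add: pmf.map_comp o_def)
        then show "map_pmf (\<lambda>z. if b then - R else height (fst z)) M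
            = (if b then return_pmf (- R) else map_pmf height q)"
          by (auto simp: M_def map_fst_pair_pmf)
      qed
      finally show ?thesis .
    qed
    then have "measure_pmf.expectation (map_pmf Z0 N0) (\<lambda>z. z)
        = measure_pmf.expectation (bind_pmf (bernoulli_pmf e) (\<lambda>b. if b then return_pmf (- R) else map_pmf height q)) (\<lambda>z. z)"
      by simp
    also have "\<dots> = (\<Sum>b\<in>UNIV. pmf (bernoulli_pmf e) b *\<^sub>R
        measure_pmf.expectation (if b then return_pmf (- R) else map_pmf height q) (\<lambda>z. z))"
      using finite_subset[OF q S] by (intro pmf_expectation_bind) auto
    also have "\<dots> = (1 - e) * measure_pmf.expectation q height - e * R"
      using e by (simp add: UNIV_bool)
    finally show ?thesis using drift by simp
  qed
  \<comment> \<open>decoding maps every natural number into the support, so that the properties of \<open>G0\<close> and \<open>Z0\<close> hold everywhere\<close>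
  define A where "A = set_pmf N0"
  have A: "countable A" "A \<noteq> {}" by (simp_all add: A_def set_pmf_not_empty)
  have dec: "from_nat_into A (to_nat_on A \<omega>) = \<omega>" if "\<omega> \<in> A" for \<omega>
    using that A by (simp add: from_nat_into_to_nat_on)
  have in_A: "from_nat_into A a \<in> set_pmf N0" for a
    using from_nat_into[OF A(2)] by (simp add: A_def)
  define N where "N = map_pmf (to_nat_on A) N0"
  have N: "map_pmf (from_nat_into A) N = N0"
  proof -
    have "map_pmf (from_nat_into A) N = map_pmf (\<lambda>\<omega>. \<omega>) N0"
      unfolding N_def pmf.map_comp o_def by (rule map_pmf_cong[OF refl]) (use dec in \<open>auto simp: A_def\<close>)
    then show ?thesis by simp
  qed
  show ?thesis
  proof (rule that)
    fix T a
    show "G0 T (from_nat_into A a) \<in> S" "\<bar>Z0 (from_nat_into A a)\<bar> \<le> R"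
      "Z0 (from_nat_into A a) \<le> height (G0 T (from_nat_into A a))"
      by (intro G0S Z0 in_A)+
  next
    fix T y assume T: "T \<subseteq> S"
    have "map_pmf (\<lambda>a. G0 T (from_nat_into A a)) N = map_pmf (G0 T) (map_pmf (from_nat_into A) N)"
      by (simp add: pmf.map_comp o_def)
    then show "pmf (map_pmf (\<lambda>a. G0 T (from_nat_into A a)) N) y = p T y"
      using T by (simp add: N G0 Int_absorb2)
  next
    have "measure_pmf.expectation (map_pmf (from_nat_into A) N) Z0 = measure_pmf.expectation N (\<lambda>a. Z0 (from_nat_into A a))"
      by (rule integral_map_pmf)
    then show "measure_pmf.expectation N (\<lambda>a. Z0 (from_nat_into A a)) > 0"
      using EZ0 by (simp add: N)
  qed
qed

text \<open>If \<open>|\<beta>|\<close> is at most \<open>e / 2\<close> times the least weight, all weights change by a factor between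
\<open>1 - e / 2\<close> and \<open>1 + e / 2\<close>, and \<open>(1 - e / 2) / (1 + e / 2) \<ge> 1 - e\<close>.  The value of \<open>e\<close> makes the drift
of the mixture half of the drift \<open>v\<close> of the unreinforced law.\<close>

theorem small_reinforcement_noise:
  fixes w :: "'v \<Rightarrow> real" and height :: "'v \<Rightarrow> real"
  assumes S: "finite S" "S \<noteq> {}" and wpos: "\<And>x. x \<in> S \<Longrightarrow> w x > 0" and w0: "\<And>x. x \<notin> S \<Longrightarrow> w x = 0"
    and drift: "(\<Sum>x\<in>S. w x * height x) > 0"
  obtains \<beta>0 where "\<beta>0 > 0" "\<And>\<beta> x. \<bar>\<beta>\<bar> \<le> \<beta>0 \<Longrightarrow> x \<in> S \<Longrightarrow> w x + \<beta> > 0"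
    "\<And>\<beta>. \<bar>\<beta>\<bar> \<le> \<beta>0 \<Longrightarrow> \<exists>(N :: nat pmf) G Z l.
        (\<forall>T a. G T a \<in> S) \<and> (\<forall>T\<subseteq>S. \<forall>y. pmf (map_pmf (G T) N) y = reinforced_prob w \<beta> S T y) \<and>
        (\<forall>a. \<bar>Z a\<bar> \<le> l) \<and> (\<forall>T a. Z a \<le> height (G T a)) \<and> measure_pmf.expectation N Z > 0"
proof -
  define W where "W = sum w S"
  define wm where "wm = Min (w ` S)"
  define R where "R = (\<Sum>x\<in>S. \<bar>height x\<bar>)"
  define v where "v = (\<Sum>x\<in>S. w x * height x) / W"
  have W: "W > 0" unfolding W_def using S wpos by (intro sum_pos) auto
  have wm: "wm > 0" "\<And>x. x \<in> S \<Longrightarrow> wm \<le> w x" using S wpos by (auto simp: wm_def)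
  have R: "R \<ge> 0" "\<And>x. x \<in> S \<Longrightarrow> \<bar>height x\<bar> \<le> R"
    using S by (auto simp: R_def sum_nonneg intro: member_le_sum)
  have v: "v > 0" using drift W by (simp add: v_def)
  define e where "e = v / (2 * (v + R))"
  have e: "0 < e" "e < 1" "(1 - e) * v - e * R = v / 2"
  proof -
    show "0 < e" "e < 1" using v R(1) by (simp_all add: e_def field_simps)
    have "e * a = v / 2" if "a = v + R" for a
    proof -
      have "a > 0" using v R(1) that by simp
      then show ?thesis by (simp add: e_def flip: that)
    qed
    from this[OF refl] have "e * (v + R) = v / 2" .
    then show "(1 - e) * v - e * R = v / 2" by (simp add: algebra_simps)
  qed
  define \<beta>0 where "\<beta>0 = e / 2 * wm"
  have \<beta>0: "\<beta>0 > 0" using e wm by (simp add: \<beta>0_def)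
  have small: "\<bar>\<beta> * of_bool b\<bar> \<le> e / 2 * w x" if "\<bar>\<beta>\<bar> \<le> \<beta>0" "x \<in> S" for \<beta> x b
  proof -
    have "\<bar>\<beta>\<bar> \<le> e / 2 * w x"
      by (rule order_trans[OF that(1)[unfolded \<beta>0_def] mult_left_mono[OF wm(2)[OF that(2)]]]) (use e in simp)
    moreover have "0 \<le> e / 2 * w x" using e wpos[OF that(2)] by simp
    ultimately show ?thesis by (cases b) auto
  qed
  have low: "w x + \<beta> * of_bool b \<ge> (1 - e / 2) * w x" if "\<bar>\<beta>\<bar> \<le> \<beta>0" "x \<in> S" for \<beta> x b
    using small[OF that, of b] unfolding left_diff_distrib abs_le_iff by linarith
  have high: "w x + \<beta> * of_bool b \<le> (1 + e / 2) * w x" if "\<bar>\<beta>\<bar> \<le> \<beta>0" "x \<in> S" for \<beta> x b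
    using small[OF that, of b] unfolding distrib_right abs_le_iff by linarith
  have pos: "w x + \<beta> * of_bool b > 0" if "\<bar>\<beta>\<bar> \<le> \<beta>0" "x \<in> S" for \<beta> x b
  proof -
    have "0 < (1 - e / 2) * w x" using e wpos[OF that(2)] by simp
    then show ?thesis using low[OF that, of b] by simp
  qed
  define q where "q = embed_pmf (\<lambda>x. w x / W)"
  have q: "pmf q x = w x / W" for x
    unfolding q_def
  proof (rule pmf_embed_pmf_finite[OF S(1)])
    show "w x / W \<ge> 0" for x using W wpos[of x] w0[of x] by (cases "x \<in> S") auto
    show "w x / W = 0" if "x \<notin> S" for x using w0[OF that] by simp
    show "(\<Sum>x\<in>S. w x / W) = 1" using W by (simp add: W_def sum_divide_distrib[symmetric])
  qed
  have qS: "set_pmf q \<subseteq> S" using w0 by (fastforce simp: set_pmf_iff q)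
  have Eq: "measure_pmf.expectation q height = v"
    by (simp add: pmf_expectation_finite[OF S(1) qS] q v_def sum_divide_distrib)
  show ?thesis
  proof (rule that[OF \<beta>0])
    show "w x + \<beta> > 0" if "\<bar>\<beta>\<bar> \<le> \<beta>0" "x \<in> S" for \<beta> x
      using pos[OF that, of True] by simp
    fix \<beta> :: real assume \<beta>: "\<bar>\<beta>\<bar> \<le> \<beta>0"
    have den: "(\<Sum>z\<in>S. w z + \<beta> * of_bool (z \<in> T)) > 0" for T
      using S pos[OF \<beta>] by (intro sum_pos) auto
    have den_le: "(\<Sum>z\<in>S. w z + \<beta> * of_bool (z \<in> T)) \<le> (1 + e / 2) * W" for T
      unfolding W_def sum_distrib_left by (intro sum_mono high \<beta>)
    obtain N :: "nat pmf" and G Z where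
      "\<And>T a. G T a \<in> S"
      "\<And>T y. T \<subseteq> S \<Longrightarrow> pmf (map_pmf (G T) N) y = reinforced_prob w \<beta> S T y"
      "\<And>a. \<bar>Z a\<bar> \<le> R" "\<And>T a. Z a \<le> height (G T a)" "measure_pmf.expectation N Z > 0"
    proof (rule mixture_noise[OF S(1) qS, where p = "reinforced_prob w \<beta> S" and e = e and R = R and height = height])
      fix T y assume T: "T \<subseteq> S"
      show "reinforced_prob w \<beta> S T y = 0" if "y \<notin> S"
        using that T w0 by (auto simp: reinforced_prob_def)
      show "sum (reinforced_prob w \<beta> S T) S = 1"
        using den[of T] by (simp add: reinforced_prob_def sum_divide_distrib[symmetric])
      show "(1 - e) * pmf q y \<le> reinforced_prob w \<beta> S T y"
      proof (cases "y \<in> S")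
        case True
        have "(1 - e) * (1 + e / 2) \<le> 1 - e / 2" using e by (simp add: algebra_simps)
        then have "(1 - e) * (1 + e / 2) * w y \<le> (1 - e / 2) * w y"
          using wpos[OF True] by (intro mult_right_mono) auto
        also have "\<dots> \<le> w y + \<beta> * of_bool (y \<in> T)" by (rule low[OF \<beta> True])
        finally have le: "(1 - e) * (1 + e / 2) * w y \<le> w y + \<beta> * of_bool (y \<in> T)" .
        have "(1 - e) * (w y / W) * ((1 + e / 2) * W) = (1 - e) * (1 + e / 2) * w y"
          using W by simp
        moreover have "0 < (1 + e / 2) * W" using W e by simp
        ultimately have "(1 - e) * (w y / W) \<le> (w y + \<beta> * of_bool (y \<in> T)) / ((1 + e / 2) * W)"
          using le by (simp only: pos_le_divide_eq)
        also have "\<dots> \<le> (w y + \<beta> * of_bool (y \<in> T)) / (\<Sum>z\<in>S. w z + \<beta> * of_bool (z \<in> T))"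
          using den[of T] den_le[of T] pos[OF \<beta> True, of "y \<in> T"] W e by (intro divide_left_mono) auto
        finally show ?thesis by (simp add: q reinforced_prob_def)
      next
        case False
        then show ?thesis using T w0 by (auto simp: q reinforced_prob_def)
      qed
    next
      show "(1 - e) * measure_pmf.expectation q height - e * R > 0" using e(3) v by (simp add: Eq)
    qed (use e R in auto)
    then show "\<exists>(N :: nat pmf) G Z l.
        (\<forall>T a. G T a \<in> S) \<and> (\<forall>T\<subseteq>S. \<forall>y. pmf (map_pmf (G T) N) y = reinforced_prob w \<beta> S T y) \<and>
        (\<forall>a. \<bar>Z a\<bar> \<le> l) \<and> (\<forall>T a. Z a \<le> height (G T a)) \<and> measure_pmf.expectation N Z > 0"
      by blast
  qed
qed


section \<open>The law of the reinforced walk\<close>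

locale noise_for_walk = iid_noise N for N +
  fixes w0 :: "int ^ 'd::finite \<Rightarrow> int ^ 'd \<Rightarrow> real" and \<beta> :: real
    and S :: "(int ^ 'd) set" and G :: "(int ^ 'd) set \<Rightarrow> nat \<Rightarrow> int ^ 'd"
  assumes w0_nonneg: "w0 x y \<ge> 0"
    and w0_invariant: "w0 x y = w0 0 (y - x)"
    and S: "S = {z. w0 0 z \<noteq> 0}" "finite S" "S \<noteq> {}"
    and w0_pos: "z \<in> S \<Longrightarrow> w0 0 z + \<beta> > 0"
    and G_in: "G T a \<in> S"
    and G_law: "T \<subseteq> S \<Longrightarrow> pmf (map_pmf (G T) N) y = reinforced_prob (w0 0) \<beta> S T y"
begin

text \<open>By translation invariance, weights can be indexed by the step instead of the target.\<close>

lemma step_prob_eq: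
  assumes hist: "\<And>s. s < t \<Longrightarrow> \<omega> (Suc s) - \<omega> s \<in> S"
  shows "step_prob w0 \<beta> \<omega> t y = reinforced_prob (w0 0) \<beta> S (explored \<omega> t) (y - \<omega> t)"
proof -
  let ?f = "\<lambda>z. w0 0 z + \<beta> * of_bool (z \<in> explored \<omega> t)"
  have wt: "weight w0 \<beta> \<omega> t (\<omega> t) (\<omega> t + z) = ?f z" for z
    using w0_invariant[of "\<omega> t" "\<omega> t + z"] by (simp add: weight_def explored_def)
  have sub: "explored \<omega> t \<subseteq> S"
    using hist by (fastforce simp: explored_def traversed_def)
  have "(\<Sum>\<^sub>\<infinity>y. weight w0 \<beta> \<omega> t (\<omega> t) y) = (\<Sum>\<^sub>\<infinity>z. weight w0 \<beta> \<omega> t (\<omega> t) (\<omega> t + z))"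
  proof (rule infsum_reindex_bij_betw[symmetric])
    show "bij_betw (\<lambda>z. \<omega> t + z) UNIV UNIV"
      by (rule bij_betw_byWitness[where f' = "\<lambda>y. y - \<omega> t"]) auto
  qed
  also have "\<dots> = (\<Sum>\<^sub>\<infinity>z\<in>S. ?f z)"
    unfolding wt by (rule infsum_cong_neutral) (use sub S(1) in auto)
  also have "\<dots> = sum ?f S" using S(2) by simp
  finally show ?thesis
    using wt[of "y - \<omega> t"] by (simp add: step_prob_def reinforced_prob_def)
qed

lemma pmf_walk_kernel_noise:
  assumes hist: "\<And>s. s < t \<Longrightarrow> \<omega> (Suc s) - \<omega> s \<in> S"
  shows "pmf (walk_kernel w0 \<beta> (Suc t) \<omega>) y = pmf (map_pmf (G (explored \<omega> t)) N) (y - \<omega> t)"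
proof -
  have sub: "explored \<omega> t \<subseteq> S"
    using hist by (fastforce simp: explored_def traversed_def)
  have img: "{y. w0 x y \<noteq> 0} = (\<lambda>z. x + z) ` S" for x
  proof (intro set_eqI iffI)
    fix y assume "y \<in> {y. w0 x y \<noteq> 0}"
    then have "y - x \<in> S" using w0_invariant[of x y] by (simp add: S(1))
    then show "y \<in> (\<lambda>z. x + z) ` S" by (rule rev_image_eqI) simp
  qed (use w0_invariant[of x] in \<open>auto simp: S(1)\<close>)
  have "pmf (walk_kernel w0 \<beta> (Suc t) \<omega>) y = step_prob w0 \<beta> \<omega> t y"
  proof (rule pmf_walk_kernel)
    show "w0 x y + \<beta> > 0" if "w0 x y > 0" for x y
      using that w0_pos[of "y - x"] w0_invariant[of x y] by (simp add: S(1))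
    show "finite {y. w0 (\<omega> t) y \<noteq> 0}" unfolding img using S(2) by simp
    have "{y. w0 (\<omega> t) y \<noteq> 0} \<noteq> {}" unfolding img using S(3) by simp
    then show "\<exists>y. w0 (\<omega> t) y \<noteq> 0" by blast
    show "w0 (\<omega> s) (\<omega> (Suc s)) > 0" if "s < t" for s
      using hist[OF that] w0_invariant[of "\<omega> s" "\<omega> (Suc s)"] w0_nonneg[of "\<omega> s" "\<omega> (Suc s)"]
      by (simp add: S(1))
  qed (rule w0_nonneg)
  then show ?thesis using G_law[OF sub] step_prob_eq[of t \<omega> y] hist by simp
qed

text \<open>Given the path up to time \<open>t\<close>, the next step is a function of the explored set and of the fresh noise
\<open>u t\<close>.  A path \<open>x\<close> that the driven walk cannot follow has probability \<open>0\<close> on both sides: the kernel is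
only known along histories using edges of positive weight, but the induction hypothesis already makes
the product vanish for the others.\<close>

lemma prob_walk_cylinder:
  "prob {u. \<forall>t<n. walk_pos G u t = x t} = (\<Prod>t<n. pmf (walk_kernel w0 \<beta> t x) (x t))"
proof (induction n)
  case 0
  show ?case using prob_space by simp
next
  case (Suc n)
  show ?case
  proof (cases n)
    case 0
    then show ?thesis using prob_space by (auto simp: indicator_def)
  next
    case (Suc t)
    let ?E = "\<lambda>u. \<forall>s<n. walk_pos G u s = x s"
    show ?thesis
    proof (cases "\<exists>u. ?E u")
      case False
      then have "{u. ?E u} = {}" by blast
      then have "prob {u. ?E u} = 0" by (simp only: measure_empty)
      then have "(\<Prod>t<n. pmf (walk_kernel w0 \<beta> t x) (x t)) = 0" using Suc.IH by simp
      moreover have none: "{u. \<forall>s<Suc n. walk_pos G u s = x s} = {}" using False by (auto simp: less_Suc_eq)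
      ultimately show ?thesis unfolding none by simp
    next
      case True
      then obtain u0 where u0: "?E u0" by blast
      have hist: "x (Suc s) - x s \<in> S" if "s < t" for s
        using u0 that Suc walk_pos_Suc[of G u0 s] G_in by (simp add: walk_step_def)
      define T where "T = explored x t"
      have ex: "explored (walk_pos G u) t = T" if "?E u" for u
        unfolding T_def using that Suc by (intro explored_cong) auto
      have d1: "depends_on ?E {..<t}"
      proof -
        have "depends_on (\<lambda>u. \<forall>s\<in>{..<n}. walk_pos G u s = x s) {..<t}"
          using Suc by (intro depends_on_Ball depends_on_comp[of _ _ "\<lambda>v. v = x s" for s] depends_on_walk_pos) auto
        then show ?thesis by (simp add: Ball_def)
      qed
      have "{u. \<forall>s<Suc n. walk_pos G u s = x s} = {u. ?E u \<and> G T (u t) = x n - x t}"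
      proof (intro set_eqI)
        fix u
        have "walk_pos G u n = x n \<longleftrightarrow> G T (u t) = x n - x t" if "?E u"
          using that Suc ex[OF that] walk_pos_Suc[of G u t] by (auto simp: walk_step_def algebra_simps)
        then show "u \<in> {u. \<forall>s<Suc n. walk_pos G u s = x s} \<longleftrightarrow> u \<in> {u. ?E u \<and> G T (u t) = x n - x t}"
          by (auto simp: less_Suc_eq)
      qed
      then have "prob {u. \<forall>s<Suc n. walk_pos G u s = x s} = prob {u. ?E u \<and> G T (u t) = x n - x t}" by simp
      also have "\<dots> = prob {u. ?E u} * prob {u. G T (u t) = x n - x t}"
        by (rule prob_conj_indep[OF d1 _ depends_on_coord[of t "{t}"]]) auto
      also have "prob {u. G T (u t) = x n - x t} = pmf (map_pmf (G T) N) (x n - x t)"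
        using prob_coordinate[of t "{a. G T a = x n - x t}"] by (simp add: pmf_map vimage_def)
      also have "\<dots> = pmf (walk_kernel w0 \<beta> n x) (x n)"
        unfolding Suc T_def by (rule pmf_walk_kernel_noise[symmetric]) (rule hist)
      finally show ?thesis using Suc.IH by simp
    qed
  qed
qed

lemma countable_paths: "countable (PiE {0..<n::nat} (\<lambda>_. UNIV :: (int ^ 'd) set))"
  by (intro countable_PiE) auto

lemma measurable_walk_pos: "(\<lambda>u. walk_pos G u n) \<in> P \<rightarrow>\<^sub>M count_space UNIV"
  by (rule measurable_depends_on[OF depends_on_walk_pos[OF order_refl]]) simp

text \<open>The laws of the first \<open>n + 1\<close> positions live on a countable space and agree on singletons by the cylinder
formulas; their images under the last coordinate are the two laws in question.\<close>

lemma walk_law_eq: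
  "distr (walk_law w0 \<beta>) (count_space UNIV) (\<lambda>\<omega>. \<omega> n) = distr P (count_space UNIV) (\<lambda>u. walk_pos G u n)"
proof -
  let ?I = "{0..<Suc n}"
  let ?X = "count_space (PiE ?I (\<lambda>_. UNIV :: (int ^ 'd) set))"
  have M1: "(\<lambda>\<omega>. restrict \<omega> ?I) \<in> walk_law w0 \<beta> \<rightarrow>\<^sub>M ?X"
  proof -
    have "(\<lambda>\<omega>. restrict \<omega> ?I) \<in> PiM UNIV (\<lambda>_. count_space UNIV) \<rightarrow>\<^sub>M PiM ?I (\<lambda>_. count_space (UNIV :: (int ^ 'd) set))"
      by (rule measurable_restrict_subset) simp
    also have "PiM ?I (\<lambda>_. count_space (UNIV :: (int ^ 'd) set)) = ?X"
      by (rule count_space_PiM_finite) auto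
    finally show ?thesis by (simp only: measurable_cong_sets[OF sets_walk_law refl])
  qed
  have M2: "(\<lambda>u. restrict (walk_pos G u) ?I) \<in> P \<rightarrow>\<^sub>M ?X"
  proof -
    have "depends_on (\<lambda>u. restrict (walk_pos G u) ?I) {..<Suc n}"
      by (rule depends_onI) (auto simp: restrict_def fun_eq_iff intro!: depends_onD[OF depends_on_walk_pos[of _ "Suc n"]])
    then have "(\<lambda>u. restrict (walk_pos G u) ?I) \<in> P \<rightarrow>\<^sub>M count_space UNIV"
      by (rule measurable_depends_on) simp
    then have "(\<lambda>u. restrict (walk_pos G u) ?I) -` A \<inter> space P \<in> sets P" for A
      by (rule measurable_sets) simp
    then show ?thesis by (intro measurableI) auto
  qed
  have eq: "distr (walk_law w0 \<beta>) ?X (\<lambda>\<omega>. restrict \<omega> ?I) = distr P ?X (\<lambda>u. restrict (walk_pos G u) ?I)"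
  proof (rule measure_eqI_countable[OF _ _ countable_paths])
    fix x assume x: "x \<in> PiE ?I (\<lambda>_. UNIV :: (int ^ 'd) set)"
    have iff: "restrict \<omega> ?I = x \<longleftrightarrow> (\<forall>t<Suc n. \<omega> t = x t)" for \<omega>
      using x by (auto simp: fun_eq_iff restrict_def PiE_iff extensional_def)
    have "emeasure (distr (walk_law w0 \<beta>) ?X (\<lambda>\<omega>. restrict \<omega> ?I)) {x}
        = emeasure (walk_law w0 \<beta>) {\<omega>. \<forall>t<Suc n. \<omega> t = x t}"
      using x by (subst emeasure_distr[OF M1]) (auto simp: vimage_def iff)
    also have "\<dots> = (\<Prod>t<Suc n. ennreal (pmf (walk_kernel w0 \<beta> t x) (x t)))"
      by (rule emeasure_walk_law_cylinder)
    also have "\<dots> = ennreal (\<Prod>t<Suc n. pmf (walk_kernel w0 \<beta> t x) (x t))"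
      by (rule prod_ennreal) simp
    also have "\<dots> = emeasure P {u. \<forall>t<Suc n. walk_pos G u t = x t}"
      unfolding prob_walk_cylinder[symmetric] by (rule emeasure_eq_measure[symmetric])
    also have "\<dots> = emeasure (distr P ?X (\<lambda>u. restrict (walk_pos G u) ?I)) {x}"
      using x by (subst emeasure_distr[OF M2]) (auto simp: vimage_def iff)
    finally show "emeasure (distr (walk_law w0 \<beta>) ?X (\<lambda>\<omega>. restrict \<omega> ?I)) {x}
        = emeasure (distr P ?X (\<lambda>u. restrict (walk_pos G u) ?I)) {x}" .
  qed auto
  have ev: "(\<lambda>x. x n) \<in> ?X \<rightarrow>\<^sub>M count_space UNIV" by simp
  have "distr (distr (walk_law w0 \<beta>) ?X (\<lambda>\<omega>. restrict \<omega> ?I)) (count_space UNIV) (\<lambda>x. x n)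
      = distr (walk_law w0 \<beta>) (count_space UNIV) (\<lambda>\<omega>. \<omega> n)"
    by (subst distr_distr[OF ev M1]) (simp add: o_def)
  moreover have "distr (distr P ?X (\<lambda>u. restrict (walk_pos G u) ?I)) (count_space UNIV) (\<lambda>x. x n)
      = distr P (count_space UNIV) (\<lambda>u. walk_pos G u n)"
    by (subst distr_distr[OF ev M2]) (simp add: o_def)
  ultimately show ?thesis using eq by simp
qed

lemma measurable_walk_coordinate: "(\<lambda>\<omega>. \<omega> n) \<in> walk_law w0 \<beta> \<rightarrow>\<^sub>M count_space UNIV"
  unfolding measurable_cong_sets[OF sets_walk_law refl] by (rule measurable_component_singleton) simp

lemma walk_law_integral:
  fixes f :: "int ^ 'd \<Rightarrow> 'b::{banach, second_countable_topology}"
  shows "(\<integral>\<omega>. f (\<omega> n) \<partial>walk_law w0 \<beta>) = (\<integral>u. f (walk_pos G u n) \<partial>P)"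
  using integral_distr[OF measurable_walk_coordinate, of f n] integral_distr[OF measurable_walk_pos, of f n]
  by (simp add: walk_law_eq)

lemma walk_law_distr:
  fixes f :: "int ^ 'd \<Rightarrow> 'b::topological_space"
  shows "distr (walk_law w0 \<beta>) borel (\<lambda>\<omega>. f (\<omega> n)) = distr P borel (\<lambda>u. f (walk_pos G u n))"
proof -
  have f: "f \<in> count_space UNIV \<rightarrow>\<^sub>M borel" by simp
  show ?thesis
    using distr_distr[OF f measurable_walk_coordinate[of n]] distr_distr[OF f measurable_walk_pos[of n]]
    by (simp add: walk_law_eq o_def)
qed

end

section \<open>Weak convergence from characteristic functions\<close>

text \<open>The phase \<open>c\<close> covers sines and, with \<open>t = 0\<close>, constants.\<close>

inductive trig_poly :: "('a::real_inner \<Rightarrow> real) \<Rightarrow> bool" where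
  wave: "trig_poly (\<lambda>x. a * cos (t \<bullet> x + c))"
| add: "trig_poly f \<Longrightarrow> trig_poly g \<Longrightarrow> trig_poly (\<lambda>x. f x + g x)"

lemma trig_poly_const: "trig_poly (\<lambda>_. c)"
  using trig_poly.wave[of c 0 0] by simp

lemma trig_poly_wave_mult: "trig_poly g \<Longrightarrow> trig_poly (\<lambda>x. a * cos (t \<bullet> x + c) * g x)"
proof (induction rule: trig_poly.induct)
  case (wave a' t' c')
  have "a * cos (t \<bullet> x + c) * (a' * cos (t' \<bullet> x + c'))
      = a * a' / 2 * cos ((t - t') \<bullet> x + (c - c')) + a * a' / 2 * cos ((t + t') \<bullet> x + (c + c'))" for x
  proof -
    have "a * cos (t \<bullet> x + c) * (a' * cos (t' \<bullet> x + c')) = a * a' * (cos (t \<bullet> x + c) * cos (t' \<bullet> x + c'))"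
      by simp
    also have "\<dots> = a * a' * ((cos (t \<bullet> x + c - (t' \<bullet> x + c')) + cos (t \<bullet> x + c + (t' \<bullet> x + c'))) / 2)"
      by (simp only: cos_times_cos)
    finally show ?thesis
      by (simp add: inner_diff_left inner_add_left algebra_simps)
  qed
  then show ?case
    by (simp only:) (intro trig_poly.add trig_poly.wave)
next
  case (add f g)
  then show ?case
    using trig_poly.add[OF add.IH] by (simp add: algebra_simps)
qed

lemma trig_poly_mult: "trig_poly f \<Longrightarrow> trig_poly g \<Longrightarrow> trig_poly (\<lambda>x. f x * g x)"
proof (induction rule: trig_poly.induct)
  case (wave a t c)
  then show ?case by (rule trig_poly_wave_mult)
next
  case (add f1 f2)
  then show ?case
    using trig_poly.add[of "\<lambda>x. f1 x * g x" "\<lambda>x. f2 x * g x"] by (simp add: algebra_simps)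
qed

lemma trig_poly_continuous: "trig_poly f \<Longrightarrow> continuous_on S f"
  by (induction rule: trig_poly.induct) (auto intro!: continuous_intros)

lemma trig_poly_bounded: "trig_poly f \<Longrightarrow> \<exists>B. \<forall>x. \<bar>f x\<bar> \<le> B"
proof (induction rule: trig_poly.induct)
  case (wave a t c)
  have "\<bar>a * cos (t \<bullet> x + c)\<bar> \<le> \<bar>a\<bar>" for x
    using mult_left_mono[OF abs_cos_le_one, of "\<bar>a\<bar>" "t \<bullet> x + c"] by (simp add: abs_mult)
  then show ?case by blast
next
  case (add f g)
  then obtain A B where "\<forall>x. \<bar>f x\<bar> \<le> A" "\<forall>x. \<bar>g x\<bar> \<le> B" by blast
  then have "\<bar>f x + g x\<bar> \<le> A + B" for x
    using abs_triangle_ineq[of "f x" "g x"] by (meson add_mono order_trans)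
  then show ?case by blast
qed

text \<open>This is what allows a trigonometric polynomial to be truncated, up to a uniformly small error, by
polynomial approximation of the truncation.\<close>

lemma trig_poly_compose_polynomial:
  fixes p :: "real \<Rightarrow> real"
  assumes "real_polynomial_function p" "trig_poly f"
  shows "trig_poly (\<lambda>x. p (f x))"
  using assms(1)
proof (induction rule: real_polynomial_function.induct)
  case (linear h)
  obtain c where "\<And>x. h x = x * c"
    using linear by (auto simp: real_bounded_linear)
  then show ?case using trig_poly_mult[OF assms(2) trig_poly_const[of c]] by simp
qed (auto intro: trig_poly_const trig_poly.add trig_poly_mult)

lemma trig_poly_separates:
  fixes x y :: "'a::real_inner"
  assumes "x \<noteq> y" shows "\<exists>f. trig_poly f \<and> f x \<noteq> f y"
proof -
  define t where "t = (x - y) /\<^sub>R (norm (x - y))\<^sup>2"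
  define c where "c = - (t \<bullet> y)"
  have "t \<bullet> x + c = t \<bullet> (x - y)" by (simp add: c_def inner_diff_right)
  also have "\<dots> = 1" using assms by (simp add: t_def power2_norm_eq_inner)
  finally have "t \<bullet> x + c = 1" .
  moreover have "t \<bullet> y + c = 0" by (simp add: c_def)
  moreover have "cos (1::real) < cos 0"
    using pi_gt3 by (intro cos_monotone_0_pi) auto
  ultimately have "1 * cos (t \<bullet> x + c) \<noteq> 1 * cos (t \<bullet> y + c)" by simp
  then show ?thesis using trig_poly.wave[of 1 t c] by blast
qed

text \<open>By Stone-Weierstrass \<open>f\<close> is close to a trigonometric polynomial \<open>h\<close> on the ball, but \<open>h\<close> may be large
outside.  Truncating the values of \<open>h\<close> to \<open>[-B, B]\<close> does not spoil the approximation, and a polynomial in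
\<open>h\<close> imitates the truncation uniformly on the whole space because \<open>h\<close> is bounded.\<close>

lemma trig_poly_approximation:
  fixes f :: "'a::euclidean_space \<Rightarrow> real"
  assumes f: "continuous_on UNIV f" and B: "\<And>x. \<bar>f x\<bar> \<le> B" and e: "0 < e"
  obtains g where "trig_poly g" "\<And>x. norm x \<le> R \<Longrightarrow> \<bar>f x - g x\<bar> \<le> 2 * e" "\<And>x. \<bar>g x\<bar> \<le> B + e"
proof -
  have B0: "B \<ge> 0" using B[of 0] by linarith
  obtain h where h: "trig_poly h" "\<forall>x\<in>cball 0 R. \<bar>f x - h x\<bar> < e"
    using Stone_Weierstrass_HOL[of "cball 0 R" trig_poly f e]
    by (auto intro: trig_poly_const trig_poly.add trig_poly_mult trig_poly_continuous
        trig_poly_separates continuous_on_subset[OF f] e)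
  obtain M where M: "\<And>x. \<bar>h x\<bar> \<le> M" using trig_poly_bounded[OF h(1)] by blast
  define clip where "clip y = max (- B) (min B y)" for y
  have clip_cont: "continuous_on {- M..M} clip"
    unfolding clip_def by (intro continuous_intros)
  obtain p where p: "real_polynomial_function p" "\<And>y. y \<in> {- M..M} \<Longrightarrow> \<bar>clip y - p y\<bar> < e"
    by (rule Stone_Weierstrass_real_polynomial_function[OF _ clip_cont e]) auto
  have p': "\<bar>clip (h x) - p (h x)\<bar> < e" for x
    using M[of x] by (intro p(2)) auto
  show ?thesis
  proof (rule that[of "\<lambda>x. p (h x)"])
    show "trig_poly (\<lambda>x. p (h x))" by (rule trig_poly_compose_polynomial[OF p(1) h(1)])
    show "\<bar>p (h x)\<bar> \<le> B + e" for x
      using p'[of x] B0 by (auto simp: clip_def max_def min_def split: if_splits)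
    fix x :: 'a assume "norm x \<le> R"
    then have "\<bar>f x - h x\<bar> < e" using h(2) by simp
    then have "\<bar>f x - clip (h x)\<bar> < e"
      using B[of x] by (auto simp: clip_def max_def min_def)
    then show "\<bar>f x - p (h x)\<bar> \<le> 2 * e" using p'[of x] by linarith
  qed
qed

lemma trig_poly_integral_limit:
  fixes \<mu> :: "nat \<Rightarrow> 'a::euclidean_space measure"
  assumes \<mu>: "\<And>n. prob_space (\<mu> n)" "\<And>n. sets (\<mu> n) = sets borel"
    and \<nu>: "prob_space \<nu>" "sets \<nu> = sets borel"
    and char: "\<And>t. (\<lambda>n. \<integral>x. iexp (t \<bullet> x) \<partial>\<mu> n) \<longlonglongrightarrow> (\<integral>x. iexp (t \<bullet> x) \<partial>\<nu>)"
    and g: "trig_poly g"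
  shows "(\<lambda>n. \<integral>x. g x \<partial>\<mu> n) \<longlonglongrightarrow> (\<integral>x. g x \<partial>\<nu>)"
proof -
  have int: "integrable m f"
    if "prob_space m" "sets m = sets borel" "continuous_on UNIV f" "\<And>x. norm (f x) \<le> B"
    for m :: "'a measure" and f :: "'a \<Rightarrow> 'b::{banach, second_countable_topology}" and B
  proof -
    interpret prob_space m by fact
    have "f \<in> borel_measurable m"
      using borel_measurable_continuous_onI[OF that(3)] measurable_cong_sets[OF that(2) refl] by blast
    then show ?thesis using that(4) by (intro integrable_const_bound[of _ B]) auto
  qed
  have wave_integral: "(\<integral>x. a * cos (t \<bullet> x + c) \<partial>m) = a * Re (iexp c * (\<integral>x. iexp (t \<bullet> x) \<partial>m))"
    if m: "prob_space m" "sets m = sets borel" for m :: "'a measure" and a c t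
  proof -
    have i: "integrable m (\<lambda>x. iexp c * iexp (t \<bullet> x))"
      by (intro integrable_mult_right int[OF m, of _ 1]) (auto intro!: continuous_intros)
    have "(\<integral>x. a * cos (t \<bullet> x + c) \<partial>m) = a * (\<integral>x. Re (iexp c * iexp (t \<bullet> x)) \<partial>m)"
      by (simp add: cis_conv_exp[symmetric] cis_mult add.commute)
    also have "(\<integral>x. Re (iexp c * iexp (t \<bullet> x)) \<partial>m) = Re (\<integral>x. iexp c * iexp (t \<bullet> x) \<partial>m)"
      by (rule integral_Re[OF i])
    finally show ?thesis by simp
  qed
  show ?thesis using g
  proof (induction rule: trig_poly.induct)
    case (wave a t c)
    show ?case
      unfolding wave_integral[OF \<mu>] wave_integral[OF \<nu>] by (intro tendsto_intros char)
  next
    case (add f1 f2)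
    have "integrable m f" if f: "trig_poly f" and "prob_space m" "sets m = sets borel" for f and m :: "'a measure"
    proof -
      obtain B where "\<forall>x. \<bar>f x\<bar> \<le> B" using trig_poly_bounded[OF f] by blast
      then show ?thesis by (intro int[of m f B] that trig_poly_continuous) auto
    qed
    then show ?case
      using add \<mu> \<nu> tendsto_add[OF add.IH] by (simp add: Bochner_Integration.integral_add)
  qed
qed

text \<open>By tightness a bounded continuous function may be replaced, at small cost in all integrals, by a
trigonometric polynomial that is close to it on a large ball and of almost the same bound outside.\<close>

theorem weak_convergence_from_characteristic_functions:
  fixes \<mu> :: "nat \<Rightarrow> 'a::euclidean_space measure"
  assumes \<mu>: "\<And>n. prob_space (\<mu> n)" "\<And>n. sets (\<mu> n) = sets borel"
    and \<nu>: "prob_space \<nu>" "sets \<nu> = sets borel"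
    and char: "\<And>t. (\<lambda>n. \<integral>x. iexp (t \<bullet> x) \<partial>\<mu> n) \<longlonglongrightarrow> (\<integral>x. iexp (t \<bullet> x) \<partial>\<nu>)"
    and tight: "\<And>e. e > 0 \<Longrightarrow> \<exists>R. \<forall>n. measure (\<mu> n) {x. norm x > R} \<le> e"
  shows "converges_weakly \<mu> \<nu>"
  unfolding converges_weakly_def
proof (intro allI impI)
  fix f :: "'a \<Rightarrow> real"
  assume "continuous_on UNIV f \<and> bounded (range f)"
  then obtain B where f: "continuous_on UNIV f" and B: "\<And>x. \<bar>f x\<bar> \<le> B"
    by (auto simp: bounded_iff)
  have B0: "B \<ge> 0" using B[of 0] by linarith
  have tight\<nu>: "\<exists>R. measure \<nu> {x. norm x > R} \<le> e" if "e > 0" for e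
  proof -
    interpret prob_space \<nu> by fact
    have "(\<lambda>n. measure \<nu> {x. norm x > real n}) \<longlonglongrightarrow> measure \<nu> (\<Inter>n. {x. norm x > real n})"
    proof (rule finite_Lim_measure_decseq)
      show "range (\<lambda>n. {x. norm x > real n}) \<subseteq> events" by (auto simp: \<nu>)
      show "decseq (\<lambda>n. {x::'a. norm x > real n})" by (auto simp: decseq_def)
    qed
    also have "(\<Inter>n. {x::'a. norm x > real n}) = {}"
    proof -
      have "\<exists>n. \<not> norm x > real n" for x :: 'a
        using reals_Archimedean2[of "norm x"] by (auto simp: not_less intro: less_imp_le)
      then show ?thesis by auto
    qed
    finally have "eventually (\<lambda>n. measure \<nu> {x. norm x > real n} < e) sequentially"
      using that by (intro order_tendstoD) auto
    then obtain n where "measure \<nu> {x. norm x > real n} < e" by (auto simp: eventually_sequentially)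
    then show ?thesis by (intro exI[of _ "real n"]) simp
  qed
  have close: "\<bar>(\<integral>x. f x \<partial>m) - (\<integral>x. g x \<partial>m)\<bar> \<le> 2 * e + (2 * B + e) * e"
    if m: "prob_space m" "sets m = sets borel" and R: "measure m {x. norm x > R} \<le> e"
      and g: "trig_poly g" "\<And>x. norm x \<le> R \<Longrightarrow> \<bar>f x - g x\<bar> \<le> 2 * e" "\<And>x. \<bar>g x\<bar> \<le> B + e" and e: "e > 0"
    for m :: "'a measure" and g e R
  proof -
    interpret prob_space m by fact
    have meas: "f \<in> borel_measurable m" "g \<in> borel_measurable m"
      using borel_measurable_continuous_onI[OF f]
        borel_measurable_continuous_onI[OF trig_poly_continuous[OF g(1)]]
        measurable_cong_sets[OF m(2) refl] by blast+
    have int: "integrable m f" "integrable m g"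
      using meas B g(3) by (auto intro: integrable_const_bound[of _ B] integrable_const_bound[of _ "B + e"])
    have ev: "{x. norm x > R} \<in> events" by (simp add: m)
    have "\<bar>(\<integral>x. f x \<partial>m) - (\<integral>x. g x \<partial>m)\<bar> = \<bar>\<integral>x. f x - g x \<partial>m\<bar>"
      using int by simp
    also have "\<dots> \<le> (\<integral>x. \<bar>f x - g x\<bar> \<partial>m)"
      by (rule integral_abs_bound)
    also have "\<dots> \<le> (\<integral>x. 2 * e + (2 * B + e) * indicator {x. norm x > R} x \<partial>m)"
    proof (rule integral_mono)
      show "integrable m (\<lambda>x. \<bar>f x - g x\<bar>)" using int by simp
      show "integrable m (\<lambda>x. 2 * e + (2 * B + e) * indicator {x. norm x > R} x)"
        using ev by (simp add: emeasure_eq_measure)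
      fix x
      show "\<bar>f x - g x\<bar> \<le> 2 * e + (2 * B + e) * indicator {x. norm x > R} x"
        using g(2)[of x] g(3)[of x] B[of x] e by (auto simp: indicator_def not_less)
    qed
    also have "\<dots> = 2 * e + (2 * B + e) * measure m {x. norm x > R}"
      using ev prob_space by (simp add: emeasure_eq_measure)
    also have "\<dots> \<le> 2 * e + (2 * B + e) * e"
      using R B0 e by (intro add_left_mono mult_left_mono) auto
    finally show ?thesis .
  qed
  show "(\<lambda>n. \<integral>x. f x \<partial>\<mu> n) \<longlonglongrightarrow> (\<integral>x. f x \<partial>\<nu>)"
  proof (rule LIMSEQ_I)
    fix r :: real assume r: "r > 0"
    define e where "e = min 1 (r / (4 * (2 * B + 3)))"
    have e: "e > 0" "e \<le> 1" using r B0 by (auto simp: e_def)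
    have eB: "2 * e + (2 * B + e) * e \<le> r / 4"
    proof -
      have "2 * e + (2 * B + e) * e \<le> 2 * e + (2 * B + 1) * e"
        using e by (intro add_left_mono mult_right_mono) auto
      also have "\<dots> = (2 * B + 3) * e" by (simp add: algebra_simps)
      also have "\<dots> \<le> (2 * B + 3) * (r / (4 * (2 * B + 3)))"
        using B0 by (intro mult_left_mono) (auto simp: e_def)
      also have "\<dots> = r / 4" using B0 by (simp add: field_simps)
      finally show ?thesis .
    qed
    obtain R1 where R1: "\<And>n. measure (\<mu> n) {x. norm x > R1} \<le> e" using tight[OF e(1)] by blast
    obtain R2 where R2: "measure \<nu> {x. norm x > R2} \<le> e" using tight\<nu>[OF e(1)] by blast
    define R where "R = max R1 R2"
    have R: "measure (\<mu> n) {x. norm x > R} \<le> e" "measure \<nu> {x. norm x > R} \<le> e" for n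
    proof -
      interpret m: prob_space "\<mu> n" by (rule \<mu>)
      interpret n: prob_space \<nu> by (rule \<nu>)
      show "measure (\<mu> n) {x. norm x > R} \<le> e"
        by (rule order_trans[OF m.finite_measure_mono R1]) (auto simp: R_def \<mu>)
      show "measure \<nu> {x. norm x > R} \<le> e"
        by (rule order_trans[OF n.finite_measure_mono R2]) (auto simp: R_def \<nu>)
    qed
    obtain g where g: "trig_poly g" "\<And>x. norm x \<le> R \<Longrightarrow> \<bar>f x - g x\<bar> \<le> 2 * e" "\<And>x. \<bar>g x\<bar> \<le> B + e"
      by (rule trig_poly_approximation[OF f B e(1), where R = R]) blast
    have "(\<lambda>n. \<integral>x. g x \<partial>\<mu> n) \<longlonglongrightarrow> (\<integral>x. g x \<partial>\<nu>)"
      by (rule trig_poly_integral_limit[OF \<mu> \<nu> char g(1)])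
    then obtain n0 where n0: "\<And>n. n \<ge> n0 \<Longrightarrow> \<bar>(\<integral>x. g x \<partial>\<mu> n) - (\<integral>x. g x \<partial>\<nu>)\<bar> < r / 4"
      using LIMSEQ_D[of _ _ "r / 4"] r by fastforce
    show "\<exists>no. \<forall>n\<ge>no. norm ((\<integral>x. f x \<partial>\<mu> n) - (\<integral>x. f x \<partial>\<nu>)) < r"
    proof (intro exI[of _ n0] allI impI)
      fix n assume "n \<ge> n0"
      with n0[of n] order_trans[OF close[OF \<mu> R(1) g e(1), of n] eB] order_trans[OF close[OF \<nu> R(2) g e(1)] eB] r
      show "norm ((\<integral>x. f x \<partial>\<mu> n) - (\<integral>x. f x \<partial>\<nu>)) < r"
        unfolding real_norm_def by linarith
    qed
  qed
qed

section \<open>Normal laws with a given covariance matrix\<close>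

text \<open>Cholesky factorization by elimination of one index \<open>k\<close> at a time.  If \<open>Q $ k $ k = 0\<close>, semidefiniteness
makes the column \<open>k\<close> vanish; otherwise the Schur complement of that entry is again positive semidefinite,
its quadratic form being the minimum of that of \<open>Q\<close> along the direction \<open>k\<close>.\<close>

lemma psd_factorization_on:
  fixes Q :: "real ^ 'd::finite ^ 'd"
  assumes "finite S" "transpose Q = Q" "\<And>x. 0 \<le> x \<bullet> (Q *v x)" "\<And>i j. i \<notin> S \<Longrightarrow> Q $ i $ j = 0"
  shows "\<exists>a. \<forall>i j. Q $ i $ j = (\<Sum>k\<in>S. a i k * a j k)"
  using assms
proof (induction S arbitrary: Q rule: finite_induct)
  case empty
  then show ?case by simp
next
  case (insert k S Q)
  have sym: "Q $ i $ j = Q $ j $ i" for i j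
    using arg_cong[OF insert.prems(1), of "\<lambda>M. M $ i $ j"] by (simp add: transpose_def)
  have symb: "x \<bullet> (Q *v y) = y \<bullet> (Q *v x)" for x y
    by (metis dot_lmul_matrix inner_commute insert.prems(1) vector_transpose_matrix)
  define d where "d = Q $ k $ k"
  have dd: "axis i 1 \<bullet> (Q *v axis j 1) = Q $ i $ j" for i j
    by (simp add: inner_axis' matrix_vector_mul_component inner_axis)
  have d0: "d \<ge> 0" using insert.prems(2)[of "axis k 1"] by (simp add: dd d_def)
  have quad: "(x + s *\<^sub>R axis k 1) \<bullet> (Q *v (x + s *\<^sub>R axis k 1))
      = x \<bullet> (Q *v x) + 2 * s * (x \<bullet> (Q *v axis k 1)) + s\<^sup>2 * d" for x s
    using symb[of "axis k 1" x] dd[of k k]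
    by (simp add: matrix_vector_right_distrib matrix_vector_mult_scaleR inner_add_left inner_add_right
        d_def power2_eq_square algebra_simps)
  show ?case
  proof (cases "d = 0")
    case True
    have zero: "Q $ i $ k = 0" for i
    proof (rule ccontr)
      assume nz: "Q $ i $ k \<noteq> 0"
      \<comment> \<open>with \<open>d = 0\<close> the form is affine in the multiple \<open>s\<close> of the direction \<open>k\<close>, hence takes the value \<open>-1\<close>\<close>
      define s where "s = - (Q $ i $ i + 1) / (2 * Q $ i $ k)"
      have "0 \<le> Q $ i $ i + 2 * s * Q $ i $ k"
        using insert.prems(2)[of "axis i 1 + s *\<^sub>R axis k 1"] True unfolding quad by (simp add: dd)
      also have "\<dots> = - 1" using nz by (simp add: s_def field_simps)
      finally show False by simp
    qed
    have "\<exists>a. \<forall>i j. Q $ i $ j = (\<Sum>k\<in>S. a i k * a j k)"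
    proof (rule insert.IH)
      show "Q $ i $ j = 0" if "i \<notin> S" for i j
        using that insert.prems(3)[of i j] zero[of j] sym[of i j] by (cases "i = k") auto
    qed (use insert.prems in auto)
    then obtain a where a: "\<And>i j. Q $ i $ j = (\<Sum>k\<in>S. a i k * a j k)" by blast
    define a' where "a' i m = (if m = k then 0 else a i m)" for i m
    have "Q $ i $ j = (\<Sum>m\<in>insert k S. a' i m * a' j m)" for i j
      using insert.hyps unfolding a by (auto simp: a'_def intro!: sum.cong)
    then show ?thesis by blast
  next
    case False
    with d0 have d: "d > 0" by simp
    define c where "c = Q *v axis k 1"
    have ck: "c $ i = Q $ i $ k" for i
      using dd[of i k] by (simp add: c_def inner_axis')
    define Q' where "Q' = (\<chi> i j. Q $ i $ j - c $ i * c $ j / d)"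
    have "\<exists>a. \<forall>i j. Q' $ i $ j = (\<Sum>k\<in>S. a i k * a j k)"
    proof (rule insert.IH)
      show "transpose Q' = Q'"
        by (simp add: vec_eq_iff transpose_def Q'_def sym mult.commute)
      show "Q' $ i $ j = 0" if "i \<notin> S" for i j
      proof (cases "i = k")
        case True
        then show ?thesis using d sym[of k j] by (simp add: Q'_def ck d_def)
      next
        case False
        then show ?thesis using that insert.prems(3)[of i] by (simp add: Q'_def ck)
      qed
      fix x
      have "Q' *v x = Q *v x - ((c \<bullet> x) / d) *\<^sub>R c"
        by (simp add: vec_eq_iff Q'_def matrix_vector_mult_def inner_vec_def left_diff_distrib sum_subtractf
            sum_distrib_left sum_distrib_right sum_divide_distrib algebra_simps)
      then have "x \<bullet> (Q' *v x) = x \<bullet> (Q *v x) - (c \<bullet> x)\<^sup>2 / d"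
        by (simp add: inner_diff_right power2_eq_square inner_commute)
      also have "\<dots> = (x + (- (c \<bullet> x) / d) *\<^sub>R axis k 1) \<bullet> (Q *v (x + (- (c \<bullet> x) / d) *\<^sub>R axis k 1))"
        unfolding quad using d
        by (simp add: c_def[symmetric] inner_commute[of x c] power2_eq_square field_simps)
      also have "\<dots> \<ge> 0" by (rule insert.prems(2))
      finally show "0 \<le> x \<bullet> (Q' *v x)" .
    qed
    then obtain a where a: "\<And>i j. Q' $ i $ j = (\<Sum>k\<in>S. a i k * a j k)" by blast
    define a' where "a' i m = (if m = k then c $ i / sqrt d else a i m)" for i m
    have "Q $ i $ j = (\<Sum>m\<in>insert k S. a' i m * a' j m)" for i j
    proof -
      have "(\<Sum>m\<in>insert k S. a' i m * a' j m) = c $ i * c $ j / d + (\<Sum>m\<in>S. a' i m * a' j m)"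
        using insert.hyps d by (simp add: a'_def)
      also have "(\<Sum>m\<in>S. a' i m * a' j m) = Q' $ i $ j"
        unfolding a using insert.hyps by (auto simp: a'_def intro!: sum.cong)
      finally show ?thesis by (simp add: Q'_def)
    qed
    then show ?thesis by blast
  qed
qed

lemma psd_factorization:
  fixes Q :: "real ^ 'd::finite ^ 'd"
  assumes "transpose Q = Q" "\<And>x. 0 \<le> x \<bullet> (Q *v x)"
  obtains A :: "real ^ 'd ^ 'd" where "A ** transpose A = Q"
proof -
  have "\<exists>a. \<forall>i j. Q $ i $ j = (\<Sum>k\<in>(UNIV :: 'd set). a i k * a j k)"
    by (rule psd_factorization_on) (use assms in auto)
  then obtain a where a: "\<And>i j. Q $ i $ j = (\<Sum>k\<in>(UNIV :: 'd set). a i k * a j k)" by blast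
  have "(\<chi> i k. a i k) ** transpose (\<chi> i k. a i k) = Q"
    by (simp add: vec_eq_iff matrix_matrix_mult_def transpose_def a)
  then show ?thesis by (rule that)
qed

lemma measurable_vec_components:
  "(\<lambda>z. \<chi> i. z i) \<in> PiM UNIV (\<lambda>_ :: 'd::finite. std_normal_distribution) \<rightarrow>\<^sub>M (borel :: (real ^ 'd) measure)"
proof (subst borel_measurable_euclidean_space, rule ballI)
  fix b :: "real ^ 'd" assume "b \<in> Basis"
  then obtain i where b: "b = axis i 1" by (auto simp: Basis_vec_def)
  have "(\<lambda>z. z i) \<in> PiM UNIV (\<lambda>_ :: 'd. std_normal_distribution) \<rightarrow>\<^sub>M std_normal_distribution"
    by (rule measurable_component_singleton) simp
  then show "(\<lambda>z. (\<chi> i. z i) \<bullet> b) \<in> borel_measurable (PiM UNIV (\<lambda>_ :: 'd. std_normal_distribution))"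
    by (simp add: b inner_axis)
qed

lemma matrix_image_measurable: "(\<lambda>z. (A :: real ^ 'd::finite ^ 'd) *v z) \<in> borel_measurable borel"
proof -
  have "continuous_on UNIV (\<lambda>z. A *v z)" by (rule matrix_vector_mult_linear_continuous_on)
  then show ?thesis by (rule borel_measurable_continuous_onI)
qed

lemma prob_space_normal_law:
  "prob_space (distr std_normal_vector_law borel (\<lambda>z. (A :: real ^ 'd::finite ^ 'd) *v z))"
proof -
  have "prob_space (PiM UNIV (\<lambda>_ :: 'd. std_normal_distribution))"
    by (intro prob_space_PiM prob_space_normal_density) simp
  then have "prob_space (std_normal_vector_law :: (real ^ 'd) measure)"
    unfolding std_normal_vector_law_def by (rule prob_space.prob_space_distr[OF _ measurable_vec_components])
  then show ?thesis
    by (rule prob_space.prob_space_distr) (simp add: std_normal_vector_law_def matrix_image_measurable)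
qed

lemma characteristic_function_normal_law:
  fixes A :: "real ^ 'd::finite ^ 'd"
  shows "(\<integral>x. iexp (t \<bullet> x) \<partial>distr std_normal_vector_law borel (\<lambda>z. A *v z))
    = exp (- (t \<bullet> ((A ** transpose A) *v t)) / 2)"
proof -
  define s where "s = transpose A *v t"
  interpret product_sigma_finite "\<lambda>_ :: 'd. std_normal_distribution"
    by (intro product_sigma_finite.intro prob_space_imp_sigma_finite prob_space_normal_density) simp
  have ts: "t \<bullet> (A *v z) = s \<bullet> z" for z
    by (simp add: s_def dot_lmul_matrix[symmetric] inner_commute)
  have meas: "(\<lambda>x. iexp (t \<bullet> x)) \<in> borel_measurable borel" for t :: "real ^ 'd"
    by (intro borel_measurable_continuous_onI continuous_intros)
  have "(\<integral>x. iexp (t \<bullet> x) \<partial>distr std_normal_vector_law borel (\<lambda>z. A *v z))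
      = (\<integral>z. iexp (t \<bullet> (A *v z)) \<partial>std_normal_vector_law)"
    by (rule integral_distr) (auto simp: std_normal_vector_law_def meas matrix_image_measurable)
  also have "\<dots> = (\<integral>z. iexp (s \<bullet> (\<chi> i. z i)) \<partial>PiM UNIV (\<lambda>_ :: 'd. std_normal_distribution))"
    unfolding ts std_normal_vector_law_def by (rule integral_distr[OF measurable_vec_components meas])
  also have "\<dots> = (\<integral>z. (\<Prod>i\<in>UNIV. iexp (s $ i * z i)) \<partial>PiM UNIV (\<lambda>_ :: 'd. std_normal_distribution))"
    by (simp add: inner_vec_def exp_sum sum_distrib_left)
  also have "\<dots> = (\<Prod>i\<in>UNIV. \<integral>y. iexp (s $ i * y) \<partial>std_normal_distribution)"
    by (rule product_integral_prod) (auto intro!: prob_space.integrable_iexp prob_space_normal_density)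
  also have "\<dots> = (\<Prod>i\<in>UNIV. complex_of_real (exp (- (s $ i)\<^sup>2 / 2)))"
    using char_std_normal_distribution by (simp add: char_def fun_eq_iff)
  also have "\<dots> = complex_of_real (exp (\<Sum>i\<in>UNIV. - (s $ i)\<^sup>2 / 2))"
    by (simp add: exp_sum)
  also have "(\<Sum>i\<in>UNIV. - (s $ i)\<^sup>2 / 2) = - (s \<bullet> s) / 2"
    by (simp add: inner_vec_def power2_eq_square sum_negf sum_divide_distrib)
  also have "s \<bullet> s = t \<bullet> ((A ** transpose A) *v t)"
  proof -
    have "(A ** transpose A) *v t = A *v s"
      unfolding s_def by (rule matrix_vector_mul_assoc[symmetric])
    then show ?thesis by (simp only: ts)
  qed
  finally show ?thesis by simp
qed

section \<open>Limit theorems for the reinforced walk\<close>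

lemma linear_asympI:
  assumes "\<And>n. norm (v n - real n *\<^sub>R u) \<le> C"
  shows "linear_asymp v u (\<lambda>n. 1 / real n)"
  unfolding linear_asymp_def
proof (rule bigoI[of _ C])
  show "eventually (\<lambda>n. norm (norm (v n - real n *\<^sub>R u)) \<le> C * norm (real n * (1 / real n))) sequentially"
    using eventually_gt_at_top[of 0] by eventually_elim (use assms in simp)
qed

lemma rvec_add: "rvec (x + y) = rvec x + rvec y"
  by (simp add: rvec_def vec_eq_iff)

lemma rvec_sum: "rvec (\<Sum>i\<in>I. f i) = (\<Sum>i\<in>I. rvec (f i))"
proof (induction I rule: infinite_finite_induct)
  case (insert i I)
  then show ?case by (simp add: rvec_add)
qed (simp_all add: rvec_def vec_eq_iff)

lemma norm_matrix_le: "norm (Q :: real ^ 'd::finite ^ 'e::finite) \<le> (\<Sum>i\<in>UNIV. \<Sum>j\<in>UNIV. \<bar>Q $ i $ j\<bar>)"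
proof -
  have "norm Q \<le> (\<Sum>i\<in>UNIV. norm (Q $ i))"
    unfolding norm_vec_def by (rule L2_set_le_sum) simp
  also have "\<dots> \<le> (\<Sum>i\<in>UNIV. \<Sum>j\<in>UNIV. \<bar>Q $ i $ j\<bar>)"
    by (intro sum_mono norm_le_l1_cart)
  finally show ?thesis .
qed

locale reinforced_walk =
  driven_walk N Z l G height + noise_for_walk N w0 \<beta> S G
  for N Z l and G :: "(int ^ 'd::finite) set \<Rightarrow> nat \<Rightarrow> int ^ 'd" and height w0 \<beta> S +
  fixes L :: real
  assumes step_range: "z \<in> S \<Longrightarrow> norm (rvec z) \<le> L"
begin

definition X :: "nat \<Rightarrow> (nat \<Rightarrow> nat) \<Rightarrow> real ^ 'd" where
  "X n u = rvec (walk_pos G u n)"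

lemma X_eq_sum: "X n u = (\<Sum>i<n. rvec (walk_step G i u))"
  by (simp add: X_def walk_pos_eq_sum rvec_sum)

lemma norm_step_le: "norm (rvec (walk_step G i u)) \<le> L"
  by (simp add: walk_step_def step_range G_in)

lemma norm_X_le: "norm (X n u) \<le> L * real n"
proof -
  have "norm (X n u) \<le> (\<Sum>i<n. norm (rvec (walk_step G i u)))"
    unfolding X_eq_sum by (rule norm_sum)
  also have "\<dots> \<le> real (card {..<n}) * L"
    by (rule sum_bounded_above) (rule norm_step_le)
  finally show ?thesis by (simp add: mult.commute)
qed

lemma depends_on_X: "depends_on (X n) {..<n}"
  unfolding X_def[abs_def] by (rule depends_on_comp[OF depends_on_walk_pos]) simp

lemma cylinder_X: "cylinder_fun (X n)"
  by (rule cylinder_funI[OF depends_on_X]) (auto intro: norm_X_le)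

lemma cylinder_inner_X: "cylinder_fun (\<lambda>u. t \<bullet> X n u)"
  by (rule cylinder_fun_comp[OF cylinder_X, of _ 0 "norm t"]) (auto intro: Cauchy_Schwarz_ineq2)

lemma cylinder_X_component: "cylinder_fun (\<lambda>u. X n u $ i)"
  using cylinder_inner_X[of "axis i 1" n] by (simp add: inner_axis')

text \<open>The increments of a one-dimensional projection forget their past as the walk does.\<close>

lemma directional_limits:
  "\<exists>a s C. (\<forall>n. \<bar>expectation (\<lambda>u. t \<bullet> X n u) - a * real n\<bar> \<le> C) \<and>
    (\<forall>n. \<bar>cov (\<lambda>u. t \<bullet> X n u) (\<lambda>u. t \<bullet> X n u) - s * real n\<bar> \<le> C) \<and>
    (\<lambda>n. \<integral>u. iexp ((t \<bullet> X n u - a * real n) / sqrt (real n)) \<partial>P) \<longlonglongrightarrow> exp (- s / 2)"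
proof -
  obtain A where A: "A \<ge> 0"
    "\<And>r n. r \<le> n \<Longrightarrow> prob {u. walk_step G n u \<noteq> walk_step G (n - r) (restart r u)} \<le> (A / (real (n - r) + 1) ^ 5)\<^sup>2"
    by (rule walk_step_forgets) blast
  interpret F: forgetful_increments N "\<lambda>j u. t \<bullet> rvec (walk_step G j u)" "norm t * L" A
  proof
    show "depends_on (\<lambda>u. t \<bullet> rvec (walk_step G j u)) {..j}" for j
      by (rule depends_on_comp[OF depends_on_walk_step])
    show "\<bar>t \<bullet> rvec (walk_step G j u)\<bar> \<le> norm t * L" for j u
      by (rule order_trans[OF Cauchy_Schwarz_ineq2]) (intro mult_left_mono norm_step_le norm_ge_zero)
    show "A \<ge> 0" by (rule A)
    fix r j :: nat assume rj: "r \<le> j"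
    have "depends_on (walk_step G (j - r)) {..<Suc (j - r)}"
      using depends_on_walk_step[of G "j - r"] by (simp add: lessThan_Suc_atMost)
    from depends_on_restart[OF this, of r]
    have "depends_on (\<lambda>u. walk_step G (j - r) (restart r u)) {..j}"
      by (rule depends_on_mono) (use rj in auto)
    then have "depends_on (\<lambda>u. walk_step G j u \<noteq> walk_step G (j - r) (restart r u)) {..j}"
      by (rule depends_on_comp2[OF depends_on_walk_step])
    then have "{u. walk_step G j u \<noteq> walk_step G (j - r) (restart r u)} \<in> events"
      by (rule events_depends_on) simp
    then have "prob {u. t \<bullet> rvec (walk_step G j u) \<noteq> t \<bullet> rvec (walk_step G (j - r) (restart r u))}
        \<le> prob {u. walk_step G j u \<noteq> walk_step G (j - r) (restart r u)}"
      by (intro finite_measure_mono) auto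
    also have "\<dots> \<le> (A / (real (j - r) + 1) ^ 5)\<^sup>2" by (rule A(2)[OF rj])
    finally show "prob {u. t \<bullet> rvec (walk_step G j u) \<noteq> t \<bullet> rvec (walk_step G (j - r) (restart r u))}
        \<le> (A / (real (j - r) + 1) ^ 5)\<^sup>2" .
  qed
  have S: "F.seg 0 n = (\<lambda>u. t \<bullet> X n u)" for n
  proof
    fix u
    have "F.seg 0 n u = (\<Sum>i\<in>{0..<n}. t \<bullet> rvec (walk_step G i u))"
      unfolding F.seg_def F.incr_def by simp
    also have "\<dots> = t \<bullet> X n u"
      unfolding X_eq_sum inner_sum_right lessThan_atLeast0 ..
    finally show "F.seg 0 n u = t \<bullet> X n u" .
  qed
  show ?thesis
    using F.increments_clt by (simp only: F.mean_def F.V_def S)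
qed

lemma expectation_inner: "expectation (\<lambda>u. t \<bullet> X n u) = t \<bullet> expectation (X n)"
  by (rule integral_inner_right) (rule integrable_cylinder[OF cylinder_X])

text \<open>The coefficients \<open>a t\<close> and \<open>s t\<close> of the linear growth of mean and variance in the direction \<open>t\<close> are unique,
so they inherit linearity and the quadratic nature of mean and variance at fixed times; \<open>\<Sigma>\<close> is the
polarization of \<open>s\<close>.\<close>

theorem walk_limits:
  obtains \<theta> :: "real ^ 'd" and \<Sigma> :: "real ^ 'd ^ 'd" and C where
    "\<And>i. \<theta> $ i \<in> {- L..L}" "transpose \<Sigma> = \<Sigma>" "\<And>x. 0 \<le> x \<bullet> (\<Sigma> *v x)" 
    "\<And>n i. \<bar>expectation (X n) $ i - \<theta> $ i * real n\<bar> \<le> C"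
    "\<And>n i j. \<bar>cov (\<lambda>u. X n u $ i) (\<lambda>u. X n u $ j) - \<Sigma> $ i $ j * real n\<bar> \<le> C"
    "\<And>t. (\<lambda>n. \<integral>u. iexp (t \<bullet> ((X n u - real n *\<^sub>R \<theta>) /\<^sub>R sqrt (real n))) \<partial>P) \<longlonglongrightarrow> exp (- (t \<bullet> (\<Sigma> *v t)) / 2)"
proof -
  define R where "R t a s C \<longleftrightarrow> (\<forall>n. \<bar>expectation (\<lambda>u. t \<bullet> X n u) - a * real n\<bar> \<le> C) \<and>
      (\<forall>n. \<bar>cov (\<lambda>u. t \<bullet> X n u) (\<lambda>u. t \<bullet> X n u) - s * real n\<bar> \<le> C) \<and>
      (\<lambda>n. \<integral>u. iexp ((t \<bullet> X n u - a * real n) / sqrt (real n)) \<partial>P) \<longlonglongrightarrow> exp (- s / 2)" for t a s C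
  have "\<forall>t. \<exists>a s C. R t a s C"
    unfolding R_def by (rule allI) (rule directional_limits)
  then obtain a s c where R: "\<And>t. R t (a t) (s t) (c t)" by metis
  have a: "\<bar>expectation (\<lambda>u. t \<bullet> X n u) - a t * real n\<bar> \<le> c t"
    and s: "\<bar>cov (\<lambda>u. t \<bullet> X n u) (\<lambda>u. t \<bullet> X n u) - s t * real n\<bar> \<le> c t" for t n
    using R[of t] unfolding R_def by blast+
  have ch: "(\<lambda>n. \<integral>u. iexp ((t \<bullet> X n u - a t * real n) / sqrt (real n)) \<partial>P) \<longlonglongrightarrow> exp (- s t / 2)" for t
    using R[of t] unfolding R_def by blast
  define e where "e i = (axis i 1 :: real ^ 'd)" for i
  define \<theta> where "\<theta> = (\<chi> i. a (e i))"
  define \<Sigma> where "\<Sigma> = (\<chi> i j. (s (e i + e j) - s (e i) - s (e j)) / 2)"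
  define Q where "Q n = (\<chi> i j. cov (\<lambda>u. X n u $ i) (\<lambda>u. X n u $ j))" for n
  have eX: "e i \<bullet> x = x $ i" for i and x :: "real ^ 'd" by (simp add: e_def inner_axis')
  have mean: "\<bar>expectation (X n) $ i - \<theta> $ i * real n\<bar> \<le> c (e i)" for n i
    using a[of "e i" n, unfolded expectation_inner] by (simp add: eX \<theta>_def)
  have Q_cov: "cov (\<lambda>u. t \<bullet> X n u) (\<lambda>u. t \<bullet> X n u) = t \<bullet> (Q n *v t)" for t n
    unfolding Q_def by (rule cov_inner) (rule cylinder_X_component)
  have Q_sym: "Q n $ i $ j = Q n $ j $ i" for n i j by (simp add: Q_def cov_commute)
  have polar: "Q n $ i $ j = ((e i + e j) \<bullet> (Q n *v (e i + e j)) - e i \<bullet> (Q n *v e i) - e j \<bullet> (Q n *v e j)) / 2" for n i j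
  proof -
    have "e k \<bullet> (Q n *v e m) = Q n $ k $ m" for k m
      by (simp add: eX) (simp add: e_def matrix_vector_mul_component inner_axis)
    then show ?thesis
      using Q_sym[of n i j] by (simp add: matrix_vector_right_distrib inner_add_left inner_add_right)
  qed
  define C1 where "C1 = (\<Sum>i\<in>UNIV. c (e i))"
  define C2 where "C2 = (\<Sum>i\<in>UNIV. \<Sum>j\<in>UNIV. (c (e i + e j) + c (e i) + c (e j)) / 2)"
  have c0: "c t \<ge> 0" for t using a[of t 0] by linarith
  have entries: "\<bar>Q n $ i $ j - \<Sigma> $ i $ j * real n\<bar> \<le> (c (e i + e j) + c (e i) + c (e j)) / 2" for n i j
    using s[of "e i + e j" n] s[of "e i" n] s[of "e j" n] unfolding Q_cov
    unfolding polar[of n i j] by (simp add: \<Sigma>_def abs_le_iff field_simps)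
  have le1: "c (e i) \<le> C1" for i
    unfolding C1_def by (rule member_le_sum) (auto simp: c0)
  have le2: "(c (e i + e j) + c (e i) + c (e j)) / 2 \<le> C2" for i j
  proof -
    have "(c (e i + e j) + c (e i) + c (e j)) / 2 \<le> (\<Sum>j\<in>UNIV. (c (e i + e j) + c (e i) + c (e j)) / 2)"
      by (rule member_le_sum[where f = "\<lambda>j. (c (e i + e j) + c (e i) + c (e j)) / 2"]) (auto simp: c0)
    also have "\<dots> \<le> C2"
      unfolding C2_def
      by (rule member_le_sum[where f = "\<lambda>i. \<Sum>j\<in>UNIV. (c (e i + e j) + c (e i) + c (e j)) / 2"])
         (auto simp: c0 sum_nonneg)
    finally show ?thesis .
  qed
  have s_eq: "s t = t \<bullet> (\<Sigma> *v t)" for t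
  proof (rule linear_growth_unique[OF s])
    fix n
    have "cov (\<lambda>u. t \<bullet> X n u) (\<lambda>u. t \<bullet> X n u) - t \<bullet> (\<Sigma> *v t) * real n
        = (\<Sum>i\<in>UNIV. \<Sum>j\<in>UNIV. t $ i * t $ j * (Q n $ i $ j - \<Sigma> $ i $ j * real n))"
      unfolding Q_cov quadratic_form_eq_sum
      by (simp add: right_diff_distrib sum_subtractf sum_distrib_right mult.assoc)
    also have "\<bar>\<dots>\<bar> \<le> (\<Sum>i\<in>UNIV. \<Sum>j\<in>UNIV. \<bar>t $ i * t $ j * (Q n $ i $ j - \<Sigma> $ i $ j * real n)\<bar>)"
      by (intro order_trans[OF sum_abs] sum_mono sum_abs)
    also have "\<dots> \<le> (\<Sum>i\<in>UNIV. \<Sum>j\<in>UNIV. \<bar>t $ i * t $ j\<bar> * C2)"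
      unfolding abs_mult[of "_ * _"] by (intro sum_mono mult_left_mono order_trans[OF entries le2]) auto
    finally show "\<bar>cov (\<lambda>u. t \<bullet> X n u) (\<lambda>u. t \<bullet> X n u) - t \<bullet> (\<Sigma> *v t) * real n\<bar>
        \<le> (\<Sum>i\<in>UNIV. \<Sum>j\<in>UNIV. \<bar>t $ i * t $ j\<bar> * C2)" .
  qed
  have a_eq: "a t = t \<bullet> \<theta>" for t
  proof (rule linear_growth_unique[OF a])
    fix n
    have "expectation (\<lambda>u. t \<bullet> X n u) - t \<bullet> \<theta> * real n = (\<Sum>i\<in>UNIV. t $ i * (expectation (X n) $ i - \<theta> $ i * real n))"
      unfolding expectation_inner by (simp add: inner_vec_def right_diff_distrib sum_subtractf sum_distrib_right mult.assoc)
    also have "\<bar>\<dots>\<bar> \<le> (\<Sum>i\<in>UNIV. \<bar>t $ i\<bar> * C1)"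
      by (rule order_trans[OF sum_abs]) (unfold abs_mult, intro sum_mono mult_left_mono order_trans[OF mean le1], auto)
    finally show "\<bar>expectation (\<lambda>u. t \<bullet> X n u) - t \<bullet> \<theta> * real n\<bar> \<le> (\<Sum>i\<in>UNIV. \<bar>t $ i\<bar> * C1)" .
  qed
  have comp: "\<bar>expectation (X n) $ i\<bar> \<le> L * real n" for n i
  proof -
    have "\<bar>expectation (X n) $ i\<bar> \<le> norm (expectation (X n))" by (rule component_le_norm_cart)
    also have "\<dots> \<le> expectation (\<lambda>u. norm (X n u))" by (rule integral_norm_bound)
    also have "\<dots> \<le> expectation (\<lambda>_. L * real n)"
      by (rule integral_mono) (auto intro: norm_X_le integrable_norm cylinder_X)
    finally show ?thesis using prob_space by simp
  qed
  show ?thesis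
  proof (rule that[of \<theta> \<Sigma> "max C1 C2"])
    fix i
    have "\<theta> $ i \<le> L"
      by (rule linear_growth_bound[OF mean, of _ _ 0]) (use comp in \<open>simp add: abs_le_iff\<close>)
    moreover have "- (\<theta> $ i) \<le> L"
    proof (rule linear_growth_bound[of "\<lambda>n. - (expectation (X n) $ i)" _ "c (e i)" _ 0])
      show "\<bar>- (expectation (X n) $ i) - - (\<theta> $ i) * real n\<bar> \<le> c (e i)" for n
        using mean[of n i] by (simp add: abs_le_iff)
      show "- (expectation (X n) $ i) \<le> L * real n + 0" for n using comp[of n i] by (simp add: abs_le_iff)
    qed
    ultimately show "\<theta> $ i \<in> {- L..L}" by simp
  next
    show "transpose \<Sigma> = \<Sigma>" by (simp add: vec_eq_iff transpose_def \<Sigma>_def add.commute)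
  next
    fix x :: "real ^ 'd"
    have "- s x \<le> 0"
    proof (rule linear_growth_bound[of "\<lambda>n. - cov (\<lambda>u. x \<bullet> X n u) (\<lambda>u. x \<bullet> X n u)" _ "c x" _ 0])
      show "\<bar>- cov (\<lambda>u. x \<bullet> X n u) (\<lambda>u. x \<bullet> X n u) - - s x * real n\<bar> \<le> c x" for n
        using s[of x n] by (simp add: abs_le_iff)
      show "- cov (\<lambda>u. x \<bullet> X n u) (\<lambda>u. x \<bullet> X n u) \<le> 0 * real n + 0" for n
        using cov_self_nonneg[OF cylinder_inner_X[of x n]] by simp
    qed
    then show "0 \<le> x \<bullet> (\<Sigma> *v x)" by (simp add: s_eq)
  next
    show "\<bar>expectation (X n) $ i - \<theta> $ i * real n\<bar> \<le> max C1 C2" for n i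
      using order_trans[OF mean le1, of n i] by simp
    show "\<bar>cov (\<lambda>u. X n u $ i) (\<lambda>u. X n u $ j) - \<Sigma> $ i $ j * real n\<bar> \<le> max C1 C2" for n i j
      using order_trans[OF entries le2, of n i j] by (simp add: Q_def)
    fix t
    have "t \<bullet> ((X n u - real n *\<^sub>R \<theta>) /\<^sub>R sqrt (real n)) = (t \<bullet> X n u - a t * real n) / sqrt (real n)" for n u
      by (simp add: a_eq inner_diff_right divide_inverse mult.commute)
    then show "(\<lambda>n. \<integral>u. iexp (t \<bullet> ((X n u - real n *\<^sub>R \<theta>) /\<^sub>R sqrt (real n))) \<partial>P) \<longlonglongrightarrow> exp (- (t \<bullet> (\<Sigma> *v t)) / 2)"
      using ch[of t] by (simp add: s_eq)
  qed
qed


text \<open>The laws of the rescaled positions are tight by Chebyshev's inequality, their second moments being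
bounded by the linear growth of the variance and the bounded error of the mean.\<close>

theorem walk_law_limits:
  "\<exists>(\<theta> :: real ^ 'd) (\<Sigma> :: real ^ 'd ^ 'd).
     (\<forall>i. \<theta> $ i \<in> {- L..L}) \<and>
     linear_asymp (\<lambda>n. mean_vector (walk_law w0 \<beta>) (\<lambda>\<omega>. rvec (\<omega> n))) \<theta> (\<lambda>n. 1 / real n) \<and>
     linear_asymp (\<lambda>n. covariance_matrix (walk_law w0 \<beta>) (\<lambda>\<omega>. rvec (\<omega> n))) \<Sigma> (\<lambda>n. 1 / real n) \<and>
     (\<exists>\<mu>. is_centred_normal_law \<Sigma> \<mu> \<and>
        converges_weakly
          (\<lambda>n. distr (walk_law w0 \<beta>) borel (\<lambda>\<omega>. (rvec (\<omega> n) - real n *\<^sub>R \<theta>) /\<^sub>R sqrt (real n))) \<mu>)"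
proof -
  obtain \<theta> :: "real ^ 'd" and \<Sigma> :: "real ^ 'd ^ 'd" and C where
    \<theta>: "\<And>i. \<theta> $ i \<in> {- L..L}" and
    \<Sigma>: "transpose \<Sigma> = \<Sigma>" "\<And>x. 0 \<le> x \<bullet> (\<Sigma> *v x)" and
    mean: "\<And>n i. \<bar>expectation (X n) $ i - \<theta> $ i * real n\<bar> \<le> C" and
    var: "\<And>n i j. \<bar>cov (\<lambda>u. X n u $ i) (\<lambda>u. X n u $ j) - \<Sigma> $ i $ j * real n\<bar> \<le> C" and
    char: "\<And>t. (\<lambda>n. \<integral>u. iexp (t \<bullet> ((X n u - real n *\<^sub>R \<theta>) /\<^sub>R sqrt (real n))) \<partial>P) \<longlonglongrightarrow> exp (- (t \<bullet> (\<Sigma> *v t)) / 2)"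
    by (rule walk_limits) blast
  have C0: "C \<ge> 0" using mean[of 0] by (meson abs_ge_zero order_trans)
  have expX: "expectation (\<lambda>u. X n u $ i) = expectation (X n) $ i" for n i
    using expectation_inner[of "axis i 1" n] by (simp add: inner_axis')
  have mean_vec: "mean_vector (walk_law w0 \<beta>) (\<lambda>\<omega>. rvec (\<omega> n)) = expectation (X n)" for n
    unfolding mean_vector_def X_def[abs_def] by (rule walk_law_integral)
  have cov_mat: "covariance_matrix (walk_law w0 \<beta>) (\<lambda>\<omega>. rvec (\<omega> n)) = (\<chi> i j. cov (\<lambda>u. X n u $ i) (\<lambda>u. X n u $ j))" for n
  proof -
    have "(\<integral>\<omega>. (rvec (\<omega> n) $ i - m $ i) * (rvec (\<omega> n) $ j - m $ j) \<partial>walk_law w0 \<beta>)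
        = expectation (\<lambda>u. (X n u $ i - m $ i) * (X n u $ j - m $ j))" for i j m
      unfolding X_def by (rule walk_law_integral)
    then show ?thesis
      using cov_eq_centred[OF cylinder_X_component cylinder_X_component]
      by (simp add: covariance_matrix_def mean_vec vec_eq_iff expX)
  qed
  have asymp_mean: "linear_asymp (\<lambda>n. mean_vector (walk_law w0 \<beta>) (\<lambda>\<omega>. rvec (\<omega> n))) \<theta> (\<lambda>n. 1 / real n)"
  proof (rule linear_asympI)
    fix n
    have "norm (expectation (X n) - real n *\<^sub>R \<theta>) \<le> (\<Sum>i\<in>UNIV. \<bar>(expectation (X n) - real n *\<^sub>R \<theta>) $ i\<bar>)"
      by (rule norm_le_l1_cart)
    also have "\<dots> \<le> (\<Sum>i\<in>(UNIV :: 'd set). C)"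
      by (rule sum_mono) (use mean in \<open>simp add: mult.commute\<close>)
    finally show "norm (mean_vector (walk_law w0 \<beta>) (\<lambda>\<omega>. rvec (\<omega> n)) - real n *\<^sub>R \<theta>) \<le> (\<Sum>i\<in>(UNIV :: 'd set). C)"
      by (simp only: mean_vec)
  qed
  have asymp_var: "linear_asymp (\<lambda>n. covariance_matrix (walk_law w0 \<beta>) (\<lambda>\<omega>. rvec (\<omega> n))) \<Sigma> (\<lambda>n. 1 / real n)"
  proof (rule linear_asympI)
    fix n
    let ?Q = "covariance_matrix (walk_law w0 \<beta>) (\<lambda>\<omega>. rvec (\<omega> n)) - real n *\<^sub>R \<Sigma>"
    have "norm ?Q \<le> (\<Sum>i\<in>UNIV. \<Sum>j\<in>UNIV. \<bar>?Q $ i $ j\<bar>)"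
      by (rule norm_matrix_le)
    also have "\<dots> \<le> (\<Sum>i\<in>(UNIV :: 'd set). \<Sum>j\<in>(UNIV :: 'd set). C)"
      by (intro sum_mono) (use var in \<open>simp add: cov_mat mult.commute\<close>)
    finally show "norm ?Q \<le> (\<Sum>i\<in>(UNIV :: 'd set). \<Sum>j\<in>(UNIV :: 'd set). C)" .
  qed
  obtain A :: "real ^ 'd ^ 'd" where A: "A ** transpose A = \<Sigma>"
    by (rule psd_factorization[OF \<Sigma>])
  define \<nu> where "\<nu> = distr std_normal_vector_law borel (\<lambda>z. A *v z)"
  define Y where "Y n u = (X n u - real n *\<^sub>R \<theta>) /\<^sub>R sqrt (real n)" for n u
  define \<mu> where "\<mu> n = distr P borel (Y n)" for n
  have cX: "cylinder_fun (\<lambda>u. X n u - real n *\<^sub>R \<theta>)" for n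
    by (intro cylinder_fun_diff cylinder_X cylinder_fun_const)
  have cY: "cylinder_fun (Y n)" for n
    unfolding Y_def by (rule cylinder_fun_comp[OF cX, of _ 0 "inverse (sqrt (real n))"]) auto
  have Y: "Y n \<in> borel_measurable P" for n
    using integrable_cylinder[OF cY] by (rule borel_measurable_integrable)
  have \<mu>_eq: "distr (walk_law w0 \<beta>) borel (\<lambda>\<omega>. (rvec (\<omega> n) - real n *\<^sub>R \<theta>) /\<^sub>R sqrt (real n)) = \<mu> n" for n
    unfolding \<mu>_def Y_def X_def by (rule walk_law_distr)
  have "converges_weakly \<mu> \<nu>"
  proof (rule weak_convergence_from_characteristic_functions)
    show "prob_space (\<mu> n)" "sets (\<mu> n) = sets borel" for n
      using prob_space_distr[OF Y] by (simp_all add: \<mu>_def)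
    show "prob_space \<nu>" "sets \<nu> = sets borel"
      using prob_space_normal_law by (simp_all add: \<nu>_def)
    fix t :: "real ^ 'd"
    have "(\<integral>x. iexp (t \<bullet> x) \<partial>\<mu> n) = (\<integral>u. iexp (t \<bullet> Y n u) \<partial>P)" for n
      unfolding \<mu>_def
      by (rule integral_distr[OF Y]) (intro borel_measurable_continuous_onI continuous_intros)
    then show "(\<lambda>n. \<integral>x. iexp (t \<bullet> x) \<partial>\<mu> n) \<longlonglongrightarrow> (\<integral>x. iexp (t \<bullet> x) \<partial>\<nu>)"
      unfolding \<nu>_def characteristic_function_normal_law A using char[of t] by (simp only: Y_def)
  next
    fix e :: real assume e: "e > 0"
    define K where "K = (\<Sum>i\<in>UNIV. \<bar>\<Sigma> $ i $ i\<bar> + C + C\<^sup>2)"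
    have K0: "K \<ge> 0" using C0 by (auto simp: K_def intro!: sum_nonneg)
    have second: "expectation (\<lambda>u. (norm (Y n u))\<^sup>2) \<le> K" for n
    proof (cases "n = 0")
      case True
      then show ?thesis using K0 by (simp add: Y_def)
    next
      case False
      have comp: "expectation (\<lambda>u. (X n u $ i - real n * \<theta> $ i)\<^sup>2) \<le> real n * (\<bar>\<Sigma> $ i $ i\<bar> + C + C\<^sup>2)" for i
      proof -
        define m where "m = expectation (X n) $ i"
        have i: "integrable P (\<lambda>u. X n u $ i)" "integrable P (\<lambda>u. X n u $ i * X n u $ i)"
          by (intro integrable_cylinder cylinder_fun_mult cylinder_X_component)+
        have "expectation (\<lambda>u. (X n u $ i - real n * \<theta> $ i)\<^sup>2)
            = expectation (\<lambda>u. X n u $ i * X n u $ i - 2 * (real n * \<theta> $ i) * X n u $ i + (real n * \<theta> $ i)\<^sup>2)"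
          by (rule Bochner_Integration.integral_cong) (auto simp: power2_eq_square algebra_simps)
        also have "\<dots> = cov (\<lambda>u. X n u $ i) (\<lambda>u. X n u $ i) + (m - real n * \<theta> $ i)\<^sup>2"
          using i prob_space by (simp add: cov_def expX m_def power2_eq_square algebra_simps)
        also have "\<dots> \<le> (\<bar>\<Sigma> $ i $ i\<bar> * real n + C) + C\<^sup>2"
        proof (rule add_mono)
          have "\<Sigma> $ i $ i * real n \<le> \<bar>\<Sigma> $ i $ i\<bar> * real n" by (rule mult_right_mono) auto
          then show "cov (\<lambda>u. X n u $ i) (\<lambda>u. X n u $ i) \<le> \<bar>\<Sigma> $ i $ i\<bar> * real n + C"
            using var[of n i i] by linarith
          have "\<bar>m - real n * \<theta> $ i\<bar> \<le> \<bar>C\<bar>" using mean[of n i] C0 by (simp add: m_def mult.commute)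
          then show "(m - real n * \<theta> $ i)\<^sup>2 \<le> C\<^sup>2" by (simp only: abs_le_square_iff)
        qed
        also have "\<dots> \<le> real n * (\<bar>\<Sigma> $ i $ i\<bar> + C + C\<^sup>2)"
        proof -
          have "1 * (C + C\<^sup>2) \<le> real n * (C + C\<^sup>2)"
            using False C0 by (intro mult_right_mono) auto
          then show ?thesis by (simp add: algebra_simps)
        qed
        finally show ?thesis .
      qed
      have nY: "(norm (Y n u))\<^sup>2 = (\<Sum>i\<in>UNIV. (X n u $ i - real n * \<theta> $ i)\<^sup>2) / real n" for u
      proof -
        have "(norm (Y n u))\<^sup>2 = (norm (X n u - real n *\<^sub>R \<theta>))\<^sup>2 / real n"
          by (simp add: Y_def power_mult_distrib power_inverse divide_inverse mult.commute)
        also have "\<dots> = ((X n u - real n *\<^sub>R \<theta>) \<bullet> (X n u - real n *\<^sub>R \<theta>)) / real n"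
          by (simp only: power2_norm_eq_inner)
        finally show ?thesis by (simp add: inner_vec_def power2_eq_square)
      qed
      have "expectation (\<lambda>u. (norm (Y n u))\<^sup>2) = (\<Sum>i\<in>UNIV. expectation (\<lambda>u. (X n u $ i - real n * \<theta> $ i)\<^sup>2)) / real n"
      proof -
        have "integrable P (\<lambda>u. (X n u $ i - real n * \<theta> $ i)\<^sup>2)" for i
          by (intro integrable_cylinder cylinder_fun_power cylinder_fun_diff cylinder_X_component cylinder_fun_const)
        then show ?thesis unfolding nY by (simp add: Bochner_Integration.integral_sum)
      qed
      also have "\<dots> \<le> (\<Sum>i\<in>UNIV. real n * (\<bar>\<Sigma> $ i $ i\<bar> + C + C\<^sup>2)) / real n"
        by (intro divide_right_mono sum_mono comp) simp
      also have "\<dots> = K"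
        using False by (simp add: K_def sum_distrib_left[symmetric])
      finally show ?thesis .
    qed
    define R where "R = sqrt (K / e) + 1"
    have R: "R > 0" "K \<le> e * R\<^sup>2"
    proof -
      have r0: "sqrt (K / e) \<ge> 0" using K0 e by simp
      then show "R > 0" unfolding R_def by linarith
      have "K = e * (sqrt (K / e))\<^sup>2" using K0 e by simp
      also have "\<dots> \<le> e * R\<^sup>2" using e r0 by (intro mult_left_mono power_mono) (auto simp: R_def)
      finally show "K \<le> e * R\<^sup>2" .
    qed
    have "measure (\<mu> n) {x. norm x > R} \<le> e" for n
    proof -
      have ev: "{u. norm (Y n u) > R} \<in> events"
        using measurable_sets[OF Y, of "{x. norm x > R}" n] by (simp add: vimage_def)
      have "R\<^sup>2 * prob {u. norm (Y n u) > R} = expectation (\<lambda>u. R\<^sup>2 * indicator {u. norm (Y n u) > R} u)"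
        using ev by (simp add: emeasure_eq_measure)
      also have "\<dots> \<le> expectation (\<lambda>u. (norm (Y n u))\<^sup>2)"
      proof (rule integral_mono)
        show "integrable P (\<lambda>u. R\<^sup>2 * indicator {u. norm (Y n u) > R} u)"
          using ev by (simp add: emeasure_eq_measure)
        have "cylinder_fun (\<lambda>u. norm (Y n u))"
          by (rule cylinder_fun_comp[OF cY, of _ 0 1]) auto
        then show "integrable P (\<lambda>u. (norm (Y n u))\<^sup>2)"
          by (intro integrable_cylinder cylinder_fun_power)
        show "R\<^sup>2 * indicator {u. norm (Y n u) > R} u \<le> (norm (Y n u))\<^sup>2" for u
          using R by (auto simp: indicator_def intro!: power_mono)
      qed
      also have "\<dots> \<le> R\<^sup>2 * e" using second[of n] R by (simp add: mult.commute)
      finally have "prob {u. norm (Y n u) > R} \<le> e" using R by simp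
      moreover have "measure (\<mu> n) {x. norm x > R} = prob {u. norm (Y n u) > R}"
        unfolding \<mu>_def by (subst measure_distr[OF Y]) (auto simp: vimage_def)
      ultimately show ?thesis by simp
    qed
    then show "\<exists>R. \<forall>n. measure (\<mu> n) {x. norm x > R} \<le> e" by blast
  qed
  then have "converges_weakly
      (\<lambda>n. distr (walk_law w0 \<beta>) borel (\<lambda>\<omega>. (rvec (\<omega> n) - real n *\<^sub>R \<theta>) /\<^sub>R sqrt (real n))) \<nu>"
    by (simp only: \<mu>_eq)
  moreover have "is_centred_normal_law \<Sigma> \<nu>"
    unfolding is_centred_normal_law_def \<nu>_def using A by blast
  ultimately show ?thesis using \<theta> asymp_mean asymp_var by blast
qed

end

text \<open>This makes the set of possible steps finite.\<close>

lemma finite_lattice_ball: "finite {x :: int ^ 'd::finite. norm (rvec x) \<le> L}"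
proof (rule finite_subset)
  let ?B = "(\<lambda>f. \<chi> i. f i) ` PiE (UNIV :: 'd set) (\<lambda>_. {- \<lceil>L\<rceil>..\<lceil>L\<rceil>})"
  show "finite ?B" by (intro finite_imageI finite_PiE) auto
  show "{x :: int ^ 'd. norm (rvec x) \<le> L} \<subseteq> ?B"
  proof
    fix x :: "int ^ 'd" assume "x \<in> {x. norm (rvec x) \<le> L}"
    then have "\<bar>real_of_int (x $ i)\<bar> \<le> L" for i
      using component_le_norm_cart[of "rvec x" i] by (simp add: rvec_def)
    then have "x $ i \<in> {- \<lceil>L\<rceil>..\<lceil>L\<rceil>}" for i
      by (simp add: abs_le_iff) (smt (verit) le_ceiling_iff ceiling_mono ceiling_of_int of_int_minus)
    then show "x \<in> ?B"
      by (intro image_eqI[of _ _ "\<lambda>i. x $ i"]) (auto simp: vec_eq_iff)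
  qed
qed

theorem theorem2p1:
  fixes w0 :: "int ^ 'd::finite \<Rightarrow> int ^ 'd \<Rightarrow> real" and L :: real
  assumes "\<forall>x y. w0 x y \<ge> 0"
    and "translation_invariant w0"
    and "\<exists>x y. w0 x y \<noteq> 0"
    and "finite_range L w0"
    and "drift w0 \<noteq> 0"
  shows "\<exists>\<beta>0>0. \<forall>\<beta>. \<bar>\<beta>\<bar> \<le> \<beta>0 \<longrightarrow>
    (\<exists>(\<theta> :: real ^ 'd) (\<Sigma> :: real ^ 'd ^ 'd).
       (\<forall>i. \<theta> $ i \<in> {-L..L}) \<and>
       linear_asymp (\<lambda>n. mean_vector (walk_law w0 \<beta>) (\<lambda>\<omega>. rvec (\<omega> n))) \<theta> (\<lambda>n. 1 / real n) \<and>
       linear_asymp (\<lambda>n. covariance_matrix (walk_law w0 \<beta>) (\<lambda>\<omega>. rvec (\<omega> n))) \<Sigma> (\<lambda>n. 1 / real n) \<and>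
       (\<exists>\<mu>. is_centred_normal_law \<Sigma> \<mu> \<and>
          converges_weakly
            (\<lambda>n. distr (walk_law w0 \<beta>) borel
                   (\<lambda>\<omega>. (rvec (\<omega> n) - real n *\<^sub>R \<theta>) /\<^sub>R sqrt (real n))) \<mu>))"
proof -
  define S where "S = {z. w0 0 z \<noteq> 0}"
  have inv: "w0 x y = w0 0 (y - x)" for x y
    using assms(2) unfolding translation_invariant_def by blast
  have range: "norm (rvec z) \<le> L" if "z \<in> S" for z
    using assms(4) that by (force simp: finite_range_def S_def not_less)
  have S: "finite S" "S \<noteq> {}"
  proof -
    show "finite S" by (rule finite_subset[OF _ finite_lattice_ball[of L]]) (use range in auto)
    obtain x y where "w0 x y \<noteq> 0" using assms(3) by blast
    then have "y - x \<in> S" using inv[of x y] by (simp add: S_def)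
    then show "S \<noteq> {}" by blast
  qed
  define height where "height x = drift w0 \<bullet> rvec x" for x
  have "drift w0 = (\<Sum>\<^sub>\<infinity>x\<in>S. w0 0 x *\<^sub>R rvec x)"
    unfolding drift_def by (rule infsum_cong_neutral) (auto simp: S_def)
  then have drift: "drift w0 = (\<Sum>x\<in>S. w0 0 x *\<^sub>R rvec x)" using S by simp
  have "(\<Sum>x\<in>S. w0 0 x * height x) = drift w0 \<bullet> (\<Sum>x\<in>S. w0 0 x *\<^sub>R rvec x)"
    by (simp add: height_def inner_sum_right)
  also have "\<dots> > 0" using assms(5) by (simp add: drift[symmetric])
  finally have pos_drift: "(\<Sum>x\<in>S. w0 0 x * height x) > 0" .
  have w0_S: "w0 0 x > 0" if "x \<in> S" for x
    using that assms(1) by (simp add: S_def order_less_le)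
  obtain \<beta>0 where \<beta>0: "\<beta>0 > 0" "\<And>\<beta> x. \<bar>\<beta>\<bar> \<le> \<beta>0 \<Longrightarrow> x \<in> S \<Longrightarrow> w0 0 x + \<beta> > 0"
    "\<And>\<beta>. \<bar>\<beta>\<bar> \<le> \<beta>0 \<Longrightarrow> \<exists>(N :: nat pmf) G Z l.
        (\<forall>T a. G T a \<in> S) \<and> (\<forall>T\<subseteq>S. \<forall>y. pmf (map_pmf (G T) N) y = reinforced_prob (w0 0) \<beta> S T y) \<and>
        (\<forall>a. \<bar>Z a\<bar> \<le> l) \<and> (\<forall>T a. Z a \<le> height (G T a)) \<and> measure_pmf.expectation N Z > 0"
    by (rule small_reinforcement_noise[OF S w0_S _ pos_drift]) (auto simp: S_def)
  show ?thesis
  proof (intro exI[of _ \<beta>0] conjI allI impI)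
    show "\<beta>0 > 0" by (rule \<beta>0)
    fix \<beta> :: real assume \<beta>: "\<bar>\<beta>\<bar> \<le> \<beta>0"
    from \<beta>0(3)[OF \<beta>] obtain N :: "nat pmf" and G Z l where
      noise: "\<forall>T a. G T a \<in> S" "\<forall>T\<subseteq>S. \<forall>y. pmf (map_pmf (G T) N) y = reinforced_prob (w0 0) \<beta> S T y"
        "\<forall>a. \<bar>Z a\<bar> \<le> l" "\<forall>T a. Z a \<le> height (G T a)" "measure_pmf.expectation N Z > 0"
      by (elim exE conjE)
    interpret reinforced_walk N Z l G height w0 \<beta> S L
    proof
      show "height (x + y) = height x + height y" for x y
        by (simp add: height_def rvec_add inner_add_right)
    qed (use noise S \<beta>0(2)[OF \<beta>] range assms(1) in \<open>auto simp: S_def intro: inv\<close>)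
    show "\<exists>(\<theta> :: real ^ 'd) (\<Sigma> :: real ^ 'd ^ 'd).
       (\<forall>i. \<theta> $ i \<in> {-L..L}) \<and>
       linear_asymp (\<lambda>n. mean_vector (walk_law w0 \<beta>) (\<lambda>\<omega>. rvec (\<omega> n))) \<theta> (\<lambda>n. 1 / real n) \<and>
       linear_asymp (\<lambda>n. covariance_matrix (walk_law w0 \<beta>) (\<lambda>\<omega>. rvec (\<omega> n))) \<Sigma> (\<lambda>n. 1 / real n) \<and>
       (\<exists>\<mu>. is_centred_normal_law \<Sigma> \<mu> \<and>
          converges_weakly
            (\<lambda>n. distr (walk_law w0 \<beta>) borel
                   (\<lambda>\<omega>. (rvec (\<omega> n) - real n *\<^sub>R \<theta>) /\<^sub>R sqrt (real n))) \<mu>)"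
      by (rule walk_law_limits)
  qed
qed

end
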